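(* Let $\nabla$ be an $A$-anisotropic connection on $M$ and let $P$, $\mathcal T$ and $R$ be its vertical derivative, torsion and curvature tensor, respectively. For every $v\in A$ and $u,w,z,b\in T_{\pi(v)}M$ we have $R_v(u,w)=-R_v(w,u)$, and $R$ satisfies the first Bianchi identity $$\sum_{\mathrm{cyc}:u,w,z}R_v(u,w)z=\sum_{\mathrm{cyc}:u,w,z}\big(\mathcal T_v(\mathcal T_v(u,w),z)+(\nabla_u\mathcal T)_v(w,z)\big)$$ and the second Bianchi identity $$\sum_{\mathrm{cyc}:u,w,z}\big((\nabla_uR)_v(w,z)b-P_v(w,b,R_v(u,z)v)+R_v(\mathcal T_v(u,w),z)b\big)=0,$$ where $\sum_{\mathrm{cyc}:u,w,z}$ denotes the cyclic sum over $u,w,z$.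
   Context: $M$ is a smooth manifold, $\pi:TM\to M$ its tangent bundle, $A\subset TM$ an open subset with $\pi(A)=M$, $\mathcal F(\cdot)$ denotes smooth real functions, $\mathfrak X(\cdot)$ smooth vector fields. $\mathfrak T^1_0(M,A)$ is the set of smooth maps $v\in A\mapsto\mathcal X_v\in T_{\pi(v)}M$; vector fields $X$ on $M$ are regarded as such maps via $v\mapsto X_{\pi(v)}$. An $A$-anisotropic tensor (of type $(1,s)$) is an $\mathcal F(A)$-multilinear map $T:\mathfrak T^1_0(M,A)^s\to\mathfrak T^1_0(M,A)$; it amounts to multilinear maps $T_v:(T_{\pi(v)}M)^s\to T_{\pi(v)}M$ depending smoothly on $v\in A$. A vector field $V$ on an open $\Omega\subset M$ is $A$-admissible if $V_p\in A$ for all $p\in\Omega$; it extends $v$ if $V_{\pi(v)}=v$; $(\mathcal Y_V)_p=\mathcal Y_{V_p}$. For $\mathcal Y\in\mathfrak T^1_0(M,A)$, $(\partial^\nu\mathcal Y)_v(z)=\frac{d}{dt}\mathcal Y_{v+tz}|_{t=0}$, $z\in T_{\pi(v)}M$. An $A$-anisotropic connection is a map $\nabla:A\times\mathfrak X(M)\times\mathfrak X(M)\to TM$, $(v,X,Y)\mapsto\nabla^v_XY\in T_{\pi(v)}M$, additive in $Y$, with $\nabla^v_X(fY)=X_{\pi(v)}(f)Y_{\pi(v)}+f(\pi(v))\nabla^v_XY$, $\nabla^v_{fX+hY}Z=f(\pi(v))\nabla^v_XZ+h(\pi(v))\nabla^v_YZ$ for $f,h\in\mathcal F(M)$, and with $\nabla_XY\in\mathfrak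 T^1_0(M,A)$ (smoothness in $v$). For $\mathcal Y\in\mathfrak T^1_0(M,A)$, $\nabla^v_X\mathcal Y=\nabla^v_X(\mathcal Y_V)-(\partial^\nu\mathcal Y)_v(\nabla^v_XV)$ for any local $A$-admissible extension $V$ of $v$ (independent of $V$). For an anisotropic tensor $T$ of type $(1,s)$, $(\nabla_XT)(X_1,\ldots,X_s)=\nabla_X(T(X_1,\ldots,X_s))-\sum_jT(X_1,\ldots,\nabla_XX_j,\ldots,X_s)$; $(\nabla_XT)_v$ depends only on $X_{\pi(v)}$, so $(\nabla_uT)_v$ makes sense for $u\in T_{\pi(v)}M$. Torsion: $\mathcal T_v(X,Y)=\nabla^v_XY-\nabla^v_YX-[X,Y]_{\pi(v)}$. Vertical derivative of $\nabla$: $P_v(X,Y,Z)=\frac{\partial}{\partial t}\big(\nabla^{v+tZ}_XY\big)|_{t=0}$. Curvature tensor: $R_v(X,Y)Z=\nabla^v_X(\nabla_YZ)-\nabla^v_Y(\nabla_XZ)-\nabla^v_{[X,Y]}Z$ for $X,Y,Z\in\mathfrak X(M)$. These are $A$-anisotropic tensors. *)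

theory Defs
  imports "HOL-Analysis.Analysis"
begin

section \<open>Smooth maps between Euclidean spaces\<close>

text \<open>\<open>C_upto k S f\<close>: f is of class \<open>C\<^sup>k\<close> on S; only used for open S.\<close>

primrec C_upto ::
    "nat \<Rightarrow> 'b::euclidean_space set \<Rightarrow> ('b \<Rightarrow> 'c::real_normed_vector) \<Rightarrow> bool" where
  "C_upto 0 S f \<longleftrightarrow> continuous_on S f"
| "C_upto (Suc k) S f \<longleftrightarrow>
     (\<forall>x\<in>S. f differentiable (at x)) \<and>
     (\<forall>h. C_upto k S (\<lambda>x. frechet_derivative f (at x) h))"

definition smooth_on ::
    "'b::euclidean_space set \<Rightarrow> ('b \<Rightarrow> 'c::real_normed_vector) \<Rightarrow> bool" where
  "smooth_on S f \<longleftrightarrow> (\<forall>k. C_upto k S f)"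


section \<open>Smooth manifolds\<close>

text \<open>The manifold M is the whole type \<open>'a\<close>, modelled on the Euclidean space \<open>'e\<close>.
  A chart is a pair of a domain and a map, of which only the values on the domain matter.
  The atlas need not be maximal.\<close>

type_synonym ('a, 'e) chart = "'a set \<times> ('a \<Rightarrow> 'e)"

abbreviation cdom :: "('a, 'e) chart \<Rightarrow> 'a set" where
  "cdom c \<equiv> fst c"

abbreviation cmap :: "('a, 'e) chart \<Rightarrow> 'a \<Rightarrow> 'e" where
  "cmap c \<equiv> snd c"

definition cinv :: "('a, 'e) chart \<Rightarrow> 'e \<Rightarrow> 'a" where
  "cinv c = inv_into (cdom c) (cmap c)"

definition smooth_atlas ::
    "('a::{t2_space, second_countable_topology}, 'e::euclidean_space) chart set \<Rightarrow> bool" where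
  "smooth_atlas \<A> \<longleftrightarrow>
     (\<Union>c\<in>\<A>. cdom c) = UNIV \<and>
     (\<forall>c\<in>\<A>. open (cdom c) \<and> open (cmap c ` cdom c) \<and>
        homeomorphism (cdom c) (cmap c ` cdom c) (cmap c) (cinv c)) \<and>
     (\<forall>c\<in>\<A>. \<forall>d\<in>\<A>. smooth_on (cmap c ` (cdom c \<inter> cdom d)) (cmap d \<circ> cinv c))"

definition smooth_funs ::
    "('a, 'e::euclidean_space) chart set \<Rightarrow> ('a \<Rightarrow> real) set" where
  "smooth_funs \<A> = {f. \<forall>c\<in>\<A>. smooth_on (cmap c ` cdom c) (f \<circ> cinv c)}"


section \<open>The tangent bundle\<close>

text \<open>A tangent vector is a base point together with its components in all charts around
  that point, subject to the transformation law below.  To make the representation unique,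
  the components at pairs that are not charts around the base point are zero.\<close>

datatype ('a, 'e) tvec = TVec (base: 'a) (coord: "('a, 'e) chart \<Rightarrow> 'e")

definition tangent_space ::
    "('a, 'e::euclidean_space) chart set \<Rightarrow> 'a \<Rightarrow> ('a, 'e) tvec set" where
  "tangent_space \<A> p = {v. base v = p \<and>
     (\<forall>c. c \<notin> \<A> \<or> p \<notin> cdom c \<longrightarrow> coord v c = 0) \<and>
     (\<forall>c\<in>\<A>. \<forall>d\<in>\<A>. p \<in> cdom c \<inter> cdom d \<longrightarrow>
        coord v d = frechet_derivative (cmap d \<circ> cinv c) (at (cmap c p)) (coord v c))}"

definition tangent_bundle ::
    "('a, 'e::euclidean_space) chart set \<Rightarrow> ('a, 'e) tvec set" where
  "tangent_bundle \<A> = (\<Union>p. tangent_space \<A> p)"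

text \<open>The linear structure of the tangent spaces.  The binary operations are only meaningful
  for vectors with the same base point.\<close>

instantiation tvec :: (type, plus) plus
begin
definition "v + w = TVec (base v) (\<lambda>c. coord v c + coord w c)"
instance ..
end

instantiation tvec :: (type, minus) minus
begin
definition "v - w = TVec (base v) (\<lambda>c. coord v c - coord w c)"
instance ..
end

instantiation tvec :: (type, uminus) uminus
begin
definition "- v = TVec (base v) (\<lambda>c. - coord v c)"
instance ..
end

instantiation tvec :: (type, scaleR) scaleR
begin
definition "a *\<^sub>R v = TVec (base v) (\<lambda>c. a *\<^sub>R coord v c)"
instance ..
end

definition zero_vec :: "'a \<Rightarrow> ('a, 'e::euclidean_space) tvec" where
  "zero_vec p = TVec p (\<lambda>c. 0)"

text \<open>The charts of the tangent bundle induced by the charts of M; they define its topology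
  and its smooth structure.\<close>

definition bundle_chart ::
    "('a, 'e) chart \<Rightarrow> ('a, 'e) tvec \<Rightarrow> 'e \<times> 'e" where
  "bundle_chart c v = (cmap c (base v), coord v c)"

definition bundle_cinv ::
    "('a, 'e::euclidean_space) chart set \<Rightarrow> ('a, 'e) chart \<Rightarrow> 'e \<times> 'e \<Rightarrow> ('a, 'e) tvec" where
  "bundle_cinv \<A> c = inv_into {v \<in> tangent_bundle \<A>. base v \<in> cdom c} (bundle_chart c)"

definition open_in_tangent_bundle ::
    "('a, 'e::euclidean_space) chart set \<Rightarrow> ('a, 'e) tvec set \<Rightarrow> bool" where
  "open_in_tangent_bundle \<A> A \<longleftrightarrow> A \<subseteq> tangent_bundle \<A> \<and>
     (\<forall>c\<in>\<A>. open (bundle_chart c ` {v \<in> A. base v \<in> cdom c}))"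


section \<open>Vector fields\<close>

definition vector_fields_on ::
    "('a, 'e::euclidean_space) chart set \<Rightarrow> 'a set \<Rightarrow> ('a \<Rightarrow> ('a, 'e) tvec) set" where
  "vector_fields_on \<A> \<Omega> = {X.
     (\<forall>p\<in>\<Omega>. X p \<in> tangent_space \<A> p) \<and>
     (\<forall>c\<in>\<A>. smooth_on (cmap c ` (cdom c \<inter> \<Omega>)) (\<lambda>x. coord (X (cinv c x)) c))}"

abbreviation vector_fields ::
    "('a, 'e::euclidean_space) chart set \<Rightarrow> ('a \<Rightarrow> ('a, 'e) tvec) set" where
  "vector_fields \<A> \<equiv> vector_fields_on \<A> UNIV"

text \<open>The derivative \<open>v(f)\<close> of a function f, smooth near \<open>base v\<close>, computed in an arbitrary
  chart.\<close>

definition dir_deriv ::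
    "('a, 'e::euclidean_space) chart set \<Rightarrow> ('a, 'e) tvec \<Rightarrow> ('a \<Rightarrow> real) \<Rightarrow> real" where
  "dir_deriv \<A> v f =
     (let c = (SOME c. c \<in> \<A> \<and> base v \<in> cdom c)
      in frechet_derivative (f \<circ> cinv c) (at (cmap c (base v))) (coord v c))"

definition lie_bracket ::
    "('a, 'e::euclidean_space) chart set \<Rightarrow>
     ('a \<Rightarrow> ('a, 'e) tvec) \<Rightarrow> ('a \<Rightarrow> ('a, 'e) tvec) \<Rightarrow> 'a \<Rightarrow> ('a, 'e) tvec" where
  "lie_bracket \<A> X Y p =
     (THE w. w \<in> tangent_space \<A> p \<and>
        (\<forall>f\<in>smooth_funs \<A>. dir_deriv \<A> w f =
           dir_deriv \<A> (X p) (\<lambda>q. dir_deriv \<A> (Y q) f) -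
           dir_deriv \<A> (Y p) (\<lambda>q. dir_deriv \<A> (X q) f)))"

text \<open>An arbitrary global extension of a tangent vector to a smooth vector field.\<close>

definition ext ::
    "('a, 'e::euclidean_space) chart set \<Rightarrow> ('a, 'e) tvec \<Rightarrow> 'a \<Rightarrow> ('a, 'e) tvec" where
  "ext \<A> u = (SOME X. X \<in> vector_fields \<A> \<and> X (base u) = u)"


section \<open>Anisotropic vector fields\<close>

text \<open>The set \<open>\<TT>\<^sup>1\<^sub>0(M, A)\<close> of smooth maps from A to the tangent bundle that preserve
  base points; smoothness is expressed in the bundle charts, where the base component of the
  map is the identity.\<close>

definition aniso_fields ::
    "('a, 'e::euclidean_space) chart set \<Rightarrow> ('a, 'e) tvec set \<Rightarrow>
     (('a, 'e) tvec \<Rightarrow> ('a, 'e) tvec) set" where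
  "aniso_fields \<A> A = {\<Y>.
     (\<forall>v\<in>A. \<Y> v \<in> tangent_space \<A> (base v)) \<and>
     (\<forall>c\<in>\<A>. smooth_on (bundle_chart c ` {v \<in> A. base v \<in> cdom c})
                 (\<lambda>y. coord (\<Y> (bundle_cinv \<A> c y)) c))}"

text \<open>The vertical derivative \<open>(\<partial>\<^sup>\<nu>\<Y>)\<^sub>v(z)\<close>; the derivative of a curve in the
  finite-dimensional space \<open>tangent_space \<A> (base v)\<close> is taken component by component.\<close>

definition vert_deriv ::
    "(('a, 'e::euclidean_space) tvec \<Rightarrow> ('a, 'e) tvec) \<Rightarrow>
     ('a, 'e) tvec \<Rightarrow> ('a, 'e) tvec \<Rightarrow> ('a, 'e) tvec" where
  "vert_deriv \<Y> v z =
     TVec (base v) (\<lambda>c. vector_derivative (\<lambda>t. coord (\<Y> (v + t *\<^sub>R z)) c) (at 0))"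


section \<open>Anisotropic connections\<close>

type_synonym ('a, 'e) conn =
  "('a, 'e) tvec \<Rightarrow> ('a \<Rightarrow> ('a, 'e) tvec) \<Rightarrow> ('a \<Rightarrow> ('a, 'e) tvec) \<Rightarrow> ('a, 'e) tvec"

definition anisotropic_connection ::
    "('a, 'e::euclidean_space) chart set \<Rightarrow> ('a, 'e) tvec set \<Rightarrow> ('a, 'e) conn \<Rightarrow> bool" where
  "anisotropic_connection \<A> A nabla \<longleftrightarrow>
     (\<forall>v\<in>A. \<forall>X\<in>vector_fields \<A>. \<forall>Y\<in>vector_fields \<A>.
        nabla v X Y \<in> tangent_space \<A> (base v)) \<and>
     (\<forall>v\<in>A. \<forall>X\<in>vector_fields \<A>. \<forall>Y\<in>vector_fields \<A>. \<forall>Z\<in>vector_fields \<A>.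
        nabla v X (\<lambda>p. Y p + Z p) = nabla v X Y + nabla v X Z) \<and>
     (\<forall>v\<in>A. \<forall>X\<in>vector_fields \<A>. \<forall>Y\<in>vector_fields \<A>. \<forall>f\<in>smooth_funs \<A>.
        nabla v X (\<lambda>p. f p *\<^sub>R Y p) =
          dir_deriv \<A> (X (base v)) f *\<^sub>R Y (base v) + f (base v) *\<^sub>R nabla v X Y) \<and>
     (\<forall>v\<in>A. \<forall>X\<in>vector_fields \<A>. \<forall>Y\<in>vector_fields \<A>. \<forall>Z\<in>vector_fields \<A>.
        \<forall>f\<in>smooth_funs \<A>. \<forall>h\<in>smooth_funs \<A>.
        nabla v (\<lambda>p. f p *\<^sub>R X p + h p *\<^sub>R Y p) Z =
          f (base v) *\<^sub>R nabla v X Z + h (base v) *\<^sub>R nabla v Y Z) \<and>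
     (\<forall>X\<in>vector_fields \<A>. \<forall>Y\<in>vector_fields \<A>. (\<lambda>v. nabla v X Y) \<in> aniso_fields \<A> A)"

text \<open>\<open>nabla v X Y\<close> depends on Y only through its germ at \<open>base v\<close>.  Hence \<open>nabla\<close> applies
  to a vector field Y that is defined only near \<open>base v\<close>: replace it by a global field with
  the same germ.\<close>

definition nabla_local ::
    "('a::topological_space, 'e::euclidean_space) chart set \<Rightarrow> ('a, 'e) conn \<Rightarrow> ('a, 'e) conn" where
  "nabla_local \<A> nabla v X Y =
     nabla v X (SOME Y'. Y' \<in> vector_fields \<A> \<and> eventually (\<lambda>q. Y' q = Y q) (nhds (base v)))"

definition admissible_extension ::
    "('a::topological_space, 'e::euclidean_space) chart set \<Rightarrow> ('a, 'e) tvec set \<Rightarrow>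
     ('a, 'e) tvec \<Rightarrow> 'a set \<Rightarrow> ('a \<Rightarrow> ('a, 'e) tvec) \<Rightarrow> bool" where
  "admissible_extension \<A> A v \<Omega> V \<longleftrightarrow>
     open \<Omega> \<and> base v \<in> \<Omega> \<and> V \<in> vector_fields_on \<A> \<Omega> \<and> (\<forall>p\<in>\<Omega>. V p \<in> A) \<and> V (base v) = v"

text \<open>The derivative \<open>\<nabla>\<^sup>v\<^sub>X\<Y>\<close> of an anisotropic vector field, which does not depend
  on the choice of the local admissible extension V.\<close>

definition nabla_aniso ::
    "('a::topological_space, 'e::euclidean_space) chart set \<Rightarrow> ('a, 'e) tvec set \<Rightarrow>
     ('a, 'e) conn \<Rightarrow> ('a, 'e) tvec \<Rightarrow> ('a \<Rightarrow> ('a, 'e) tvec) \<Rightarrow>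
     (('a, 'e) tvec \<Rightarrow> ('a, 'e) tvec) \<Rightarrow> ('a, 'e) tvec" where
  "nabla_aniso \<A> A nabla v X \<Y> =
     (let V = (SOME V. \<exists>\<Omega>. admissible_extension \<A> A v \<Omega> V)
      in nabla_local \<A> nabla v X (\<lambda>p. \<Y> (V p)) - vert_deriv \<Y> v (nabla_local \<A> nabla v X V))"


section \<open>Torsion, vertical derivative and curvature\<close>

text \<open>Each tensor is first defined on vector fields, with suffix \<open>_field\<close>, and then on
  tangent vectors by means of arbitrary extensions.\<close>

definition torsion_field ::
    "('a, 'e::euclidean_space) chart set \<Rightarrow> ('a, 'e) conn \<Rightarrow> ('a, 'e) conn" where
  "torsion_field \<A> nabla v X Y = nabla v X Y - nabla v Y X - lie_bracket \<A> X Y (base v)"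

definition torsion ::
    "('a, 'e::euclidean_space) chart set \<Rightarrow> ('a, 'e) conn \<Rightarrow>
     ('a, 'e) tvec \<Rightarrow> ('a, 'e) tvec \<Rightarrow> ('a, 'e) tvec \<Rightarrow> ('a, 'e) tvec" where
  "torsion \<A> nabla v x y = torsion_field \<A> nabla v (ext \<A> x) (ext \<A> y)"

definition vert_conn_field ::
    "('a, 'e::euclidean_space) conn \<Rightarrow> ('a, 'e) tvec \<Rightarrow>
     ('a \<Rightarrow> ('a, 'e) tvec) \<Rightarrow> ('a \<Rightarrow> ('a, 'e) tvec) \<Rightarrow> ('a \<Rightarrow> ('a, 'e) tvec) \<Rightarrow> ('a, 'e) tvec" where
  "vert_conn_field nabla v X Y Z = vert_deriv (\<lambda>v'. nabla v' X Y) v (Z (base v))"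

definition vert_conn ::
    "('a, 'e::euclidean_space) chart set \<Rightarrow> ('a, 'e) conn \<Rightarrow>
     ('a, 'e) tvec \<Rightarrow> ('a, 'e) tvec \<Rightarrow> ('a, 'e) tvec \<Rightarrow> ('a, 'e) tvec \<Rightarrow> ('a, 'e) tvec" where
  "vert_conn \<A> nabla v x y z = vert_conn_field nabla v (ext \<A> x) (ext \<A> y) (ext \<A> z)"

definition curvature_field ::
    "('a::topological_space, 'e::euclidean_space) chart set \<Rightarrow> ('a, 'e) tvec set \<Rightarrow>
     ('a, 'e) conn \<Rightarrow> ('a, 'e) tvec \<Rightarrow>
     ('a \<Rightarrow> ('a, 'e) tvec) \<Rightarrow> ('a \<Rightarrow> ('a, 'e) tvec) \<Rightarrow> ('a \<Rightarrow> ('a, 'e) tvec) \<Rightarrow> ('a, 'e) tvec" where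
  "curvature_field \<A> A nabla v X Y Z =
     nabla_aniso \<A> A nabla v X (\<lambda>v'. nabla v' Y Z) -
     nabla_aniso \<A> A nabla v Y (\<lambda>v'. nabla v' X Z) -
     nabla v (lie_bracket \<A> X Y) Z"

definition curvature ::
    "('a::topological_space, 'e::euclidean_space) chart set \<Rightarrow> ('a, 'e) tvec set \<Rightarrow>
     ('a, 'e) conn \<Rightarrow>
     ('a, 'e) tvec \<Rightarrow> ('a, 'e) tvec \<Rightarrow> ('a, 'e) tvec \<Rightarrow> ('a, 'e) tvec \<Rightarrow> ('a, 'e) tvec" where
  "curvature \<A> A nabla v x y z = curvature_field \<A> A nabla v (ext \<A> x) (ext \<A> y) (ext \<A> z)"


section \<open>Covariant derivatives of anisotropic tensors\<close>

text \<open>Anisotropic tensors of type (1,2) and (1,3) are given by their pointwise maps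
  \<open>T\<^sub>v\<close>; evaluated on fields, they give the anisotropic field \<open>v' \<mapsto> T\<^sub>v\<^sub>'(X, Y)\<close>.\<close>

definition nabla_tensor2_field ::
    "('a::topological_space, 'e::euclidean_space) chart set \<Rightarrow> ('a, 'e) tvec set \<Rightarrow>
     ('a, 'e) conn \<Rightarrow>
     (('a, 'e) tvec \<Rightarrow> ('a, 'e) tvec \<Rightarrow> ('a, 'e) tvec \<Rightarrow> ('a, 'e) tvec) \<Rightarrow>
     ('a, 'e) tvec \<Rightarrow>
     ('a \<Rightarrow> ('a, 'e) tvec) \<Rightarrow> ('a \<Rightarrow> ('a, 'e) tvec) \<Rightarrow> ('a \<Rightarrow> ('a, 'e) tvec) \<Rightarrow> ('a, 'e) tvec" where
  "nabla_tensor2_field \<A> A nabla T v X X1 X2 =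
     nabla_aniso \<A> A nabla v X (\<lambda>v'. T v' (X1 (base v')) (X2 (base v'))) -
     T v (nabla v X X1) (X2 (base v)) -
     T v (X1 (base v)) (nabla v X X2)"

definition nabla_tensor2 ::
    "('a::topological_space, 'e::euclidean_space) chart set \<Rightarrow> ('a, 'e) tvec set \<Rightarrow>
     ('a, 'e) conn \<Rightarrow>
     (('a, 'e) tvec \<Rightarrow> ('a, 'e) tvec \<Rightarrow> ('a, 'e) tvec \<Rightarrow> ('a, 'e) tvec) \<Rightarrow>
     ('a, 'e) tvec \<Rightarrow> ('a, 'e) tvec \<Rightarrow> ('a, 'e) tvec \<Rightarrow> ('a, 'e) tvec \<Rightarrow> ('a, 'e) tvec" where
  "nabla_tensor2 \<A> A nabla T v u x1 x2 =
     nabla_tensor2_field \<A> A nabla T v (ext \<A> u) (ext \<A> x1) (ext \<A> x2)"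

definition nabla_tensor3_field ::
    "('a::topological_space, 'e::euclidean_space) chart set \<Rightarrow> ('a, 'e) tvec set \<Rightarrow>
     ('a, 'e) conn \<Rightarrow>
     (('a, 'e) tvec \<Rightarrow> ('a, 'e) tvec \<Rightarrow> ('a, 'e) tvec \<Rightarrow> ('a, 'e) tvec \<Rightarrow> ('a, 'e) tvec) \<Rightarrow>
     ('a, 'e) tvec \<Rightarrow> ('a \<Rightarrow> ('a, 'e) tvec) \<Rightarrow>
     ('a \<Rightarrow> ('a, 'e) tvec) \<Rightarrow> ('a \<Rightarrow> ('a, 'e) tvec) \<Rightarrow> ('a \<Rightarrow> ('a, 'e) tvec) \<Rightarrow> ('a, 'e) tvec" where
  "nabla_tensor3_field \<A> A nabla T v X X1 X2 X3 =
     nabla_aniso \<A> A nabla v X (\<lambda>v'. T v' (X1 (base v')) (X2 (base v')) (X3 (base v'))) -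
     T v (nabla v X X1) (X2 (base v)) (X3 (base v)) -
     T v (X1 (base v)) (nabla v X X2) (X3 (base v)) -
     T v (X1 (base v)) (X2 (base v)) (nabla v X X3)"

definition nabla_tensor3 ::
    "('a::topological_space, 'e::euclidean_space) chart set \<Rightarrow> ('a, 'e) tvec set \<Rightarrow>
     ('a, 'e) conn \<Rightarrow>
     (('a, 'e) tvec \<Rightarrow> ('a, 'e) tvec \<Rightarrow> ('a, 'e) tvec \<Rightarrow> ('a, 'e) tvec \<Rightarrow> ('a, 'e) tvec) \<Rightarrow>
     ('a, 'e) tvec \<Rightarrow> ('a, 'e) tvec \<Rightarrow>
     ('a, 'e) tvec \<Rightarrow> ('a, 'e) tvec \<Rightarrow> ('a, 'e) tvec \<Rightarrow> ('a, 'e) tvec" where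
  "nabla_tensor3 \<A> A nabla T v u x1 x2 x3 =
     nabla_tensor3_field \<A> A nabla T v (ext \<A> u) (ext \<A> x1) (ext \<A> x2) (ext \<A> x3)"

definition cyclic_sum ::
    "('t \<Rightarrow> 't \<Rightarrow> 't \<Rightarrow> 't::plus) \<Rightarrow> 't \<Rightarrow> 't \<Rightarrow> 't \<Rightarrow> 't" where
  "cyclic_sum F u w z = F u w z + F w z u + F z u w"

end

theory Submission
  imports Defs
begin

text \<open>In a chart, \<open>\<nabla>\<^sup>v\<^sub>XY = dY(X) + G(X, Y)\<close> with bilinear maps \<open>G = G(x, y)\<close> that depend smoothly
  on the coordinates x of the base point and y of v, and the derivative of an anisotropic field
  is \<open>\<nabla>\<^sub>h\<Y> = \<delta>\<^sub>h\<Y> + G(h, \<Y>)\<close> with the horizontal derivative \<open>\<delta>\<^sub>hf = Df(h, - G(h, y))\<close>.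
  Therefore \<open>R(h, k) = \<delta>\<^sub>hG\<^sub>k - \<delta>\<^sub>kG\<^sub>h + [G\<^sub>h, G\<^sub>k]\<close>, and the first Bianchi identity is an algebraic
  identity.  The second one is the Jacobi identity for the operators \<open>\<delta>\<^sub>h + G\<^sub>h\<close>; the term with P
  arises because the horizontal derivatives do not commute: \<open>[\<delta>\<^sub>h, \<delta>\<^sub>k]f = - Df(0, R(h, k)y)\<close>.
  Since connections, the Lie bracket and \<open>ext\<close> refer to global objects only, smooth
  bump functions are needed to pass to a chart.\<close>

section \<open>Calculus of smooth maps\<close>

text \<open>The tensors are defined at a single v through arbitrary choices (\<open>ext\<close>, an
  admissible extension, a germ), whereas their covariant derivatives differentiate them in v. A
  formula at one point is therefore not enough: each tensor needs a coordinate expression that holds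
  for all v over one open set W, with a single chart and a single cutoff function, and that contains
  only the values of its arguments, so that the choices drop out. \<open>represents2\<close> and
  \<open>represents3\<close> record exactly this. The torsion terms disappear by the same
  cancellation in both identities. Together with the terms of the covariant derivative that have G
  inside an argument they reduce to B(G(u, z), w) - B(G(w, u), z), where the alternating map B is
  the torsion or the curvature (with b fixed), and the two parts cancel in the cyclic sum.\<close>

abbreviation fD :: "('b::real_normed_vector \<Rightarrow> 'c::real_normed_vector) \<Rightarrow> 'b \<Rightarrow> 'b \<Rightarrow> 'c" where
  "fD f x \<equiv> frechet_derivative f (at x)"

lemma fD_eqI: "(f has_derivative f') (at x) \<Longrightarrow> fD f x = f'"
  using frechet_derivative_at by blast

lemma linear_eq_sum_Basis:
  fixes L :: "'b::euclidean_space \<Rightarrow> 'c::real_normed_vector"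
  assumes "linear L"
  shows "L x = (\<Sum>i\<in>Basis. (x \<bullet> i) *\<^sub>R L i)"
  using linear_sum[OF assms, of "\<lambda>i. (x \<bullet> i) *\<^sub>R i" Basis]
  by (simp add: euclidean_representation linear_scale[OF assms])

section \<open>Closure properties of the classes C^k\<close>

lemma C_upto_SucD:
  assumes "C_upto (Suc k) S f"
  shows "x \<in> S \<Longrightarrow> (f has_derivative fD f x) (at x)" and "C_upto k S (\<lambda>x. fD f x h)"
  using assms by (auto simp: frechet_derivative_works)

lemma C_upto_cong:
  assumes "open S" "C_upto k S f" "\<And>x. x \<in> S \<Longrightarrow> f x = g x"
  shows "C_upto k S g"
  using assms(2,3)
proof (induction k arbitrary: f g)
  case 0
  then show ?case by (simp cong: continuous_on_cong)
next
  case (Suc k)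
  have D: "(g has_derivative fD f x) (at x)" if "x \<in> S" for x
    using has_derivative_transform_within_open[OF C_upto_SucD(1)[OF Suc.prems(1) that] assms(1) that]
      Suc.prems(2) by blast
  have "C_upto k S (\<lambda>x. fD g x h)" for h
    using Suc.IH[OF C_upto_SucD(2)[OF Suc.prems(1), of h]] fD_eqI[OF D] by simp
  then show ?case using D by (auto simp: differentiable_def)
qed

lemma C_upto_SucI:
  assumes "open S" "\<And>x. x \<in> S \<Longrightarrow> (f has_derivative f' x) (at x)" "\<And>h. C_upto k S (\<lambda>x. f' x h)"
  shows "C_upto (Suc k) S f"
proof -
  have "C_upto k S (\<lambda>x. fD f x h)" for h
    by (rule C_upto_cong[OF assms(1) assms(3)[of h]]) (simp add: fD_eqI[OF assms(2)])
  then show ?thesis using assms(2) by (auto simp: differentiable_def)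
qed

lemma C_upto_local:
  assumes "\<And>x. x \<in> S \<Longrightarrow> \<exists>N. open N \<and> x \<in> N \<and> C_upto k N f"
  shows "C_upto k S f"
  using assms
proof (induction k arbitrary: f)
  case 0
  then show ?case
    by (metis C_upto.simps(1) continuous_at_imp_continuous_on continuous_on_eq_continuous_at)
next
  case (Suc k)
  then show ?case by (metis C_upto.simps(2))
qed

lemma C_upto_subset: "C_upto k T f \<Longrightarrow> open T \<Longrightarrow> S \<subseteq> T \<Longrightarrow> C_upto k S f"
  by (rule C_upto_local) blast

lemma C_upto_lower: "C_upto (Suc k) S f \<Longrightarrow> C_upto k S f"
proof (induction k arbitrary: f)
  case 0
  then show ?case
    by (auto simp: intro!: continuous_at_imp_continuous_on differentiable_imp_continuous_within)
next
  case (Suc k)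
  then show ?case by (auto simp del: C_upto.simps(2) simp: C_upto.simps(2)[of "Suc k"] C_upto.simps(2)[of k] )
qed

lemma C_upto_const: "open S \<Longrightarrow> C_upto k S (\<lambda>x. a)"
  by (induction k arbitrary: a) (auto intro!: C_upto_SucI has_derivative_const simp del: C_upto.simps(2))

lemma C_upto_bounded_linear:
  assumes "open S" "bounded_linear L" "C_upto k S f"
  shows "C_upto k S (\<lambda>x. L (f x))"
  using assms(3)
proof (induction k arbitrary: f)
  case 0
  then show ?case
    using assms(2) by (auto intro: bounded_linear.continuous_on)
next
  case (Suc k)
  show ?case
    by (rule C_upto_SucI[OF assms(1) bounded_linear.has_derivative[OF assms(2) C_upto_SucD(1)[OF Suc.prems]]
          Suc.IH[OF C_upto_SucD(2)[OF Suc.prems]]])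
qed

lemma C_upto_add:
  assumes "open S" "C_upto k S f" "C_upto k S g"
  shows "C_upto k S (\<lambda>x. f x + g x)"
  using assms(2,3)
proof (induction k arbitrary: f g)
  case 0
  then show ?case by (auto intro: continuous_intros)
next
  case (Suc k)
  note f = C_upto_SucD[OF Suc.prems(1)] and g = C_upto_SucD[OF Suc.prems(2)]
  show ?case
    by (rule C_upto_SucI[OF assms(1) has_derivative_add[OF f(1) g(1)] Suc.IH[OF f(2) g(2)]])
qed

lemma C_upto_sum:
  assumes "open S" "\<And>i. i \<in> I \<Longrightarrow> C_upto k S (f i)"
  shows "C_upto k S (\<lambda>x. \<Sum>i\<in>I. f i x)"
  using assms(2)
  by (induction I rule: infinite_finite_induct) (auto intro: C_upto_const C_upto_add assms(1))

lemma C_upto_scaleR: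
  fixes g :: "'b::euclidean_space \<Rightarrow> 'c::real_normed_vector"
  assumes "open S" "C_upto k S f" "C_upto k S g"
  shows "C_upto k S (\<lambda>x. f x *\<^sub>R g x)"
  using assms(2,3)
proof (induction k arbitrary: f g)
  case 0
  then show ?case by (auto intro: continuous_intros)
next
  case (Suc k)
  note f = C_upto_SucD[OF Suc.prems(1)] and g = C_upto_SucD[OF Suc.prems(2)]
  show ?case
    by (rule C_upto_SucI[OF assms(1) has_derivative_scaleR[OF f(1) g(1)]])
      (intro C_upto_add assms(1) Suc.IH f(2) g(2) Suc.prems[THEN C_upto_lower] | simp)+
qed

text \<open>\<open>C_upto\<close> controls derivatives along constant directions only, while the
  chain rule applies the derivative of f to the moving vector \<open>fD g x h\<close>. Expanding
  this vector in the basis gives products of functions of class C^k, to which the induction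
  hypothesis applies.\<close>

lemma C_upto_comp:
  fixes g :: "'b::euclidean_space \<Rightarrow> 'c::euclidean_space" and f :: "'c \<Rightarrow> 'd::real_normed_vector"
  assumes "open S" "open T" "g ` S \<subseteq> T" "C_upto k T f" "C_upto k S g"
  shows "C_upto k S (\<lambda>x. f (g x))"
  using assms(4,5)
proof (induction k arbitrary: f)
  case 0
  then show ?case
    using continuous_on_compose2[OF _ _ assms(3)] by auto
next
  case (Suc k)
  note f = C_upto_SucD[OF Suc.prems(1)] and g = C_upto_SucD[OF Suc.prems(2)]
  have T: "x \<in> S \<Longrightarrow> g x \<in> T" for x using assms(3) by auto
  have "C_upto k S (\<lambda>x. \<Sum>i\<in>Basis. (fD g x h \<bullet> i) *\<^sub>R fD f (g x) i)" for h
    by (intro C_upto_sum C_upto_scaleR assms(1) Suc.IH f(2) C_upto_lower[OF Suc.prems(2)]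
        C_upto_bounded_linear[OF assms(1) bounded_linear_inner_left g(2)])
  then have *: "C_upto k S (\<lambda>x. fD f (g x) (fD g x h))" for h
    by (rule C_upto_cong[OF assms(1)])
      (rule linear_eq_sum_Basis[OF has_derivative_linear[OF f(1)[OF T]], symmetric])
  show ?case
    by (rule C_upto_SucI[OF assms(1) has_derivative_compose[OF g(1) f(1)[OF T]] *])
qed

text \<open>The derivative -(1/f) f' (1/f) is built from f' and from the inverse itself at one order
  less, so the induction on k closes with f fixed.\<close>

lemma C_upto_inverse:
  fixes f :: "'b::euclidean_space \<Rightarrow> real"
  assumes "open S" "C_upto k S f" "\<And>x. x \<in> S \<Longrightarrow> f x \<noteq> 0"
  shows "C_upto k S (\<lambda>x. inverse (f x))"
  using assms(2)
proof (induction k)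
  case 0
  then show ?case using assms(3) by (auto intro: continuous_intros)
next
  case (Suc k)
  note f = C_upto_SucD[OF Suc.prems] and IH = Suc.IH[OF C_upto_lower[OF Suc.prems]]
  have "C_upto k S (\<lambda>x. - (inverse (f x) *\<^sub>R fD f x h *\<^sub>R inverse (f x)))" for h
    by (intro C_upto_bounded_linear[OF assms(1) bounded_linear_minus[OF bounded_linear_ident]]
        C_upto_scaleR assms(1) IH f(2))
  then show ?case
    by (intro C_upto_SucI[OF assms(1) Deriv.has_derivative_inverse[OF assms(3) f(1)]]) (auto simp: mult.assoc)
qed

section \<open>Smooth maps and smooth families of linear maps\<close>

named_theorems smooth_intros

lemma smooth_on_cong: "open S \<Longrightarrow> smooth_on S f \<Longrightarrow> (\<And>x. x \<in> S \<Longrightarrow> f x = g x) \<Longrightarrow> smooth_on S g"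
  unfolding smooth_on_def using C_upto_cong by blast

lemma smooth_on_local: "(\<And>x. x \<in> S \<Longrightarrow> \<exists>N. open N \<and> x \<in> N \<and> smooth_on N f) \<Longrightarrow> smooth_on S f"
  unfolding smooth_on_def by (meson C_upto_local)

lemma smooth_on_subset: "smooth_on T f \<Longrightarrow> open T \<Longrightarrow> S \<subseteq> T \<Longrightarrow> smooth_on S f"
  unfolding smooth_on_def using C_upto_subset by blast

lemma smooth_on_const [smooth_intros]: "open S \<Longrightarrow> smooth_on S (\<lambda>x. a)"
  unfolding smooth_on_def using C_upto_const by blast

lemma smooth_on_id [smooth_intros]: "open S \<Longrightarrow> smooth_on S (\<lambda>x. x)"
  unfolding smooth_on_def
proof
  fix k assume "open S"
  then show "C_upto k S (\<lambda>x. x)"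
    by (cases k) (auto intro!: C_upto_SucI has_derivative_ident C_upto_const continuous_intros
        simp del: C_upto.simps(2))
qed

lemma smooth_on_bounded_linear:
  "open S \<Longrightarrow> bounded_linear L \<Longrightarrow> smooth_on S f \<Longrightarrow> smooth_on S (\<lambda>x. L (f x))"
  unfolding smooth_on_def using C_upto_bounded_linear by blast

lemma smooth_on_linear:
  fixes L :: "'b::euclidean_space \<Rightarrow> 'c::real_normed_vector"
  shows "open S \<Longrightarrow> linear L \<Longrightarrow> smooth_on S f \<Longrightarrow> smooth_on S (\<lambda>x. L (f x))"
  by (simp add: linear_conv_bounded_linear smooth_on_bounded_linear)

lemma smooth_on_add [smooth_intros]:
  "open S \<Longrightarrow> smooth_on S f \<Longrightarrow> smooth_on S g \<Longrightarrow> smooth_on S (\<lambda>x. f x + g x)"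
  unfolding smooth_on_def using C_upto_add by blast

lemma smooth_on_minus [smooth_intros]:
  "open S \<Longrightarrow> smooth_on S f \<Longrightarrow> smooth_on S (\<lambda>x. - f x)"
  using smooth_on_bounded_linear[OF _ bounded_linear_minus[OF bounded_linear_ident]] by blast

lemma smooth_on_diff [smooth_intros]:
  "open S \<Longrightarrow> smooth_on S f \<Longrightarrow> smooth_on S g \<Longrightarrow> smooth_on S (\<lambda>x. f x - g x)"
  using smooth_on_add[OF _ _ smooth_on_minus] by fastforce

lemma smooth_on_sum [smooth_intros]:
  "open S \<Longrightarrow> (\<And>i. i \<in> I \<Longrightarrow> smooth_on S (f i)) \<Longrightarrow> smooth_on S (\<lambda>x. \<Sum>i\<in>I. f i x)"
  unfolding smooth_on_def by (intro allI C_upto_sum) auto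

lemma smooth_on_scaleR [smooth_intros]:
  "open S \<Longrightarrow> smooth_on S f \<Longrightarrow> smooth_on S g \<Longrightarrow> smooth_on S (\<lambda>x. f x *\<^sub>R g x)"
  unfolding smooth_on_def using C_upto_scaleR by blast

lemma smooth_on_mult [smooth_intros]:
  fixes f g :: "'b::euclidean_space \<Rightarrow> real"
  shows "open S \<Longrightarrow> smooth_on S f \<Longrightarrow> smooth_on S g \<Longrightarrow> smooth_on S (\<lambda>x. f x * g x)"
  using smooth_on_scaleR[of S f g] by simp

lemma smooth_on_inner_left [smooth_intros]:
  "open S \<Longrightarrow> smooth_on S f \<Longrightarrow> smooth_on S (\<lambda>x. f x \<bullet> a)"
  using smooth_on_bounded_linear[OF _ bounded_linear_inner_left] .

lemma smooth_on_inner: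
  fixes f g :: "'b::euclidean_space \<Rightarrow> 'c::euclidean_space"
  assumes "open S" "smooth_on S f" "smooth_on S g"
  shows "smooth_on S (\<lambda>x. f x \<bullet> g x)"
proof -
  have "smooth_on S (\<lambda>x. \<Sum>i\<in>Basis. (f x \<bullet> i) * (g x \<bullet> i))"
    by (intro smooth_intros assms)
  then show ?thesis by (simp flip: euclidean_inner)
qed

lemma smooth_on_fst [smooth_intros]: "open S \<Longrightarrow> smooth_on S f \<Longrightarrow> smooth_on S (\<lambda>x. fst (f x))"
  using smooth_on_bounded_linear[OF _ bounded_linear_fst] .

lemma smooth_on_snd [smooth_intros]: "open S \<Longrightarrow> smooth_on S f \<Longrightarrow> smooth_on S (\<lambda>x. snd (f x))"
  using smooth_on_bounded_linear[OF _ bounded_linear_snd] .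

lemma smooth_on_Pair [smooth_intros]:
  fixes f :: "'b::euclidean_space \<Rightarrow> 'c::euclidean_space" and g :: "'b \<Rightarrow> 'd::euclidean_space"
  assumes "open S" "smooth_on S f" "smooth_on S g"
  shows "smooth_on S (\<lambda>x. (f x, g x))"
proof -
  have "smooth_on S (\<lambda>x. (f x, 0) + (0, g x))"
    by (intro smooth_intros assms smooth_on_linear[of S "\<lambda>y. (y, 0)"] smooth_on_linear[of S "\<lambda>y. (0, y)"])
      (auto intro!: linearI)
  then show ?thesis by simp
qed

lemma smooth_on_comp:
  fixes g :: "'b::euclidean_space \<Rightarrow> 'c::euclidean_space" and f :: "'c \<Rightarrow> 'd::real_normed_vector"
  shows "open S \<Longrightarrow> open T \<Longrightarrow> g ` S \<subseteq> T \<Longrightarrow> smooth_on T f \<Longrightarrow> smooth_on S g \<Longrightarrow> smooth_on S (\<lambda>x. f (g x))"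
  unfolding smooth_on_def using C_upto_comp by blast

lemma smooth_on_inverse:
  fixes f :: "'b::euclidean_space \<Rightarrow> real"
  shows "open S \<Longrightarrow> smooth_on S f \<Longrightarrow> (\<And>x. x \<in> S \<Longrightarrow> f x \<noteq> 0) \<Longrightarrow> smooth_on S (\<lambda>x. inverse (f x))"
  unfolding smooth_on_def using C_upto_inverse by blast

lemma smooth_on_has_derivative: "smooth_on S f \<Longrightarrow> x \<in> S \<Longrightarrow> (f has_derivative fD f x) (at x)"
  unfolding smooth_on_def using C_upto_SucD(1) by blast

lemma smooth_on_linear_fD: "smooth_on S f \<Longrightarrow> x \<in> S \<Longrightarrow> linear (fD f x)"
  using smooth_on_has_derivative has_derivative_linear by blast

lemma smooth_on_imp_continuous_on: "smooth_on S f \<Longrightarrow> continuous_on S f"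
  unfolding smooth_on_def using C_upto.simps(1) by blast

lemma smooth_on_fD_const: "smooth_on S f \<Longrightarrow> smooth_on S (\<lambda>x. fD f x h)"
  unfolding smooth_on_def using C_upto_SucD(2) by blast

text \<open>By linearity only the basis vectors h enter, so smoothness for each constant h carries
  over to a moving argument. Derivatives and Christoffel symbols are treated as such
  families.\<close>

lemma smooth_on_family:
  fixes g :: "'b::euclidean_space \<Rightarrow> 'c::euclidean_space"
  assumes "open S" "\<And>h. smooth_on S (\<lambda>x. F x h)" "\<And>x. x \<in> S \<Longrightarrow> linear (F x)" "smooth_on S g"
  shows "smooth_on S (\<lambda>x. F x (g x))"
proof -
  have "smooth_on S (\<lambda>x. \<Sum>i\<in>Basis. (g x \<bullet> i) *\<^sub>R F x i)"
    by (intro smooth_intros assms)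
  then show ?thesis
    by (rule smooth_on_cong[OF assms(1)]) (rule linear_eq_sum_Basis[OF assms(3), symmetric])
qed

lemma smooth_on_fD:
  assumes "open S" "smooth_on S f" "smooth_on S g"
  shows "smooth_on S (\<lambda>x. fD f x (g x))"
  by (rule smooth_on_family[OF assms(1) smooth_on_fD_const[OF assms(2)] smooth_on_linear_fD[OF assms(2)] assms(3)])

text \<open>Uniqueness of derivatives forces \<open>F' h\<close> to be linear in h; hence the
  product rule for the finite expansion of \<open>g y\<close> in the basis can be summed up
  again.\<close>

lemma has_derivative_family:
  fixes g :: "'b::euclidean_space \<Rightarrow> 'c::euclidean_space" and F :: "'b \<Rightarrow> 'c \<Rightarrow> 'd::real_normed_vector"
  assumes "open S" "x \<in> S" "\<And>y. y \<in> S \<Longrightarrow> linear (F y)"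
    and F: "\<And>h. ((\<lambda>y. F y h) has_derivative F' h) (at x)" and g: "(g has_derivative g') (at x)"
  shows "((\<lambda>y. F y (g y)) has_derivative (\<lambda>\<xi>. F' (g x) \<xi> + F x (g' \<xi>))) (at x)"
proof -
  have lin: "linear (\<lambda>h. F' h \<xi>)" for \<xi>
  proof (rule linearI)
    fix h k :: 'c and r :: real
    have "((\<lambda>y. F y (h + k)) has_derivative (\<lambda>\<xi>. F' h \<xi> + F' k \<xi>)) (at x)"
      by (rule has_derivative_transform_within_open[OF has_derivative_add[OF F F] assms(1,2)])
        (simp add: linear_add[OF assms(3)])
    then show "F' (h + k) \<xi> = F' h \<xi> + F' k \<xi>"
      by (rule has_derivative_unique[OF F, THEN fun_cong])
    have "((\<lambda>y. F y (r *\<^sub>R h)) has_derivative (\<lambda>\<xi>. r *\<^sub>R F' h \<xi>)) (at x)"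
      by (rule has_derivative_transform_within_open[OF has_derivative_scaleR_right[OF F] assms(1,2)])
        (simp add: linear_scale[OF assms(3)])
    then show "F' (r *\<^sub>R h) \<xi> = r *\<^sub>R F' h \<xi>"
      by (rule has_derivative_unique[OF F, THEN fun_cong])
  qed
  have "((\<lambda>y. \<Sum>i\<in>Basis. (g y \<bullet> i) *\<^sub>R F y i) has_derivative
      (\<lambda>\<xi>. \<Sum>i\<in>Basis. (g x \<bullet> i) *\<^sub>R F' i \<xi> + (g' \<xi> \<bullet> i) *\<^sub>R F x i)) (at x)"
    by (intro has_derivative_sum has_derivative_scaleR F has_derivative_inner_left g)
  moreover have "(\<Sum>i\<in>Basis. (g x \<bullet> i) *\<^sub>R F' i \<xi> + (g' \<xi> \<bullet> i) *\<^sub>R F x i) = F' (g x) \<xi> + F x (g' \<xi>)" for \<xi>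
    using linear_eq_sum_Basis[OF lin, of "g x"] linear_eq_sum_Basis[OF assms(3)[OF assms(2)], of "g' \<xi>"]
    by (simp add: sum.distrib)
  ultimately have *: "((\<lambda>y. \<Sum>i\<in>Basis. (g y \<bullet> i) *\<^sub>R F y i) has_derivative (\<lambda>\<xi>. F' (g x) \<xi> + F x (g' \<xi>))) (at x)"
    by simp
  show ?thesis
    by (rule has_derivative_transform_within_open[OF * assms(1,2)]) (rule linear_eq_sum_Basis[OF assms(3), symmetric])
qed

lemma has_derivative_bilinear_family:
  fixes g :: "'b::euclidean_space \<Rightarrow> 'c::euclidean_space" and l :: "'b \<Rightarrow> 'c2::euclidean_space"
    and F :: "'b \<Rightarrow> 'c \<Rightarrow> 'c2 \<Rightarrow> 'd::real_normed_vector"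
  assumes S: "open S" "x \<in> S" and lin: "\<And>y k. y \<in> S \<Longrightarrow> linear (\<lambda>h. F y h k)" "\<And>y h. y \<in> S \<Longrightarrow> linear (F y h)"
    and F: "\<And>h k. ((\<lambda>y. F y h k) has_derivative F' h k) (at x)"
    and g: "(g has_derivative g') (at x)" and l: "(l has_derivative l') (at x)"
  shows "((\<lambda>y. F y (g y) (l y)) has_derivative
    (\<lambda>\<xi>. F' (g x) (l x) \<xi> + F x (g' \<xi>) (l x) + F x (g x) (l' \<xi>))) (at x)"
  by (rule has_derivative_family[OF S lin(2) has_derivative_family[OF S lin(1) F g] l])

section \<open>Symmetry of second derivatives\<close>

lemma smooth_on_DERIV_line:
  fixes f :: "'b::euclidean_space \<Rightarrow> real"
  assumes "smooth_on S f" "a + s *\<^sub>R h \<in> S"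
  shows "((\<lambda>s. f (a + s *\<^sub>R h)) has_real_derivative fD f (a + s *\<^sub>R h) h) (at s)"
proof -
  have "((\<lambda>s. f (a + s *\<^sub>R h)) has_derivative (\<lambda>r. fD f (a + s *\<^sub>R h) (r *\<^sub>R h))) (at s)"
    by (rule has_derivative_compose[where g=f and f="\<lambda>s. a + s *\<^sub>R h" and f'="\<lambda>r. r *\<^sub>R h"])
      (rule derivative_eq_intros refl smooth_on_has_derivative[OF assms] | simp)+
  then show ?thesis
    unfolding has_field_derivative_def
    by (rule has_derivative_eq_rhs) (simp add: fun_eq_iff linear_scale[OF smooth_on_linear_fD[OF assms]])
qed

text \<open>Two applications of the mean value theorem: along h to the increment in direction k,
  then along k to the derivative in direction h. The second difference is symmetric in h and k, so
  it can be read in both orders.\<close>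

lemma second_difference_eq_fD:
  fixes f :: "'b::euclidean_space \<Rightarrow> real"
  assumes "smooth_on S f" "ball x r \<subseteq> S" "t > 0" "t * (norm h + norm k) < r"
  shows "\<exists>y. dist x y < r \<and>
    f (x + t *\<^sub>R h + t *\<^sub>R k) - f (x + t *\<^sub>R h) - f (x + t *\<^sub>R k) + f x = t * (t * fD (\<lambda>z. fD f z h) y k)"
proof -
  have in_S: "dist x (x + a *\<^sub>R h + b *\<^sub>R k) < r" "x + a *\<^sub>R h + b *\<^sub>R k \<in> S"
    if "0 \<le> a" "a \<le> t" "0 \<le> b" "b \<le> t" for a b
  proof -
    have "norm (a *\<^sub>R h + b *\<^sub>R k) \<le> a * norm h + b * norm k"
      using that by (metis abs_of_nonneg norm_scaleR norm_triangle_ineq)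
    also have "\<dots> \<le> t * norm h + t * norm k"
      using that by (intro add_mono mult_right_mono) auto
    finally have "norm (a *\<^sub>R h + b *\<^sub>R k) < r" using assms(4) by (simp add: algebra_simps)
    then show "dist x (x + a *\<^sub>R h + b *\<^sub>R k) < r"
      by (metis add.assoc add_diff_cancel_left' dist_norm dist_commute)
    then show "x + a *\<^sub>R h + b *\<^sub>R k \<in> S" using assms(2) by (auto simp: subset_iff)
  qed
  let ?\<phi> = "\<lambda>s. f ((x + t *\<^sub>R k) + s *\<^sub>R h) - f (x + s *\<^sub>R h)"
  have "\<exists>s>0. s < t \<and> ?\<phi> t - ?\<phi> 0 = (t - 0) * (fD f ((x + t *\<^sub>R k) + s *\<^sub>R h) h - fD f (x + s *\<^sub>R h) h)"
  proof (rule MVT2[OF assms(3)])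
    fix s assume s: "0 \<le> s" "s \<le> t"
    have "x + t *\<^sub>R k + s *\<^sub>R h \<in> S" "x + s *\<^sub>R h \<in> S"
      using in_S(2)[of s t] in_S(2)[of s 0] s assms(3) by (auto simp: algebra_simps)
    then show "(?\<phi> has_real_derivative fD f ((x + t *\<^sub>R k) + s *\<^sub>R h) h - fD f (x + s *\<^sub>R h) h) (at s)"
      by (intro DERIV_diff smooth_on_DERIV_line[OF assms(1)])
  qed
  then obtain s where s: "0 < s" "s < t"
    "?\<phi> t - ?\<phi> 0 = t * (fD f ((x + t *\<^sub>R k) + s *\<^sub>R h) h - fD f (x + s *\<^sub>R h) h)" by auto
  let ?\<psi> = "\<lambda>r. fD f ((x + s *\<^sub>R h) + r *\<^sub>R k) h"
  have "\<exists>r>0. r < t \<and> ?\<psi> t - ?\<psi> 0 = (t - 0) * fD (\<lambda>z. fD f z h) ((x + s *\<^sub>R h) + r *\<^sub>R k) k"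
    by (rule MVT2[OF assms(3)])
      (use s in \<open>auto intro!: smooth_on_DERIV_line[OF smooth_on_fD_const[OF assms(1)]] in_S(2)\<close>)
  then obtain r' where "0 < r'" "r' < t"
    "?\<psi> t - ?\<psi> 0 = t * fD (\<lambda>z. fD f z h) ((x + s *\<^sub>R h) + r' *\<^sub>R k) k" by auto
  moreover have "dist x (x + s *\<^sub>R h + r' *\<^sub>R k) < r"
    using s calculation by (intro in_S) auto
  ultimately show ?thesis
    using s(3) by (intro exI[of _ "x + s *\<^sub>R h + r' *\<^sub>R k"]) (simp add: algebra_simps)
qed

text \<open>One second difference equals t^2 times either mixed derivative, each at some point near
  x. By continuity the mixed derivatives cannot differ at x.\<close>

lemma smooth_on_fD_symmetric_real:
  fixes f :: "'b::euclidean_space \<Rightarrow> real"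
  assumes "open S" "smooth_on S f" "x \<in> S"
  shows "fD (\<lambda>z. fD f z h) x k = fD (\<lambda>z. fD f z k) x h"
proof (rule ccontr)
  let ?A = "\<lambda>y. fD (\<lambda>z. fD f z h) y k" and ?B = "\<lambda>y. fD (\<lambda>z. fD f z k) y h"
  assume ne: "?A x \<noteq> ?B x"
  have cont: "isCont ?A x" "isCont ?B x"
    using smooth_on_imp_continuous_on[OF smooth_on_fD_const[OF smooth_on_fD_const[OF assms(2)]]]
      continuous_on_eq_continuous_at[OF assms(1)] assms(3) by blast+
  \<comment> \<open>Half the gap: a number within e of \<open>?A x\<close> cannot also be within e
    of \<open>?B x\<close>.\<close>
  define e where "e = \<bar>?A x - ?B x\<bar> / 2"
  have e: "e > 0" using ne by (simp add: e_def)
  obtain d1 where d1: "d1 > 0" "\<And>y. dist y x < d1 \<Longrightarrow> dist (?A y) (?A x) < e"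
    using cont(1) e unfolding continuous_at_eps_delta by (metis dist_commute)
  obtain d2 where d2: "d2 > 0" "\<And>y. dist y x < d2 \<Longrightarrow> dist (?B y) (?B x) < e"
    using cont(2) e unfolding continuous_at_eps_delta by (metis dist_commute)
  obtain d3 where d3: "d3 > 0" "ball x d3 \<subseteq> S" using assms(1,3) open_contains_ball by blast
  define r where "r = min d1 (min d2 d3)"
  have r: "r > 0" "ball x r \<subseteq> S" using d1 d2 d3 by (auto simp: r_def)
  \<comment> \<open>The summand 1 prevents a zero denominator when h = k = 0 and makes the bound
    \<open>t * (norm h + norm k) < r\<close> strict.\<close>
  define t where "t = r / (norm h + norm k + 1)"
  have pos: "norm h + norm k + 1 > 0" by (simp add: add_nonneg_pos)
  have t: "t > 0" "t * (norm h + norm k) < r"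
    using r pos by (auto simp: t_def field_simps)
  obtain y1 where y1: "dist x y1 < r"
    "f (x + t *\<^sub>R h + t *\<^sub>R k) - f (x + t *\<^sub>R h) - f (x + t *\<^sub>R k) + f x = t * (t * ?A y1)"
    using second_difference_eq_fD[OF assms(2) r(2) t] by blast
  have "t * (norm k + norm h) < r" using t(2) by (simp add: add.commute)
  from second_difference_eq_fD[OF assms(2) r(2) t(1) this]
  obtain y2 where y2: "dist x y2 < r"
    "f (x + t *\<^sub>R k + t *\<^sub>R h) - f (x + t *\<^sub>R k) - f (x + t *\<^sub>R h) + f x = t * (t * ?B y2)"
    by blast
  have "t * (t * ?A y1) = t * (t * ?B y2)"
  proof -
    have swap: "x + t *\<^sub>R k + t *\<^sub>R h = x + t *\<^sub>R h + t *\<^sub>R k" by simp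
    show ?thesis using y1(2) y2(2)[unfolded swap] by linarith
  qed
  then have "?A y1 = ?B y2" using t by simp
  moreover have "dist (?A y1) (?A x) < e" "dist (?B y2) (?B x) < e"
    using y1(1) y2(1) by (auto simp: r_def dist_commute[of x] intro!: d1(2) d2(2))
  ultimately show False by (auto simp: e_def dist_real_def abs_if split: if_splits)
qed

lemma fD_inner_left:
  "smooth_on S f \<Longrightarrow> x \<in> S \<Longrightarrow> fD (\<lambda>y. f y \<bullet> i) x h = fD f x h \<bullet> i"
  using fD_eqI[OF has_derivative_inner_left[OF smooth_on_has_derivative]] by metis

text \<open>\<open>frechet_derivative\<close> is a choice among the derivatives; functions that
  agree near x have the same derivatives there, so the same choice is made.\<close>

lemma fD_cong_open:
  assumes "open S" "x \<in> S" "\<And>y. y \<in> S \<Longrightarrow> f y = g y"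
  shows "fD f x = fD g x"
proof -
  have "(f has_derivative f') (at x) \<longleftrightarrow> (g has_derivative f') (at x)" for f'
    using has_derivative_transform_within_open[of f f' x UNIV S g]
      has_derivative_transform_within_open[of g f' x UNIV S f] assms by auto
  then show ?thesis by (simp add: frechet_derivative_def)
qed

text \<open>The mean value theorem needs real values, hence the passage to components.\<close>

lemma smooth_on_fD_symmetric:
  fixes f :: "'b::euclidean_space \<Rightarrow> 'c::euclidean_space"
  assumes "open S" "smooth_on S f" "x \<in> S"
  shows "fD (\<lambda>z. fD f z h) x k = fD (\<lambda>z. fD f z k) x h"
proof (rule euclidean_eqI)
  fix i :: 'c
  have "fD (\<lambda>z. fD (\<lambda>y. f y \<bullet> i) z h) x k = fD (\<lambda>z. fD f z h) x k \<bullet> i" for h k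
    using fD_cong_open[OF assms(1,3), of "\<lambda>z. fD (\<lambda>y. f y \<bullet> i) z h" "\<lambda>z. fD f z h \<bullet> i"]
      fD_inner_left[OF assms(2)] fD_inner_left[OF smooth_on_fD_const[OF assms(2)] assms(3)] by simp
  then show "fD (\<lambda>z. fD f z h) x k \<bullet> i = fD (\<lambda>z. fD f z k) x h \<bullet> i"
    using smooth_on_fD_symmetric_real[OF assms(1) smooth_on_inner_left[OF assms(1,2)] assms(3)] by metis
qed

section \<open>Bump functions\<close>

text \<open>The polynomial factor makes the family closed under differentiation, so that smoothness
  of exp(-1/x), extended by zero, follows by one induction over all p at once.\<close>

definition flat_exp :: "real poly \<Rightarrow> real \<Rightarrow> real" where
  "flat_exp p x = (if x > 0 then poly p (1 / x) * exp (- (1 / x)) else 0)"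

lemma poly_exp_minus_tendsto_0: "((\<lambda>t. poly p t * exp (- t)) \<longlongrightarrow> (0::real)) at_top"
proof -
  have "((\<lambda>t. \<Sum>i\<le>degree p. coeff p i * (t ^ i / exp t)) \<longlongrightarrow> (\<Sum>i\<le>degree p. coeff p i * 0)) at_top"
    by (intro tendsto_intros tendsto_power_div_exp_0)
  then show ?thesis
    by (simp add: poly_altdef sum_distrib_right exp_minus divide_inverse mult.assoc)
qed

lemma flat_exp_tendsto_0: "(flat_exp p \<longlongrightarrow> 0) (at 0)"
proof -
  have "((\<lambda>x. poly p (inverse x) * exp (- inverse x)) \<longlongrightarrow> 0) (at_right 0)"
    using filterlim_compose[OF poly_exp_minus_tendsto_0 filterlim_inverse_at_top_right] by simp
  then have "(flat_exp p \<longlongrightarrow> 0) (at_right 0)"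
    by (rule Lim_transform_eventually)
      (auto simp: flat_exp_def eventually_at_filter inverse_eq_divide)
  moreover have "(flat_exp p \<longlongrightarrow> 0) (at_left 0)"
    by (rule Lim_transform_eventually[OF tendsto_const]) (auto simp: flat_exp_def eventually_at_filter)
  ultimately show ?thesis by (simp add: filterlim_at_split)
qed

text \<open>For x > 0 the derivative is (1/x^2) (p(1/x) - p'(1/x)) exp(-1/x); the monomial
  \<open>[:0, 0, 1:]\<close> supplies the factor 1/x^2.\<close>

lemma DERIV_flat_exp:
  "(flat_exp p has_real_derivative flat_exp ([:0, 0, 1:] * (p - pderiv p)) x) (at x)"
proof -
  let ?q = "[:0, 0, 1:] * (p - pderiv p)"
  consider "x > 0" | "x < 0" | "x = 0" by linarith
  then show ?thesis
  proof cases
    case 1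
    have "((\<lambda>x. poly p (1 / x) * exp (- (1 / x))) has_real_derivative poly ?q (1 / x) * exp (- (1 / x))) (at x)"
      using 1 by (auto intro!: derivative_eq_intros DERIV_chain2[OF poly_DERIV] simp: field_simps power2_eq_square)
    moreover have ev: "eventually (\<lambda>y. poly p (1 / y) * exp (- (1 / y)) = flat_exp p y) (nhds x)"
      using eventually_nhds_in_open[of "{0<..}" x] 1 by (auto elim!: eventually_mono simp: flat_exp_def)
    ultimately show ?thesis
      using 1 DERIV_cong_ev[OF refl ev refl] by (simp only: flat_exp_def[of ?q] if_True)
  next
    case 2
    have ev: "eventually (\<lambda>y. 0 = flat_exp p y) (nhds x)"
      using eventually_nhds_in_open[of "{..<0}" x] 2 by (auto elim!: eventually_mono simp: flat_exp_def)
    moreover have "flat_exp ?q x = 0" using 2 by (simp add: flat_exp_def)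
    ultimately show ?thesis
      using iffD1[OF DERIV_cong_ev[OF refl ev refl], of 0] DERIV_const by (simp only:) blast
  next
    case 3
    \<comment> \<open>Dividing by h multiplies p by its variable, so the difference quotient at 0 is
      itself a flat function and tends to 0.\<close>
    have "(\<lambda>h. (flat_exp p (0 + h) - flat_exp p 0) / h) = flat_exp (pCons 0 p)"
      by (auto simp: flat_exp_def)
    then show ?thesis
      using flat_exp_tendsto_0[of "pCons 0 p"] 3 by (simp add: DERIV_def flat_exp_def)
  qed
qed

lemma smooth_on_flat_exp: "smooth_on UNIV (flat_exp p)"
  unfolding smooth_on_def
proof
  fix k
  show "C_upto k UNIV (flat_exp p)"
  proof (induction k arbitrary: p)
    case 0
    then show ?case
      using DERIV_isCont[OF DERIV_flat_exp] by (auto intro: continuous_at_imp_continuous_on)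
  next
    case (Suc k)
    show ?case
      by (rule C_upto_SucI[OF _ DERIV_flat_exp[unfolded has_field_derivative_def]], rule open_UNIV)
        (rule C_upto_scaleR[where 'c=real, unfolded real_scaleR_def, OF open_UNIV Suc C_upto_const[OF open_UNIV]])
  qed
qed

definition smooth_step :: "real \<Rightarrow> real" where
  "smooth_step x = flat_exp 1 x * inverse (flat_exp 1 x + flat_exp 1 (1 - x))"

lemma smooth_step_eq: "x \<le> 0 \<Longrightarrow> smooth_step x = 0" "x \<ge> 1 \<Longrightarrow> smooth_step x = 1"
  by (auto simp: smooth_step_def flat_exp_def)

text \<open>At least one of x and 1 - x is positive, so the denominator never vanishes.\<close>

lemma smooth_on_smooth_step: "smooth_on UNIV smooth_step"
proof -
  have 1: "smooth_on UNIV (\<lambda>x. flat_exp 1 (1 - x))"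
    by (rule smooth_on_comp[where T=UNIV]) (auto intro!: smooth_intros smooth_on_flat_exp)
  have "flat_exp 1 x + flat_exp 1 (1 - x) \<noteq> 0" for x
    by (auto simp: flat_exp_def add_pos_pos less_imp_neq[OF add_pos_pos, symmetric])
  then show ?thesis
    unfolding smooth_step_def[abs_def]
    by (intro smooth_intros smooth_on_inverse smooth_on_flat_exp 1) auto
qed

lemma smooth_bump_euclidean:
  fixes a :: "'b::euclidean_space"
  assumes "r > 0"
  obtains f :: "'b \<Rightarrow> real" where "smooth_on UNIV f" "\<And>x. x \<in> ball a r \<Longrightarrow> f x = 1"
    "\<And>x. x \<notin> cball a (2 * r) \<Longrightarrow> f x = 0"
proof
  \<comment> \<open>The squared distance keeps the function smooth at the centre. The value is at
    least 1 up to radius r and at most 0 from radius sqrt 2 times r on, in particular outside radius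
    2 r.\<close>
  let ?q = "\<lambda>x. 2 - (1 / r\<^sup>2) * ((x - a) \<bullet> (x - a))"
  have "smooth_on UNIV ?q"
    by (intro smooth_intros smooth_on_inner) auto
  then show "smooth_on UNIV (\<lambda>x. smooth_step (?q x))"
    by (intro smooth_on_comp[OF _ _ _ smooth_on_smooth_step]) auto
  fix x
  have n: "(x - a) \<bullet> (x - a) = (dist a x)\<^sup>2" by (metis dist_commute dist_norm power2_norm_eq_inner)
  show "smooth_step (?q x) = 1" if "x \<in> ball a r"
  proof -
    have "(dist a x)\<^sup>2 \<le> r\<^sup>2" using that by (intro power_mono) auto
    then show ?thesis using assms by (intro smooth_step_eq) (auto simp: n field_simps)
  qed
  show "smooth_step (?q x) = 0" if "x \<notin> cball a (2 * r)"
  proof -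
    have "(2 * r)\<^sup>2 \<le> (dist a x)\<^sup>2" using that assms by (intro power_mono) auto
    moreover have "2 * r\<^sup>2 \<le> (2 * r)\<^sup>2" by (simp add: power2_eq_square)
    ultimately have "2 * r\<^sup>2 \<le> (dist a x)\<^sup>2" by linarith
    then show ?thesis using assms by (intro smooth_step_eq) (auto simp: n field_simps)
  qed
qed

section \<open>Charts and tangent vectors\<close>

lemma base_tvec [simp]:
  "base (u + w) = base u" "base (u - w) = base u" "base (- u) = base u" "base (a *\<^sub>R u) = base u"
  "base (zero_vec p) = p"
  by (simp_all add: plus_tvec_def minus_tvec_def uminus_tvec_def scaleR_tvec_def zero_vec_def)

lemma coord_tvec [simp]:
  "coord (u + w) c = coord u c + coord w c" "coord (u - w) c = coord u c - coord w c"
  "coord (- u) c = - coord u c" "coord (a *\<^sub>R u) c = a *\<^sub>R coord u c" "coord (zero_vec p) c = 0"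
  by (simp_all add: plus_tvec_def minus_tvec_def uminus_tvec_def scaleR_tvec_def zero_vec_def)

abbreviation loc :: "('a, 'e) chart \<Rightarrow> ('a \<Rightarrow> ('a, 'e) tvec) \<Rightarrow> 'e \<Rightarrow> 'e" where
  "loc c X \<equiv> \<lambda>x. coord (X (cinv c x)) c"

locale manifold =
  fixes \<A> :: "('a::{t2_space, second_countable_topology}, 'e::euclidean_space) chart set"
  assumes atlas: "smooth_atlas \<A>"
begin

lemma chart_exists: obtains c where "c \<in> \<A>" "p \<in> cdom c"
  using atlas unfolding smooth_atlas_def by blast

lemma open_cdom: "c \<in> \<A> \<Longrightarrow> open (cdom c)"
  using atlas unfolding smooth_atlas_def by blast

lemma chart_homeo: "c \<in> \<A> \<Longrightarrow> homeomorphism (cdom c) (cmap c ` cdom c) (cmap c) (cinv c)"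
  using atlas unfolding smooth_atlas_def by blast

lemma open_cimage_cdom: "c \<in> \<A> \<Longrightarrow> open (cmap c ` cdom c)"
  using atlas unfolding smooth_atlas_def by blast

lemma cinv_cmap: "c \<in> \<A> \<Longrightarrow> p \<in> cdom c \<Longrightarrow> cinv c (cmap c p) = p"
  using chart_homeo homeomorphism_apply1 by blast

lemma cmap_cinv: "c \<in> \<A> \<Longrightarrow> x \<in> cmap c ` cdom c \<Longrightarrow> cmap c (cinv c x) = x"
  using chart_homeo homeomorphism_apply2 by blast

lemma open_cimage:
  assumes "c \<in> \<A>" "open S" "S \<subseteq> cdom c"
  shows "open (cmap c ` S)"
  using homeomorphism_imp_open_map[OF chart_homeo[OF assms(1)], of S] assms open_cimage_cdom
  by (metis inf.absorb_iff2 open_openin_trans open_openin subtopology_UNIV openin_open_Int openin_open_eq)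

lemma open_cvimage:
  assumes "c \<in> \<A>" "open T"
  shows "open (cdom c \<inter> cmap c -` T)"
  using homeomorphism_cont1[OF chart_homeo[OF assms(1)]] continuous_on_open_vimage[OF open_cdom[OF assms(1)]] assms
  by (metis inf_commute)

abbreviation tr :: "('a, 'e) chart \<Rightarrow> ('a, 'e) chart \<Rightarrow> 'e \<Rightarrow> 'e" where
  "tr c d \<equiv> cmap d \<circ> cinv c"

lemma smooth_on_tr: "c \<in> \<A> \<Longrightarrow> d \<in> \<A> \<Longrightarrow> smooth_on (cmap c ` (cdom c \<inter> cdom d)) (tr c d)"
  using atlas unfolding smooth_atlas_def by blast

lemma tr_has_derivative:
  "c \<in> \<A> \<Longrightarrow> d \<in> \<A> \<Longrightarrow> p \<in> cdom c \<Longrightarrow> p \<in> cdom d \<Longrightarrow>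
    (tr c d has_derivative fD (tr c d) (cmap c p)) (at (cmap c p))"
  by (rule smooth_on_has_derivative[OF smooth_on_tr]) auto

lemma linear_fD_tr:
  "c \<in> \<A> \<Longrightarrow> d \<in> \<A> \<Longrightarrow> p \<in> cdom c \<Longrightarrow> p \<in> cdom d \<Longrightarrow> linear (fD (tr c d) (cmap c p))"
  using tr_has_derivative has_derivative_linear by blast

lemma fD_tr_self: "c \<in> \<A> \<Longrightarrow> p \<in> cdom c \<Longrightarrow> fD (tr c c) (cmap c p) h = h"
  using fD_cong_open[OF open_cimage_cdom, of c "cmap c p" "tr c c" "\<lambda>x. x"] by (simp add: cmap_cinv)

lemma fD_tr_comp:
  assumes "c \<in> \<A>" "d \<in> \<A>" "e \<in> \<A>" "p \<in> cdom c" "p \<in> cdom d" "p \<in> cdom e"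
  shows "fD (tr d e) (cmap d p) (fD (tr c d) (cmap c p) h) = fD (tr c e) (cmap c p) h"
proof -
  let ?S = "cmap c ` (cdom c \<inter> cdom d \<inter> cdom e)"
  have S: "open ?S" "cmap c p \<in> ?S" using assms by (auto intro!: open_cimage open_Int open_cdom)
  have "((\<lambda>x. tr d e (tr c d x)) has_derivative (\<lambda>h. fD (tr d e) (cmap d p) (fD (tr c d) (cmap c p) h))) (at (cmap c p))"
    by (rule has_derivative_compose[OF tr_has_derivative]) (use assms tr_has_derivative[of d e p] in \<open>simp_all add: cinv_cmap comp_def\<close>)
  then have "(tr c e has_derivative (\<lambda>h. fD (tr d e) (cmap d p) (fD (tr c d) (cmap c p) h))) (at (cmap c p))"
    by (rule has_derivative_transform_within_open[OF _ S]) (use assms in \<open>auto simp: cinv_cmap\<close>)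
  then show ?thesis by (metis fD_eqI)
qed

lemma smooth_on_chart_change:
  fixes f :: "'e \<Rightarrow> 'f::real_normed_vector"
  assumes "c \<in> \<A>" "d \<in> \<A>" "open \<Omega>" "\<Omega> \<subseteq> cdom c" "\<Omega> \<subseteq> cdom d" "smooth_on (cmap c ` \<Omega>) f"
  shows "smooth_on (cmap d ` \<Omega>) (\<lambda>x. f (tr d c x))"
proof (rule smooth_on_comp[OF _ _ _ assms(6)])
  show "smooth_on (cmap d ` \<Omega>) (tr d c)"
    by (rule smooth_on_subset[OF smooth_on_tr]) (use assms in \<open>auto intro!: open_cimage open_Int open_cdom\<close>)
qed (use assms in \<open>auto intro!: open_cimage simp: cinv_cmap subset_iff\<close>)

section \<open>Tangent vectors in coordinates\<close>

definition tvec_at :: "('a, 'e) chart \<Rightarrow> 'a \<Rightarrow> 'e \<Rightarrow> ('a, 'e) tvec" where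
  "tvec_at c p h = TVec p (\<lambda>d. if d \<in> \<A> \<and> p \<in> cdom d then fD (tr c d) (cmap c p) h else 0)"

lemma base_tvec_at [simp]: "base (tvec_at c p h) = p"
  by (simp add: tvec_at_def)

lemma coord_tvec_at: "c \<in> \<A> \<Longrightarrow> p \<in> cdom c \<Longrightarrow> coord (tvec_at c p h) c = h"
  by (simp add: tvec_at_def fD_tr_self)

lemma tvec_at_in: "c \<in> \<A> \<Longrightarrow> p \<in> cdom c \<Longrightarrow> tvec_at c p h \<in> tangent_space \<A> p"
  by (auto simp: tangent_space_def tvec_at_def fD_tr_comp)

lemma tangent_base: "u \<in> tangent_space \<A> p \<Longrightarrow> base u = p"
  by (simp add: tangent_space_def)

lemma tangent_coord:
  "u \<in> tangent_space \<A> p \<Longrightarrow> c \<in> \<A> \<Longrightarrow> d \<in> \<A> \<Longrightarrow> p \<in> cdom c \<Longrightarrow> p \<in> cdom d \<Longrightarrow>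
    coord u d = fD (tr c d) (cmap c p) (coord u c)"
  unfolding tangent_space_def by blast

lemma tangent_coord_0: "u \<in> tangent_space \<A> p \<Longrightarrow> c \<notin> \<A> \<or> p \<notin> cdom c \<Longrightarrow> coord u c = 0"
  unfolding tangent_space_def by blast

text \<open>The transformation law determines the components in all charts around p from those in c,
  and the remaining components are zero by normalisation. Every identity between tangent vectors is
  therefore checked in a single chart.\<close>

lemma tangent_eqI:
  assumes "u \<in> tangent_space \<A> p" "w \<in> tangent_space \<A> p" "c \<in> \<A>" "p \<in> cdom c" "coord u c = coord w c"
  shows "u = w"
proof (rule tvec.expand, intro conjI)
  show "coord u = coord w"
  proof
    fix d show "coord u d = coord w d"
      using tangent_coord[OF assms(1,3) _ assms(4), of d] tangent_coord[OF assms(2,3) _ assms(4), of d]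
        tangent_coord_0[OF assms(1), of d] tangent_coord_0[OF assms(2), of d] assms(5)
      by (cases "d \<in> \<A> \<and> p \<in> cdom d") auto
  qed
qed (use assms(1,2) in \<open>auto simp: tangent_base\<close>)

lemma tvec_at_coord: "u \<in> tangent_space \<A> p \<Longrightarrow> c \<in> \<A> \<Longrightarrow> p \<in> cdom c \<Longrightarrow> tvec_at c p (coord u c) = u"
  by (rule tangent_eqI) (auto simp: coord_tvec_at tvec_at_in)

lemma tangent_spaceI:
  assumes "base u = p" "\<And>c. c \<notin> \<A> \<or> p \<notin> cdom c \<Longrightarrow> coord u c = 0"
    and "\<And>c d. c \<in> \<A> \<Longrightarrow> d \<in> \<A> \<Longrightarrow> p \<in> cdom c \<Longrightarrow> p \<in> cdom d \<Longrightarrow>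
      coord u d = fD (tr c d) (cmap c p) (coord u c)"
  shows "u \<in> tangent_space \<A> p"
  unfolding tangent_space_def using assms by blast

lemma tangent_space_lincomb:
  assumes "u \<in> tangent_space \<A> p" "w \<in> tangent_space \<A> p"
  shows "a *\<^sub>R u + b *\<^sub>R w \<in> tangent_space \<A> p"
proof (rule tangent_spaceI)
  fix c d assume cd: "c \<in> \<A>" "d \<in> \<A>" "p \<in> cdom c" "p \<in> cdom d"
  show "coord (a *\<^sub>R u + b *\<^sub>R w) d = fD (tr c d) (cmap c p) (coord (a *\<^sub>R u + b *\<^sub>R w) c)"
    using tangent_coord[OF assms(1) cd] tangent_coord[OF assms(2) cd]
    by (simp only: coord_tvec linear_add[OF linear_fD_tr[OF cd]] linear_scale[OF linear_fD_tr[OF cd]])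
qed (simp_all add: tangent_base[OF assms(1)] tangent_coord_0[OF assms(1)] tangent_coord_0[OF assms(2)])

lemma tangent_space_add: "u \<in> tangent_space \<A> p \<Longrightarrow> w \<in> tangent_space \<A> p \<Longrightarrow> u + w \<in> tangent_space \<A> p"
  using tangent_space_lincomb[of u p w 1 1] by (simp add: plus_tvec_def scaleR_tvec_def)

lemma tangent_space_diff: "u \<in> tangent_space \<A> p \<Longrightarrow> w \<in> tangent_space \<A> p \<Longrightarrow> u - w \<in> tangent_space \<A> p"
  using tangent_space_lincomb[of u p w 1 "-1"] by (simp add: plus_tvec_def minus_tvec_def scaleR_tvec_def)

lemma tangent_space_minus: "u \<in> tangent_space \<A> p \<Longrightarrow> - u \<in> tangent_space \<A> p"
  using tangent_space_lincomb[of u p u "-1" 0] by (simp add: plus_tvec_def uminus_tvec_def scaleR_tvec_def)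

lemma tangent_space_scaleR: "u \<in> tangent_space \<A> p \<Longrightarrow> a *\<^sub>R u \<in> tangent_space \<A> p"
  using tangent_space_lincomb[of u p u a 0] by (simp add: plus_tvec_def scaleR_tvec_def)

lemmas tangent_space_closed = tangent_space_add tangent_space_diff tangent_space_minus tangent_space_scaleR

lemma zero_vec_in: "zero_vec p \<in> tangent_space \<A> p"
  by (auto simp: tangent_space_def linear_0[OF linear_fD_tr] zero_vec_def)

lemma bundle_cinv_bundle_chart:
  assumes "c \<in> \<A>" "v \<in> tangent_space \<A> p" "p \<in> cdom c"
  shows "bundle_cinv \<A> c (bundle_chart c v) = v"
  unfolding bundle_cinv_def
proof (rule inv_into_f_f)
  show "inj_on (bundle_chart c) {v \<in> tangent_bundle \<A>. base v \<in> cdom c}"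
  proof (rule inj_onI)
    fix u w assume u: "u \<in> {v \<in> tangent_bundle \<A>. base v \<in> cdom c}" and w: "w \<in> {v \<in> tangent_bundle \<A>. base v \<in> cdom c}"
      and eq: "bundle_chart c u = bundle_chart c w"
    have "base u = base w"
      using u w eq cinv_cmap[OF assms(1)] unfolding bundle_chart_def by (metis (no_types, lifting) Pair_inject mem_Collect_eq)
    moreover have "u \<in> tangent_space \<A> (base u)" "w \<in> tangent_space \<A> (base w)"
      using u w by (auto simp: tangent_bundle_def tangent_base)
    ultimately show "u = w"
      using u eq by (intro tangent_eqI[OF _ _ assms(1), of u "base u"]) (auto simp: bundle_chart_def)
  qed
  show "v \<in> {v \<in> tangent_bundle \<A>. base v \<in> cdom c}"
    using assms by (auto simp: tangent_bundle_def tangent_base)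
qed

section \<open>Smooth functions and vector fields on a manifold\<close>

lemma vector_fields_on_in: "X \<in> vector_fields_on \<A> \<Omega> \<Longrightarrow> p \<in> \<Omega> \<Longrightarrow> X p \<in> tangent_space \<A> p"
  by (simp add: vector_fields_on_def)

lemma vector_fields_on_smooth:
  "X \<in> vector_fields_on \<A> \<Omega> \<Longrightarrow> c \<in> \<A> \<Longrightarrow> smooth_on (cmap c ` (cdom c \<inter> \<Omega>)) (loc c X)"
  by (simp add: vector_fields_on_def)

lemma vector_fields_in: "X \<in> vector_fields \<A> \<Longrightarrow> X p \<in> tangent_space \<A> p"
  by (simp add: vector_fields_on_def)

lemma vector_fields_smooth: "X \<in> vector_fields \<A> \<Longrightarrow> c \<in> \<A> \<Longrightarrow> smooth_on (cmap c ` cdom c) (loc c X)"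
  by (simp add: vector_fields_on_def)

text \<open>The components in another chart d arise from those in c by the derivative of the
  transition map, followed by a change of variables; both preserve smoothness.\<close>

lemma vector_fields_on_chartI:
  assumes "c \<in> \<A>" "open \<Omega>" "\<Omega> \<subseteq> cdom c" "\<And>p. p \<in> \<Omega> \<Longrightarrow> X p \<in> tangent_space \<A> p"
    and "smooth_on (cmap c ` \<Omega>) (loc c X)"
  shows "X \<in> vector_fields_on \<A> \<Omega>"
proof -
  have "smooth_on (cmap d ` (cdom d \<inter> \<Omega>)) (loc d X)" if d: "d \<in> \<A>" for d
  proof -
    let ?O = "cdom d \<inter> \<Omega>"
    have O: "open ?O" "?O \<subseteq> cdom c" "?O \<subseteq> cdom d" "open (cmap c ` ?O)" "open (cmap d ` ?O)"
      using assms d by (auto intro!: open_cimage open_cdom open_Int)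
    have "smooth_on (cmap c ` ?O) (\<lambda>y. fD (tr c d) y (loc c X y))"
      by (intro smooth_on_fD O smooth_on_subset[OF smooth_on_tr] smooth_on_subset[OF assms(5)])
        (use assms d in \<open>auto intro!: open_cimage open_Int open_cdom\<close>)
    from smooth_on_chart_change[OF assms(1) d O(1-3) this]
    show ?thesis
      by (rule smooth_on_cong[OF O(5)])
        (use assms d in \<open>auto simp: cinv_cmap subset_iff tangent_coord[OF assms(4) assms(1) d]\<close>)
  qed
  then show ?thesis using assms by (simp add: vector_fields_on_def)
qed

lemma vector_fields_on_subset:
  assumes "X \<in> vector_fields_on \<A> \<Omega>" "open \<Omega>" "\<Omega>' \<subseteq> \<Omega>"
  shows "X \<in> vector_fields_on \<A> \<Omega>'"
proof -
  have "smooth_on (cmap c ` (cdom c \<inter> \<Omega>')) (loc c X)" if "c \<in> \<A>" for c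
    by (rule smooth_on_subset[OF vector_fields_on_smooth[OF assms(1) that]])
      (use assms that in \<open>auto intro!: open_cimage open_cdom open_Int\<close>)
  then show ?thesis using assms by (auto simp: vector_fields_on_def)
qed

lemma vector_fields_on_local:
  assumes "\<And>p. p \<in> \<Omega> \<Longrightarrow> \<exists>N. open N \<and> p \<in> N \<and> X \<in> vector_fields_on \<A> N"
  shows "X \<in> vector_fields_on \<A> \<Omega>"
proof -
  have "smooth_on (cmap c ` (cdom c \<inter> \<Omega>)) (loc c X)" if c: "c \<in> \<A>" for c
  proof (rule smooth_on_local)
    fix x assume "x \<in> cmap c ` (cdom c \<inter> \<Omega>)"
    then obtain p where p: "p \<in> cdom c" "p \<in> \<Omega>" "x = cmap c p" by blast
    obtain N where N: "open N" "p \<in> N" "X \<in> vector_fields_on \<A> N" using assms[OF p(2)] by blast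
    show "\<exists>N. open N \<and> x \<in> N \<and> smooth_on N (loc c X)"
      by (rule exI[of _ "cmap c ` (cdom c \<inter> N)"])
        (use N p c vector_fields_on_smooth[OF N(3) c] in \<open>auto intro!: open_cimage open_cdom open_Int\<close>)
  qed
  moreover have "X p \<in> tangent_space \<A> p" if "p \<in> \<Omega>" for p
    using assms[OF that] vector_fields_on_in by blast
  ultimately show ?thesis by (simp add: vector_fields_on_def)
qed

lemma smooth_funs_smooth: "f \<in> smooth_funs \<A> \<Longrightarrow> c \<in> \<A> \<Longrightarrow> smooth_on (cmap c ` cdom c) (\<lambda>x. f (cinv c x))"
  by (simp add: smooth_funs_def comp_def)

lemma smooth_funs_const: "(\<lambda>p. a) \<in> smooth_funs \<A>"
  by (auto simp: smooth_funs_def comp_def intro!: smooth_intros open_cimage_cdom)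

lemma smooth_funs_mult: "f \<in> smooth_funs \<A> \<Longrightarrow> g \<in> smooth_funs \<A> \<Longrightarrow> (\<lambda>p. f p * g p) \<in> smooth_funs \<A>"
  by (auto simp: smooth_funs_def comp_def intro!: smooth_intros open_cimage_cdom)

lemma vector_fields_scale:
  "f \<in> smooth_funs \<A> \<Longrightarrow> X \<in> vector_fields \<A> \<Longrightarrow> (\<lambda>p. f p *\<^sub>R X p) \<in> vector_fields \<A>"
  using smooth_funs_smooth tangent_space_closed(4)
  by (auto simp: vector_fields_on_def intro!: smooth_intros open_cimage_cdom)

lemma vector_fields_add:
  "X \<in> vector_fields \<A> \<Longrightarrow> Y \<in> vector_fields \<A> \<Longrightarrow> (\<lambda>p. X p + Y p) \<in> vector_fields \<A>"
  using tangent_space_closed(1) by (auto simp: vector_fields_on_def intro!: smooth_intros open_cimage_cdom)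

section \<open>Cutoff functions and extension of local fields\<close>

definition cutoff :: "('a \<Rightarrow> real) \<Rightarrow> 'a set \<Rightarrow> 'a set \<Rightarrow> bool" where
  "cutoff f W K \<longleftrightarrow> f \<in> smooth_funs \<A> \<and> open W \<and> closed K \<and> W \<subseteq> K \<and> (\<forall>p\<in>W. f p = 1) \<and> (\<forall>p. p \<notin> K \<longrightarrow> f p = 0)"

lemma cutoff_exists:
  assumes "open \<Omega>" "p \<in> \<Omega>"
  obtains f W K where "cutoff f W K" "p \<in> W" "K \<subseteq> \<Omega>"
proof -
  obtain c where c: "c \<in> \<A>" "p \<in> cdom c" using chart_exists .
  let ?U = "cmap c ` (cdom c \<inter> \<Omega>)"
  have "open ?U" "cmap c p \<in> ?U" using assms c by (auto intro!: open_cimage open_cdom open_Int)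
  then obtain e where e: "e > 0" "cball (cmap c p) e \<subseteq> ?U" using open_contains_cball by blast
  define r where "r = e / 2"
  have r: "r > 0" "cball (cmap c p) (2 * r) \<subseteq> ?U" using e by (auto simp: r_def)
  obtain g :: "'e \<Rightarrow> real" where g: "smooth_on UNIV g" "\<And>x. x \<in> ball (cmap c p) r \<Longrightarrow> g x = 1"
    "\<And>x. x \<notin> cball (cmap c p) (2 * r) \<Longrightarrow> g x = 0"
    using smooth_bump_euclidean[OF r(1)] by blast
  define f where "f q = (if q \<in> cdom c then g (cmap c q) else 0)" for q
  define K where "K = cinv c ` cball (cmap c p) (2 * r)"
  define W where "W = cdom c \<inter> cmap c -` ball (cmap c p) r"
  \<comment> \<open>Compactness in the Hausdorff space M yields closedness in all of M, not merely
    in the chart domain.\<close>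
  have "compact K" unfolding K_def
    by (rule compact_continuous_image[OF continuous_on_subset[OF homeomorphism_cont2[OF chart_homeo[OF c(1)]]]])
      (use r in auto)
  then have K: "closed K" "K \<subseteq> \<Omega>"
    using r(2) cinv_cmap[OF c(1)] by (auto simp: K_def compact_imp_closed)
  have W: "open W" "p \<in> W" using c r by (auto simp: W_def open_cvimage)
  have f0: "f q = 0" if "q \<notin> K" for q
  proof (cases "q \<in> cdom c")
    case True
    then have "cmap c q \<notin> cball (cmap c p) (2 * r)" using that cinv_cmap[OF c(1) True] by (metis K_def imageI)
    then show ?thesis using g(3) by (simp add: f_def)
  qed (simp add: f_def)
  have "smooth_on (cmap d ` cdom d) (f \<circ> cinv d)" if d: "d \<in> \<A>" for d
  proof (rule smooth_on_local)
    fix x assume "x \<in> cmap d ` cdom d"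
    then obtain q where q: "q \<in> cdom d" "x = cmap d q" by blast
    show "\<exists>N. open N \<and> x \<in> N \<and> smooth_on N (f \<circ> cinv d)"
    proof (cases "q \<in> cdom c")
      case True
      let ?N = "cmap d ` (cdom c \<inter> cdom d)"
      have N: "open ?N" using c d by (auto intro!: open_cimage open_cdom open_Int)
      have "smooth_on ?N (\<lambda>x. g (tr d c x))"
        by (rule smooth_on_chart_change[OF c(1) d _ _ _ smooth_on_subset[OF g(1)]])
          (use c d in \<open>auto intro!: open_cdom open_Int\<close>)
      then have "smooth_on ?N (f \<circ> cinv d)"
        by (rule smooth_on_cong[OF N]) (auto simp: f_def cinv_cmap d)
      then show ?thesis using N q True by blast
    next
      case False
      let ?N = "cmap d ` (cdom d \<inter> - K)"
      have N: "open ?N" using d K by (auto intro!: open_cimage open_cdom open_Int)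
      have "smooth_on ?N (f \<circ> cinv d)"
        by (rule smooth_on_cong[OF N smooth_on_const[OF N, of 0]]) (auto simp: f0 cinv_cmap d)
      moreover have "q \<notin> K" using False r(2) cinv_cmap[OF c(1)] by (auto simp: K_def)
      ultimately show ?thesis using N q by blast
    qed
  qed
  then have "f \<in> smooth_funs \<A>" by (simp add: smooth_funs_def)
  moreover have "W \<subseteq> K"
  proof
    fix q assume q: "q \<in> W"
    then have "cmap c q \<in> cball (cmap c p) (2 * r)" using r(1) by (auto simp: W_def)
    moreover have "cinv c (cmap c q) = q" using q cinv_cmap[OF c(1)] by (simp add: W_def)
    ultimately show "q \<in> K" unfolding K_def by (metis imageI)
  qed
  moreover have "\<forall>q\<in>W. f q = 1" using g(2) by (simp add: W_def f_def)
  ultimately have "cutoff f W K" using K W f0 by (simp add: cutoff_def)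
  then show ?thesis using that W K by blast
qed

text \<open>Outside \<Omega> the value of X is arbitrary and may have another base point, so that
  multiplying it by 0 could give a zero vector of the wrong tangent space.\<close>

definition cut_field :: "('a \<Rightarrow> real) \<Rightarrow> 'a set \<Rightarrow> ('a \<Rightarrow> ('a, 'e) tvec) \<Rightarrow> 'a \<Rightarrow> ('a, 'e) tvec" where
  "cut_field f \<Omega> X p = (if p \<in> \<Omega> then f p *\<^sub>R X p else zero_vec p)"

text \<open>\<Omega> and the complement of the closed set K form an open cover: on the first set the
  field is a product of smooth objects, on the second it is zero.\<close>

lemma cut_field_in_vector_fields:
  assumes "cutoff f W K" "K \<subseteq> \<Omega>" "open \<Omega>" "X \<in> vector_fields_on \<A> \<Omega>"
  shows "cut_field f \<Omega> X \<in> vector_fields \<A>"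
proof (rule vector_fields_on_local)
  have f: "f \<in> smooth_funs \<A>" "closed K" "\<And>p. p \<notin> K \<Longrightarrow> f p = 0" using assms(1) by (auto simp: cutoff_def)
  fix p :: 'a
  obtain c where c: "c \<in> \<A>" "p \<in> cdom c" using chart_exists .
  show "\<exists>N. open N \<and> p \<in> N \<and> cut_field f \<Omega> X \<in> vector_fields_on \<A> N"
  proof (cases "p \<in> \<Omega>")
    case True
    let ?N = "cdom c \<inter> \<Omega>"
    have N: "open ?N" "open (cmap c ` ?N)" using assms c by (auto intro!: open_cimage open_cdom open_Int)
    have "cut_field f \<Omega> X \<in> vector_fields_on \<A> ?N"
    proof (rule vector_fields_on_chartI[OF c(1) N(1)])
      have "smooth_on (cmap c ` ?N) (\<lambda>x. f (cinv c x) *\<^sub>R loc c X x)"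
        by (intro smooth_intros N vector_fields_on_smooth[OF assms(4) c(1)]
            smooth_on_subset[OF smooth_funs_smooth[OF f(1) c(1)]] open_cimage_cdom c(1)) auto
      then show "smooth_on (cmap c ` ?N) (loc c (cut_field f \<Omega> X))"
        by (rule smooth_on_cong[OF N(2)]) (auto simp: cut_field_def cinv_cmap c)
    qed (use vector_fields_on_in[OF assms(4)] tangent_space_closed(4) in \<open>auto simp: cut_field_def\<close>)
    then show ?thesis using N True c by blast
  next
    case False
    let ?N = "cdom c \<inter> - K"
    have N: "open ?N" "open (cmap c ` ?N)" using f c by (auto intro!: open_cimage open_cdom open_Int)
    have *: "coord (cut_field f \<Omega> X q) c = 0" "cut_field f \<Omega> X q \<in> tangent_space \<A> q" if "q \<notin> K" for q
      using that f zero_vec_in tangent_space_closed(4)[OF vector_fields_on_in[OF assms(4)]]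
      by (auto simp: cut_field_def)
    have "cut_field f \<Omega> X \<in> vector_fields_on \<A> ?N"
    proof (rule vector_fields_on_chartI[OF c(1) N(1)])
      show "smooth_on (cmap c ` ?N) (loc c (cut_field f \<Omega> X))"
        by (rule smooth_on_cong[OF N(2) smooth_on_const[OF N(2), of 0]]) (auto simp: * cinv_cmap c)
    qed (use * in auto)
    moreover have "p \<notin> K" using False assms by auto
    ultimately show ?thesis using N c by blast
  qed
qed

lemma vector_fields_on_const:
  assumes "c \<in> \<A>"
  shows "(\<lambda>p. tvec_at c p h) \<in> vector_fields_on \<A> (cdom c)"
proof (rule vector_fields_on_chartI[OF assms open_cdom[OF assms]])
  show "smooth_on (cmap c ` cdom c) (loc c (\<lambda>p. tvec_at c p h))"
    by (rule smooth_on_cong[OF open_cimage_cdom[OF assms] smooth_on_const[OF open_cimage_cdom[OF assms], of h]])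
      (auto simp: coord_tvec_at assms cinv_cmap)
qed (auto simp: tvec_at_in assms)

lemma vector_field_extension:
  assumes "u \<in> tangent_space \<A> p"
  obtains X where "X \<in> vector_fields \<A>" "X p = u"
proof -
  obtain c where c: "c \<in> \<A>" "p \<in> cdom c" using chart_exists .
  obtain f W K where f: "cutoff f W K" "p \<in> W" "K \<subseteq> cdom c" using cutoff_exists[OF open_cdom[OF c(1)] c(2)] .
  let ?X = "cut_field f (cdom c) (\<lambda>q. tvec_at c q (coord u c))"
  have "?X \<in> vector_fields \<A>"
    by (rule cut_field_in_vector_fields[OF f(1,3) open_cdom[OF c(1)] vector_fields_on_const[OF c(1)]])
  moreover have "?X p = u"
    using f c assms by (intro tangent_eqI[OF _ assms c]) 
      (auto simp: cutoff_def cut_field_def coord_tvec_at tvec_at_in tangent_space_closed(4)[OF tvec_at_in])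
  ultimately show ?thesis using that by blast
qed

lemma ext_props:
  assumes "u \<in> tangent_space \<A> p"
  shows "ext \<A> u \<in> vector_fields \<A>" "ext \<A> u p = u"
proof -
  have "\<exists>X. X \<in> vector_fields \<A> \<and> X (base u) = u"
    using vector_field_extension[OF assms] tangent_base[OF assms] by metis
  then have "ext \<A> u \<in> vector_fields \<A> \<and> ext \<A> u (base u) = u"
    unfolding ext_def by (rule someI_ex)
  then show "ext \<A> u \<in> vector_fields \<A>" "ext \<A> u p = u" using tangent_base[OF assms] by auto
qed

section \<open>The Lie bracket in a chart\<close>

text \<open>\<open>dir_deriv\<close> works in a chart picked by choice. The chain rule for the
  transition map matches the transformation law of u, so any chart c gives the same value.\<close>

lemma dir_deriv_eq:
  assumes "c \<in> \<A>" "p \<in> cdom c" "u \<in> tangent_space \<A> p" "((\<lambda>x. f (cinv c x)) has_derivative F) (at (cmap c p))"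
  shows "dir_deriv \<A> u f = F (coord u c)"
proof -
  define d where "d = (SOME d. d \<in> \<A> \<and> base u \<in> cdom d)"
  have "d \<in> \<A> \<and> base u \<in> cdom d"
    unfolding d_def by (rule someI_ex) (use assms tangent_base in blast)
  then have d: "d \<in> \<A>" "p \<in> cdom d" using tangent_base[OF assms(3)] by auto
  let ?S = "cmap d ` (cdom c \<inter> cdom d)"
  have S: "open ?S" "cmap d p \<in> ?S" using assms d by (auto intro!: open_cimage open_cdom open_Int)
  have "((\<lambda>x. f (cinv c (tr d c x))) has_derivative (\<lambda>h. F (fD (tr d c) (cmap d p) h))) (at (cmap d p))"
    by (rule has_derivative_compose[OF tr_has_derivative]) (use assms d in \<open>simp_all add: cinv_cmap\<close>)
  then have "((f \<circ> cinv d) has_derivative (\<lambda>h. F (fD (tr d c) (cmap d p) h))) (at (cmap d p))"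
    by (rule has_derivative_transform_within_open[OF _ S]) (use assms d in \<open>auto simp: cinv_cmap\<close>)
  from fD_eqI[OF this] have "dir_deriv \<A> u f = F (fD (tr d c) (cmap d p) (coord u d))"
    unfolding dir_deriv_def Let_def d_def[symmetric] unfolding tangent_base[OF assms(3)] by simp
  then show ?thesis using tangent_coord[OF assms(3) d(1) assms(1) d(2) assms(2)] by simp
qed

lemma dir_deriv_smooth_funs:
  assumes "c \<in> \<A>" "p \<in> cdom c" "u \<in> tangent_space \<A> p" "f \<in> smooth_funs \<A>"
  shows "dir_deriv \<A> u f = fD (\<lambda>x. f (cinv c x)) (cmap c p) (coord u c)"
  by (rule dir_deriv_eq[OF assms(1-3) smooth_on_has_derivative[OF smooth_funs_smooth[OF assms(4,1)]]])
    (use assms(2) in auto)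

lemma dir_deriv_const: "u \<in> tangent_space \<A> p \<Longrightarrow> dir_deriv \<A> u (\<lambda>q. a) = 0"
  by (rule chart_exists[of p]) (simp add: dir_deriv_eq[where f="\<lambda>q. a", OF _ _ _ has_derivative_const])

lemma cut_fun_in_smooth_funs:
  assumes "cutoff \<phi> W K" "K \<subseteq> cdom c" "c \<in> \<A>" "smooth_on (cmap c ` cdom c) (\<lambda>x. g (cinv c x))"
  shows "(\<lambda>q. if q \<in> cdom c then \<phi> q * g q else 0) \<in> smooth_funs \<A>" (is "?f \<in> _")
proof -
  have \<phi>: "\<phi> \<in> smooth_funs \<A>" "closed K" "\<And>q. q \<notin> K \<Longrightarrow> \<phi> q = 0" using assms(1) by (auto simp: cutoff_def)
  have "smooth_on (cmap d ` cdom d) (?f \<circ> cinv d)" if d: "d \<in> \<A>" for d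
  proof (rule smooth_on_local)
    fix x assume "x \<in> cmap d ` cdom d"
    then obtain q where q: "q \<in> cdom d" "x = cmap d q" by blast
    show "\<exists>N. open N \<and> x \<in> N \<and> smooth_on N (?f \<circ> cinv d)"
    proof (cases "q \<in> cdom c")
      case True
      let ?\<Omega> = "cdom d \<inter> cdom c"
      have N: "open (cmap d ` ?\<Omega>)" using assms d by (auto intro!: open_cimage open_cdom open_Int)
      have "smooth_on (cmap c ` ?\<Omega>) (\<lambda>x. g (cinv c x))"
        by (rule smooth_on_subset[OF assms(4) open_cimage_cdom[OF assms(3)]]) auto
      then have "smooth_on (cmap d ` ?\<Omega>) (\<lambda>x. g (cinv c (tr d c x)))"
        by (rule smooth_on_chart_change[OF assms(3) d, rotated 3]) (use assms d in \<open>auto intro!: open_cdom open_Int\<close>)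
      then have "smooth_on (cmap d ` ?\<Omega>) (\<lambda>x. \<phi> (cinv d x) * g (cinv c (tr d c x)))"
        by (intro smooth_intros N smooth_on_subset[OF smooth_funs_smooth[OF \<phi>(1) d]] open_cimage_cdom d) auto
      then have "smooth_on (cmap d ` ?\<Omega>) (?f \<circ> cinv d)"
        by (rule smooth_on_cong[OF N]) (auto simp: cinv_cmap d assms(3))
      then show ?thesis using N q True by blast
    next
      case False
      let ?N = "cmap d ` (cdom d \<inter> - K)"
      have N: "open ?N" using d \<phi> by (auto intro!: open_cimage open_cdom open_Int)
      have "smooth_on ?N (?f \<circ> cinv d)"
        by (rule smooth_on_cong[OF N smooth_on_const[OF N, of 0]]) (auto simp: \<phi>(3) cinv_cmap d)
      moreover have "q \<notin> K" using False assms by auto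
      ultimately show ?thesis using N q by blast
    qed
  qed
  then show ?thesis by (simp add: smooth_funs_def)
qed

text \<open>The bracket is characterised by global test functions only. Cut-off coordinate functions
  are such test functions, and they recover the components of a vector; this gives the uniqueness
  needed for the definite description.\<close>

lemma chart_component_function:
  assumes "c \<in> \<A>" "p \<in> cdom c"
  obtains f where "f \<in> smooth_funs \<A>" "\<And>u. u \<in> tangent_space \<A> p \<Longrightarrow> dir_deriv \<A> u f = coord u c \<bullet> i"
proof -
  obtain \<phi> W K where f: "cutoff \<phi> W K" "p \<in> W" "K \<subseteq> cdom c" using cutoff_exists[OF open_cdom[OF assms(1)] assms(2)] .
  then have \<phi>: "open W" "W \<subseteq> cdom c" "\<And>q. q \<in> W \<Longrightarrow> \<phi> q = 1" by (auto simp: cutoff_def)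
  define f where "f = (\<lambda>q. if q \<in> cdom c then \<phi> q * (cmap c q \<bullet> i) else 0)"
  have "smooth_on (cmap c ` cdom c) (\<lambda>x. cmap c (cinv c x) \<bullet> i)"
    using smooth_on_inner_left[OF _ smooth_on_tr[OF assms(1) assms(1)]] open_cimage_cdom[OF assms(1)] by simp
  then have "f \<in> smooth_funs \<A>"
    unfolding f_def by (rule cut_fun_in_smooth_funs[OF f(1,3) assms(1)])
  moreover have "dir_deriv \<A> u f = coord u c \<bullet> i" if u: "u \<in> tangent_space \<A> p" for u
  proof (rule dir_deriv_eq[OF assms u])
    have S: "open (cmap c ` W)" "cmap c p \<in> cmap c ` W" using \<phi> f assms by (auto intro: open_cimage)
    show "((\<lambda>x. f (cinv c x)) has_derivative (\<lambda>h. h \<bullet> i)) (at (cmap c p))"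
      by (rule has_derivative_transform_within_open[OF has_derivative_inner_left[OF has_derivative_ident] S])
        (use \<phi>(2,3) assms in \<open>auto simp: f_def cinv_cmap subset_iff\<close>)
  qed
  ultimately show ?thesis using that by blast
qed

text \<open>Near p the inner function is the derivative of F paired with the components of Y, so the
  product rule produces a second-order term in F and a term with the derivative of Y.\<close>

lemma dir_deriv_dir_deriv:
  assumes c: "c \<in> \<A>" "p \<in> cdom c" and f: "f \<in> smooth_funs \<A>" and Y: "Y \<in> vector_fields \<A>" and u: "u \<in> tangent_space \<A> p"
  defines "F \<equiv> \<lambda>x. f (cinv c x)" and "x \<equiv> cmap c p"
  shows "dir_deriv \<A> u (\<lambda>q. dir_deriv \<A> (Y q) f) =
    fD (\<lambda>y. fD F y (coord (Y p) c)) x (coord u c) + fD F x (fD (loc c Y) x (coord u c))"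
proof (rule dir_deriv_eq[OF c u])
  let ?U = "cmap c ` cdom c"
  have U: "open ?U" "x \<in> ?U" using c by (auto simp: x_def open_cimage_cdom)
  have F: "smooth_on ?U F" unfolding F_def by (rule smooth_funs_smooth[OF f c(1)])
  have "((\<lambda>y. fD F y (loc c Y y)) has_derivative
      (\<lambda>\<xi>. fD (\<lambda>y. fD F y (loc c Y x)) x \<xi> + fD F x (fD (loc c Y) x \<xi>))) (at x)"
    by (rule has_derivative_family[OF U smooth_on_linear_fD[OF F] smooth_on_has_derivative[OF smooth_on_fD_const[OF F] U(2)]
        smooth_on_has_derivative[OF vector_fields_smooth[OF Y c(1)] U(2)]])
  then show "((\<lambda>y. dir_deriv \<A> (Y (cinv c y)) f) has_derivative
      (\<lambda>\<xi>. fD (\<lambda>y. fD F y (coord (Y p) c)) x \<xi> + fD F x (fD (loc c Y) x \<xi>))) (at (cmap c p))"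
    unfolding x_def cinv_cmap[OF c]
    by (rule has_derivative_transform_within_open[OF _ U[unfolded x_def]])
      (auto simp: dir_deriv_smooth_funs[OF c(1) _ vector_fields_in[OF Y] f] F_def cinv_cmap[OF c(1)])
qed

text \<open>The second-order terms of X(Yf) and Y(Xf) cancel by symmetry, which leaves the
  derivative of f along DY(X) - DX(Y). The vector with these components thus has the defining
  property, and the component functions show that it is the only one.\<close>

lemma lie_bracket_props:
  assumes X: "X \<in> vector_fields \<A>" and Y: "Y \<in> vector_fields \<A>"
  shows "lie_bracket \<A> X Y p \<in> tangent_space \<A> p"
    and "c \<in> \<A> \<Longrightarrow> p \<in> cdom c \<Longrightarrow> coord (lie_bracket \<A> X Y p) c =
      fD (loc c Y) (cmap c p) (coord (X p) c) - fD (loc c X) (cmap c p) (coord (Y p) c)"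
proof -
  have *: "lie_bracket \<A> X Y p = tvec_at c p (fD (loc c Y) (cmap c p) (coord (X p) c) - fD (loc c X) (cmap c p) (coord (Y p) c))"
    (is "_ = ?w") if c: "c \<in> \<A>" "p \<in> cdom c" for c
    unfolding lie_bracket_def
  proof (rule the_equality)
    let ?U = "cmap c ` cdom c"
    have U: "open ?U" "cmap c p \<in> ?U" using c by (auto simp: open_cimage_cdom)
    have eq: "dir_deriv \<A> ?w f = dir_deriv \<A> (X p) (\<lambda>q. dir_deriv \<A> (Y q) f) - dir_deriv \<A> (Y p) (\<lambda>q. dir_deriv \<A> (X q) f)"
      if f: "f \<in> smooth_funs \<A>" for f
    proof -
      have F: "smooth_on ?U (\<lambda>x. f (cinv c x))" by (rule smooth_funs_smooth[OF f c(1)])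
      show ?thesis
        unfolding dir_deriv_dir_deriv[OF c f Y vector_fields_in[OF X]] dir_deriv_dir_deriv[OF c f X vector_fields_in[OF Y]]
          dir_deriv_smooth_funs[OF c tvec_at_in[OF c] f] coord_tvec_at[OF c]
          smooth_on_fD_symmetric_real[OF U(1) F U(2), of "coord (X p) c" "coord (Y p) c"]
        by (simp add: linear_diff[OF smooth_on_linear_fD[OF F U(2)]])
    qed
    then show "?w \<in> tangent_space \<A> p \<and> (\<forall>f\<in>smooth_funs \<A>. dir_deriv \<A> ?w f =
      dir_deriv \<A> (X p) (\<lambda>q. dir_deriv \<A> (Y q) f) - dir_deriv \<A> (Y p) (\<lambda>q. dir_deriv \<A> (X q) f))"
      using tvec_at_in[OF c] by blast
    fix w assume w: "w \<in> tangent_space \<A> p \<and> (\<forall>f\<in>smooth_funs \<A>. dir_deriv \<A> w f =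
      dir_deriv \<A> (X p) (\<lambda>q. dir_deriv \<A> (Y q) f) - dir_deriv \<A> (Y p) (\<lambda>q. dir_deriv \<A> (X q) f))"
    have "coord w c \<bullet> i = coord ?w c \<bullet> i" for i
    proof -
      obtain f where f: "f \<in> smooth_funs \<A>"
        "\<And>u. u \<in> tangent_space \<A> p \<Longrightarrow> dir_deriv \<A> u f = coord u c \<bullet> i"
        using chart_component_function[OF c] by blast
      have "dir_deriv \<A> w f = dir_deriv \<A> ?w f" using w f(1) eq[OF f(1)] by simp
      then show ?thesis using f(2) w tvec_at_in[OF c] by simp
    qed
    then show "w = ?w"
      using w tvec_at_in[OF c] by (intro tangent_eqI[OF _ _ c]) (auto intro: euclidean_eqI)
  qed
  show "lie_bracket \<A> X Y p \<in> tangent_space \<A> p"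
  proof -
    obtain c where "c \<in> \<A>" "p \<in> cdom c" using chart_exists .
    then show ?thesis using * tvec_at_in by simp
  qed
  show "c \<in> \<A> \<Longrightarrow> p \<in> cdom c \<Longrightarrow> coord (lie_bracket \<A> X Y p) c =
      fD (loc c Y) (cmap c p) (coord (X p) c) - fD (loc c X) (cmap c p) (coord (Y p) c)"
    using * coord_tvec_at by simp
qed

lemma lie_bracket_in_vector_fields:
  assumes X: "X \<in> vector_fields \<A>" and Y: "Y \<in> vector_fields \<A>"
  shows "lie_bracket \<A> X Y \<in> vector_fields \<A>"
proof (rule vector_fields_on_local)
  fix p :: 'a
  obtain c where c: "c \<in> \<A>" "p \<in> cdom c" using chart_exists .
  let ?U = "cmap c ` cdom c"
  have U: "open ?U" using c by (simp add: open_cimage_cdom)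
  have "smooth_on ?U (\<lambda>x. fD (loc c Y) x (loc c X x) - fD (loc c X) x (loc c Y x))"
    by (intro smooth_intros smooth_on_fD U vector_fields_smooth X Y c)
  then have "smooth_on ?U (loc c (lie_bracket \<A> X Y))"
    by (rule smooth_on_cong[OF U]) (use c in \<open>auto simp: lie_bracket_props(2)[OF X Y] cinv_cmap\<close>)
  then have "lie_bracket \<A> X Y \<in> vector_fields_on \<A> (cdom c)"
    by (intro vector_fields_on_chartI[OF c(1)] open_cdom c lie_bracket_props(1)[OF X Y]) auto
  then show "\<exists>N. open N \<and> p \<in> N \<and> lie_bracket \<A> X Y \<in> vector_fields_on \<A> N"
    using c open_cdom by blast
qed

end

section \<open>Anisotropic connections in a chart\<close>

lemma scaleR_one_tvec [simp]: "1 *\<^sub>R u = (u :: ('a, 'e::euclidean_space) tvec)"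
  by (cases u) (simp add: scaleR_tvec_def)

locale connection = manifold \<A>
  for \<A> :: "('a::{t2_space, second_countable_topology}, 'e::euclidean_space) chart set" +
  fixes A :: "('a, 'e) tvec set" and nabla :: "('a, 'e) conn"
  assumes open_A: "open_in_tangent_bundle \<A> A"
    and connection: "anisotropic_connection \<A> A nabla"
begin

lemma A_tangent: "v \<in> A \<Longrightarrow> v \<in> tangent_space \<A> (base v)"
  using open_A by (auto simp: open_in_tangent_bundle_def tangent_bundle_def tangent_base)

lemma nabla_in:
  "v \<in> A \<Longrightarrow> X \<in> vector_fields \<A> \<Longrightarrow> Y \<in> vector_fields \<A> \<Longrightarrow> nabla v X Y \<in> tangent_space \<A> (base v)"
  using connection unfolding anisotropic_connection_def by blast

lemma nabla_add:
  "v \<in> A \<Longrightarrow> X \<in> vector_fields \<A> \<Longrightarrow> Y \<in> vector_fields \<A> \<Longrightarrow> Z \<in> vector_fields \<A> \<Longrightarrow>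
    nabla v X (\<lambda>p. Y p + Z p) = nabla v X Y + nabla v X Z"
  using connection unfolding anisotropic_connection_def by blast

lemma nabla_leibniz:
  "v \<in> A \<Longrightarrow> X \<in> vector_fields \<A> \<Longrightarrow> Y \<in> vector_fields \<A> \<Longrightarrow> f \<in> smooth_funs \<A> \<Longrightarrow>
    nabla v X (\<lambda>p. f p *\<^sub>R Y p) = dir_deriv \<A> (X (base v)) f *\<^sub>R Y (base v) + f (base v) *\<^sub>R nabla v X Y"
  using connection unfolding anisotropic_connection_def by blast

lemma nabla_lincomb_left:
  "v \<in> A \<Longrightarrow> X \<in> vector_fields \<A> \<Longrightarrow> Y \<in> vector_fields \<A> \<Longrightarrow> Z \<in> vector_fields \<A> \<Longrightarrow>
    f \<in> smooth_funs \<A> \<Longrightarrow> h \<in> smooth_funs \<A> \<Longrightarrow>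
    nabla v (\<lambda>p. f p *\<^sub>R X p + h p *\<^sub>R Y p) Z = f (base v) *\<^sub>R nabla v X Z + h (base v) *\<^sub>R nabla v Y Z"
  using connection unfolding anisotropic_connection_def by blast

lemma nabla_aniso_field:
  "X \<in> vector_fields \<A> \<Longrightarrow> Y \<in> vector_fields \<A> \<Longrightarrow> (\<lambda>v. nabla v X Y) \<in> aniso_fields \<A> A"
  using connection unfolding anisotropic_connection_def by blast

lemma coord_nabla_scale:
  assumes "v \<in> A" "X \<in> vector_fields \<A>" "Y \<in> vector_fields \<A>" "f \<in> smooth_funs \<A>"
  shows "coord (nabla v (\<lambda>p. f p *\<^sub>R X p) Y) c = f (base v) *\<^sub>R coord (nabla v X Y) c"
proof -
  \<comment> \<open>The axiom concerns combinations of two fields; a zero multiple of X is added to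
    bring the product into that form.\<close>
  have "(\<lambda>p. f p *\<^sub>R X p) = (\<lambda>p. f p *\<^sub>R X p + 0 *\<^sub>R X p)"
    by (auto simp: plus_tvec_def scaleR_tvec_def)
  then show ?thesis
    using nabla_lincomb_left[OF assms(1,2,2,3,4) smooth_funs_const[of 0]] by simp
qed

lemma coord_nabla_scale_const_right:
  assumes "v \<in> A" "X \<in> vector_fields \<A>" "Y \<in> vector_fields \<A>"
  shows "coord (nabla v X (\<lambda>p. a *\<^sub>R Y p)) c = a *\<^sub>R coord (nabla v X Y) c"
  using nabla_leibniz[OF assms smooth_funs_const[of a]] dir_deriv_const[OF vector_fields_in[OF assms(2)]] by simp

end

text \<open>Near the points of W, where \<open>\<phi>\<close> is one, the global fields \<open>E h\<close> below have constant
  components; the bilinear maps \<open>G q\<close> are the Christoffel symbols.\<close>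

locale connection_chart = connection +
  fixes c :: "('a, 'b) chart" and \<phi> :: "'a \<Rightarrow> real" and W K :: "'a set"
  assumes c: "c \<in> \<A>" and cutoff: "cutoff \<phi> W K" and K_sub: "K \<subseteq> cdom c"
begin

lemma cutoff_props:
  "\<phi> \<in> smooth_funs \<A>" "open W" "W \<subseteq> cdom c" "p \<in> W \<Longrightarrow> \<phi> p = 1" "p \<notin> cdom c \<Longrightarrow> \<phi> p = 0"
  using cutoff K_sub unfolding cutoff_def by blast+

lemma W_cdom: "p \<in> W \<Longrightarrow> p \<in> cdom c"
  using cutoff_props(3) by blast

lemma open_cW: "open (cmap c ` W)"
  using open_cimage[OF c] cutoff_props by blast

definition E :: "'b \<Rightarrow> 'a \<Rightarrow> ('a, 'b) tvec" where
  "E h = cut_field \<phi> (cdom c) (\<lambda>q. tvec_at c q h)"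

lemma E_in: "E h \<in> vector_fields \<A>"
  unfolding E_def by (rule cut_field_in_vector_fields[OF cutoff K_sub open_cdom[OF c] vector_fields_on_const[OF c]])

lemma coord_E: "coord (E h p) c = \<phi> p *\<^sub>R h"
  using cutoff_props(5)[of p] by (simp add: E_def cut_field_def coord_tvec_at c)

lemma base_E [simp]: "base (E h p) = p"
  by (simp add: E_def cut_field_def)

lemma tangent_eq_cutI:
  assumes "u \<in> tangent_space \<A> p" "w \<in> tangent_space \<A> p" "coord u c = coord w c"
    and "p \<notin> cdom c \<Longrightarrow> u = zero_vec p" "p \<notin> cdom c \<Longrightarrow> w = zero_vec p"
  shows "u = w"
  using assms tangent_eqI[OF assms(1,2) c _ assms(3)] by fastforce

lemma zero_vec_ops: "a *\<^sub>R zero_vec p = zero_vec p" "zero_vec p + zero_vec p = zero_vec p"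
  "base u = p \<Longrightarrow> 0 *\<^sub>R u = zero_vec p"
  by (auto simp: zero_vec_def scaleR_tvec_def plus_tvec_def)

text \<open>Restricted to base points in W, where \<phi> is one: only there do the fields
  \<open>E h\<close> have constant components.\<close>

definition chart_dom :: "('b \<times> 'b) set" where
  "chart_dom = bundle_chart c ` {v \<in> A. base v \<in> W}"

definition vec :: "'b \<times> 'b \<Rightarrow> ('a, 'b) tvec" where
  "vec q = tvec_at c (cinv c (fst q)) (snd q)"

lemma vec_bundle_chart: "v \<in> tangent_space \<A> p \<Longrightarrow> p \<in> cdom c \<Longrightarrow> vec (bundle_chart c v) = v"
  by (simp add: vec_def bundle_chart_def cinv_cmap c tangent_base tvec_at_coord)

lemma chart_domE:
  assumes "q \<in> chart_dom"
  obtains v where "v \<in> A" "base v \<in> W" "q = bundle_chart c v" "vec q = v"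
  using assms vec_bundle_chart A_tangent W_cdom unfolding chart_dom_def by blast

lemma chart_domI: "v \<in> A \<Longrightarrow> base v \<in> W \<Longrightarrow> bundle_chart c v \<in> chart_dom"
  unfolding chart_dom_def by blast

lemma fst_chart_dom: "q \<in> chart_dom \<Longrightarrow> fst q \<in> cmap c ` W"
  by (elim chart_domE) (auto simp: bundle_chart_def)

lemma chart_dom_props:
  assumes "q \<in> chart_dom"
  shows "vec q \<in> A" "base (vec q) \<in> W" "cinv c (fst q) = base (vec q)" "bundle_chart c (vec q) = q"
    "cmap c (base (vec q)) = fst q" "vec q \<in> tangent_space \<A> (base (vec q))"
  using assms by (auto elim!: chart_domE simp: bundle_chart_def cinv_cmap[OF c W_cdom] A_tangent)

lemma chart_dom_eq: "chart_dom = bundle_chart c ` {v \<in> A. base v \<in> cdom c} \<inter> (cmap c ` W) \<times> UNIV"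
proof (intro equalityI subsetI)
  fix q assume "q \<in> bundle_chart c ` {v \<in> A. base v \<in> cdom c} \<inter> (cmap c ` W) \<times> UNIV"
  then obtain v p where v: "v \<in> A" "base v \<in> cdom c" "q = bundle_chart c v" "p \<in> W" "cmap c (base v) = cmap c p"
    unfolding bundle_chart_def by (auto simp: mem_Times_iff image_iff)
  then have "base v = p" using cinv_cmap[OF c] W_cdom by metis
  then show "q \<in> chart_dom" using v by (auto simp: chart_dom_def)
next
  fix q assume q: "q \<in> chart_dom"
  then show "q \<in> bundle_chart c ` {v \<in> A. base v \<in> cdom c} \<inter> (cmap c ` W) \<times> UNIV"
    using fst_chart_dom[OF q] W_cdom by (auto simp: chart_dom_def mem_Times_iff)
qed

lemma open_chart_dom: "open chart_dom"
  unfolding chart_dom_eq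
  using open_A c open_cW by (intro open_Int open_Times) (auto simp: open_in_tangent_bundle_def)

section \<open>Coordinate expressions of anisotropic fields and Christoffel symbols\<close>

definition hat :: "(('a, 'b) tvec \<Rightarrow> ('a, 'b) tvec) \<Rightarrow> 'b \<times> 'b \<Rightarrow> 'b" where
  "hat \<Y> q = coord (\<Y> (vec q)) c"

lemma hat_bundle_chart: "v \<in> A \<Longrightarrow> base v \<in> W \<Longrightarrow> hat \<Y> (bundle_chart c v) = coord (\<Y> v) c"
  using vec_bundle_chart[OF A_tangent W_cdom] by (simp add: hat_def)

definition G :: "'b \<times> 'b \<Rightarrow> 'b \<Rightarrow> 'b \<Rightarrow> 'b" where
  "G q h k = hat (\<lambda>v. nabla v (E h) (E k)) q"

lemma smooth_on_G: "smooth_on chart_dom (\<lambda>q. G q h k)"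
proof -
  let ?S = "bundle_chart c ` {v \<in> A. base v \<in> cdom c}"
  have S: "open ?S" using open_A c by (auto simp: open_in_tangent_bundle_def)
  have "smooth_on ?S (\<lambda>q. coord (nabla (bundle_cinv \<A> c q) (E h) (E k)) c)"
    using nabla_aniso_field[OF E_in E_in] c by (auto simp: aniso_fields_def)
  then have "smooth_on ?S (\<lambda>q. G q h k)"
    by (rule smooth_on_cong[OF S])
      (auto simp: G_def hat_def bundle_cinv_bundle_chart[OF c A_tangent] vec_bundle_chart[OF A_tangent])
  then show ?thesis
    by (rule smooth_on_subset[OF _ S]) (auto simp: chart_dom_eq)
qed

lemma E_lincomb: "E (a *\<^sub>R h + b *\<^sub>R k) = (\<lambda>p. a *\<^sub>R E h p + b *\<^sub>R E k p)"
proof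
  fix p
  show "E (a *\<^sub>R h + b *\<^sub>R k) p = a *\<^sub>R E h p + b *\<^sub>R E k p"
    by (rule tangent_eq_cutI)
      (auto simp: coord_E coord_tvec_at[OF c] zero_vec_ops E_def[THEN fun_cong] cut_field_def algebra_simps
        intro!: tangent_space_closed vector_fields_in[OF E_in, unfolded E_def] zero_vec_in tvec_at_in c)
qed

lemma E_add: "E (h + k) = (\<lambda>p. E h p + E k p)"
  using E_lincomb[of 1 h 1 k] by simp

lemma E_scale: "E (a *\<^sub>R h) = (\<lambda>p. a *\<^sub>R E h p)"
  using E_lincomb[of a h 0 h] by (simp add: scaleR_tvec_def plus_tvec_def)

lemma linear_G_left:
  assumes "q \<in> chart_dom"
  shows "linear (\<lambda>h. G q h k)"
proof (rule linearI)
  note v = chart_dom_props(1)[OF assms]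
  fix h h' a
  have "E (h + h') = (\<lambda>p. 1 *\<^sub>R E h p + 1 *\<^sub>R E h' p)" using E_lincomb[of 1 h 1 h'] by simp
  then show "G q (h + h') k = G q h k + G q h' k"
    using nabla_lincomb_left[OF v E_in E_in E_in smooth_funs_const smooth_funs_const, of 1 h 1 h' k]
    by (simp add: G_def hat_def)
  show "G q (a *\<^sub>R h) k = a *\<^sub>R G q h k"
    using coord_nabla_scale[OF v E_in E_in smooth_funs_const] by (simp add: G_def hat_def E_scale)
qed

lemma linear_G_right:
  assumes "q \<in> chart_dom"
  shows "linear (G q h)"
proof (rule linearI)
  note v = chart_dom_props(1)[OF assms]
  fix k k' a
  show "G q h (k + k') = G q h k + G q h k'"
    using nabla_add[OF v E_in E_in E_in] by (simp add: G_def hat_def E_add)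
  show "G q h (a *\<^sub>R k) = a *\<^sub>R G q h k"
    using coord_nabla_scale_const_right[OF v E_in E_in] by (simp add: G_def hat_def E_scale)
qed

text \<open>Tensoriality: \<open>\<phi>\<^sup>2 X\<close> is a combination of the fields \<open>E i\<close> with global smooth coefficients.
  Tangent vectors at different points cannot be added within one type, so that the combination
  is built one basis vector at a time instead of as a sum.\<close>

definition comp_fun :: "('a \<Rightarrow> ('a, 'b) tvec) \<Rightarrow> 'b \<Rightarrow> 'a \<Rightarrow> real" where
  "comp_fun X i p = (if p \<in> cdom c then \<phi> p * (coord (X p) c \<bullet> i) else 0)"

definition comp_field :: "('a \<Rightarrow> ('a, 'b) tvec) \<Rightarrow> 'b set \<Rightarrow> 'a \<Rightarrow> ('a, 'b) tvec" where
  "comp_field X B p = (if p \<in> cdom c then (\<phi> p * \<phi> p) *\<^sub>R tvec_at c p (\<Sum>i\<in>B. (coord (X p) c \<bullet> i) *\<^sub>R i)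
    else zero_vec p)"

lemma comp_fun_in: "X \<in> vector_fields \<A> \<Longrightarrow> comp_fun X i \<in> smooth_funs \<A>"
  unfolding comp_fun_def[abs_def]
  by (rule cut_fun_in_smooth_funs[OF cutoff K_sub c])
    (intro smooth_on_inner_left open_cimage_cdom c vector_fields_smooth)

lemma comp_field_tangent: "comp_field X B p \<in> tangent_space \<A> p"
  by (auto simp: comp_field_def zero_vec_in intro!: tangent_space_closed tvec_at_in c)

lemma comp_field_empty: "comp_field X {} = (\<lambda>p. 0 *\<^sub>R E 0 p)"
proof
  fix p
  show "comp_field X {} p = 0 *\<^sub>R E 0 p"
    by (rule tangent_eq_cutI[OF comp_field_tangent tangent_space_scaleR[OF vector_fields_in[OF E_in]]])
      (auto simp: comp_field_def coord_tvec_at[OF c] zero_vec_ops)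
qed

text \<open>One factor \<phi> makes the coefficient a global smooth function, the other one is
  contained in \<open>E i\<close>; this is the origin of the square.\<close>

lemma comp_field_insert:
  assumes "finite B" "i \<notin> B"
  shows "comp_field X (insert i B) = (\<lambda>p. comp_fun X i p *\<^sub>R E i p + comp_field X B p)"
proof
  fix p
  show "comp_field X (insert i B) p = comp_fun X i p *\<^sub>R E i p + comp_field X B p"
    by (rule tangent_eq_cutI[OF comp_field_tangent tangent_space_add[OF tangent_space_scaleR[OF vector_fields_in[OF E_in]] comp_field_tangent]])
      (auto simp: comp_field_def comp_fun_def coord_tvec_at[OF c] coord_E zero_vec_ops assms algebra_simps)
qed

lemma comp_field_Basis:
  assumes "X \<in> vector_fields \<A>"
  shows "comp_field X Basis = (\<lambda>p. (\<phi> p * \<phi> p) *\<^sub>R X p)"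
proof
  fix p
  have "base (X p) = p" using vector_fields_in[OF assms] tangent_base by blast
  then show "comp_field X Basis p = (\<phi> p * \<phi> p) *\<^sub>R X p"
    by (intro tangent_eq_cutI[OF comp_field_tangent tangent_space_scaleR[OF vector_fields_in[OF assms]]])
      (auto simp: comp_field_def coord_tvec_at[OF c] zero_vec_ops cutoff_props(5) euclidean_representation)
qed

lemma comp_field_in:
  assumes "finite B" "X \<in> vector_fields \<A>"
  shows "comp_field X B \<in> vector_fields \<A>"
  using assms(1)
proof induction
  case empty
  then show ?case
    unfolding comp_field_empty by (rule vector_fields_scale[OF smooth_funs_const E_in])
next
  case (insert i B)
  then show ?case
    unfolding comp_field_insert[OF insert(1,2)]
    by (intro vector_fields_add vector_fields_scale comp_fun_in assms(2) E_in)
qed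

text \<open>Expanding \<phi>^2 X in the fields \<open>E i\<close> and pulling the coefficients out
  of the first slot leaves only their values at \<open>base v\<close>, where \<phi> is one.\<close>

lemma coord_nabla_left:
  assumes v: "v \<in> A" "base v \<in> W" and X: "X \<in> vector_fields \<A>" and Y: "Y \<in> vector_fields \<A>"
  shows "coord (nabla v X Y) c = (\<Sum>i\<in>Basis. (coord (X (base v)) c \<bullet> i) *\<^sub>R coord (nabla v (E i) Y) c)"
proof -
  have p: "\<phi> (base v) = 1" "base v \<in> cdom c" using v(2) cutoff_props(4) W_cdom by auto
  have "coord (nabla v (comp_field X B) Y) c = (\<Sum>i\<in>B. (coord (X (base v)) c \<bullet> i) *\<^sub>R coord (nabla v (E i) Y) c)"
    if "finite B" for B
    using that
  proof induction
    case empty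
    then show ?case
      using coord_nabla_scale[OF v(1) E_in Y smooth_funs_const[of 0]] by (simp add: comp_field_empty)
  next
    case (insert i B)
    have "comp_field X (insert i B) = (\<lambda>p. comp_fun X i p *\<^sub>R E i p + 1 *\<^sub>R comp_field X B p)"
      by (simp add: comp_field_insert[OF insert(1,2)] scaleR_tvec_def)
    then show ?case
      using nabla_lincomb_left[OF v(1) E_in comp_field_in[OF insert(1) X] Y comp_fun_in[OF X] smooth_funs_const[of 1], of i i]
        insert by (simp add: comp_fun_def p)
  qed
  from this[OF finite_Basis] show ?thesis
    using coord_nabla_scale[OF v(1) X Y smooth_funs_mult[OF cutoff_props(1,1)]]
    by (simp add: comp_field_Basis[OF X] p)
qed

text \<open>The Leibniz rule also differentiates the coefficients of the expansion of \<phi>^2 Y;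
  these contributions add up to the derivative of the components of Y.\<close>

lemma coord_nabla_right:
  assumes v: "v \<in> A" "base v \<in> W" and X: "X \<in> vector_fields \<A>" and Y: "Y \<in> vector_fields \<A>"
  shows "coord (nabla v X Y) c = fD (loc c Y) (cmap c (base v)) (coord (X (base v)) c) +
    (\<Sum>i\<in>Basis. (coord (Y (base v)) c \<bullet> i) *\<^sub>R coord (nabla v X (E i)) c)"
proof -
  let ?p = "base v" and ?x = "cmap c (base v)"
  let ?D = "fD (loc c Y) ?x (coord (X ?p) c)"
  have p: "\<phi> ?p = 1" "?p \<in> cdom c" using v(2) cutoff_props(4) W_cdom by auto
  have xW: "?x \<in> cmap c ` W" using v(2) by blast
  note Xp = vector_fields_in[OF X]
  have dY: "(loc c Y has_derivative fD (loc c Y) ?x) (at ?x)"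
    by (rule smooth_on_has_derivative[OF vector_fields_smooth[OF Y c]]) (use p in blast)
  have d1: "dir_deriv \<A> (X ?p) (comp_fun Y i) = ?D \<bullet> i" for i
  proof (rule dir_deriv_eq[OF c p(2) Xp])
    show "((\<lambda>x. comp_fun Y i (cinv c x)) has_derivative (\<lambda>\<xi>. fD (loc c Y) ?x \<xi> \<bullet> i)) (at ?x)"
      by (rule has_derivative_transform_within_open[OF has_derivative_inner_left[OF dY] open_cW xW])
        (auto simp: comp_fun_def cinv_cmap[OF c] W_cdom cutoff_props(4))
  qed
  \<comment> \<open>\<phi> is one on a whole neighbourhood, so replacing Y by \<phi>^2 Y creates no
    derivative term.\<close>
  have d2: "dir_deriv \<A> (X ?p) (\<lambda>q. \<phi> q * \<phi> q) = 0"
  proof (rule dir_deriv_eq[OF c p(2) Xp])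
    show "((\<lambda>x. \<phi> (cinv c x) * \<phi> (cinv c x)) has_derivative (\<lambda>\<xi>. 0)) (at ?x)"
      by (rule has_derivative_transform_within_open[OF has_derivative_const[of 1] open_cW xW])
        (auto simp: cinv_cmap[OF c] W_cdom cutoff_props(4))
  qed
  have "coord (nabla v X (comp_field Y B)) c =
      (\<Sum>i\<in>B. (?D \<bullet> i) *\<^sub>R i) + (\<Sum>i\<in>B. (coord (Y ?p) c \<bullet> i) *\<^sub>R coord (nabla v X (E i)) c)"
    if "finite B" for B
    using that
  proof induction
    case empty
    then show ?case
      using coord_nabla_scale_const_right[OF v(1) X E_in, of 0] by (simp add: comp_field_empty)
  next
    case (insert i B)
    show ?case
      unfolding comp_field_insert[OF insert(1,2)]
        nabla_add[OF v(1) X vector_fields_scale[OF comp_fun_in[OF Y] E_in] comp_field_in[OF insert(1) Y]]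
        nabla_leibniz[OF v(1) X E_in comp_fun_in[OF Y]] d1
      using insert by (simp add: coord_E p comp_fun_def)
  qed
  from this[OF finite_Basis] show ?thesis
    using nabla_leibniz[OF v(1) X Y smooth_funs_mult[OF cutoff_props(1,1)]]
    by (simp add: comp_field_Basis[OF Y] p d2 euclidean_representation)
qed

lemma coord_nabla:
  assumes v: "v \<in> A" "base v \<in> W" and X: "X \<in> vector_fields \<A>" and Y: "Y \<in> vector_fields \<A>"
  shows "coord (nabla v X Y) c = fD (loc c Y) (cmap c (base v)) (coord (X (base v)) c) +
    G (bundle_chart c v) (coord (X (base v)) c) (coord (Y (base v)) c)"
proof -
  let ?q = "bundle_chart c v"
  note q = chart_domI[OF v]
  have "coord (nabla v X (E i)) c = G ?q (coord (X (base v)) c) i" for i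
    unfolding coord_nabla_left[OF v X E_in] linear_eq_sum_Basis[OF linear_G_left[OF q], of "coord (X (base v)) c"]
    by (simp add: G_def hat_bundle_chart v)
  then show ?thesis
    using coord_nabla_right[OF v X Y] linear_eq_sum_Basis[OF linear_G_right[OF q], of _ "coord (Y (base v)) c"] by simp
qed

text \<open>Cutting Y off gives a global field with the same germ. Whichever such field is chosen,
  its value and first derivative at \<open>base v\<close> are those of Y, and the chart formula
  involves nothing else.\<close>

lemma nabla_local_props:
  assumes v: "v \<in> A" "base v \<in> W" and X: "X \<in> vector_fields \<A>"
    and \<Omega>: "open \<Omega>" "base v \<in> \<Omega>" "Y \<in> vector_fields_on \<A> \<Omega>"
  shows "nabla_local \<A> nabla v X Y \<in> tangent_space \<A> (base v)"
    and "coord (nabla_local \<A> nabla v X Y) c = fD (loc c Y) (cmap c (base v)) (coord (X (base v)) c) +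
    G (bundle_chart c v) (coord (X (base v)) c) (coord (Y (base v)) c)"
proof -
  define Y' where "Y' = (SOME Y'. Y' \<in> vector_fields \<A> \<and> eventually (\<lambda>q. Y' q = Y q) (nhds (base v)))"
  obtain f W' K' where f: "cutoff f W' K'" "base v \<in> W'" "K' \<subseteq> \<Omega>" using cutoff_exists[OF \<Omega>(1,2)] .
  have "cut_field f \<Omega> Y \<in> vector_fields \<A>"
    by (rule cut_field_in_vector_fields[OF f(1,3) \<Omega>(1,3)])
  moreover have "eventually (\<lambda>q. cut_field f \<Omega> Y q = Y q) (nhds (base v))"
  proof (rule eventually_mono[OF eventually_nhds_in_open[of W' "base v"]])
    show "open W'" "base v \<in> W'" using f by (auto simp: cutoff_def)
    show "cut_field f \<Omega> Y q = Y q" if "q \<in> W'" for q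
      using that f by (auto simp: cutoff_def cut_field_def scaleR_tvec_def)
  qed
  ultimately have "\<exists>Y'. Y' \<in> vector_fields \<A> \<and> eventually (\<lambda>q. Y' q = Y q) (nhds (base v))" by blast
  then have "Y' \<in> vector_fields \<A> \<and> eventually (\<lambda>q. Y' q = Y q) (nhds (base v))"
    unfolding Y'_def by (rule someI_ex)
  then have Y': "Y' \<in> vector_fields \<A>" and ev: "eventually (\<lambda>q. Y' q = Y q) (nhds (base v))" by auto
  obtain N where N: "open N" "base v \<in> N" "\<And>q. q \<in> N \<Longrightarrow> Y' q = Y q"
    using ev unfolding eventually_nhds by blast
  let ?N = "cmap c ` (cdom c \<inter> N)"
  have eq: "fD (loc c Y') (cmap c (base v)) = fD (loc c Y) (cmap c (base v))"
    by (rule fD_cong_open[of ?N])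
      (use N v W_cdom in \<open>auto intro!: open_cimage open_cdom c open_Int simp: cinv_cmap[OF c]\<close>)
  have *: "nabla_local \<A> nabla v X Y = nabla v X Y'" by (simp add: nabla_local_def Y'_def)
  show "nabla_local \<A> nabla v X Y \<in> tangent_space \<A> (base v)"
    unfolding * by (rule nabla_in[OF v(1) X Y'])
  show "coord (nabla_local \<A> nabla v X Y) c = fD (loc c Y) (cmap c (base v)) (coord (X (base v)) c) +
      G (bundle_chart c v) (coord (X (base v)) c) (coord (Y (base v)) c)"
    unfolding * coord_nabla[OF v X Y'] eq using N by simp
qed

text \<open>A local form of \<open>aniso_fields\<close>: fields built from a tensor with a known
  coordinate expression are controlled only over W.\<close>

definition chart_field :: "(('a, 'b) tvec \<Rightarrow> ('a, 'b) tvec) \<Rightarrow> bool" where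
  "chart_field \<Y> \<longleftrightarrow>
    (\<forall>v\<in>A. base v \<in> W \<longrightarrow> \<Y> v \<in> tangent_space \<A> (base v)) \<and> smooth_on chart_dom (hat \<Y>)"

lemma chart_field_in: "chart_field \<Y> \<Longrightarrow> v \<in> A \<Longrightarrow> base v \<in> W \<Longrightarrow> \<Y> v \<in> tangent_space \<A> (base v)"
  by (simp add: chart_field_def)

lemma chart_field_smooth: "chart_field \<Y> \<Longrightarrow> smooth_on chart_dom (hat \<Y>)"
  by (simp add: chart_field_def)

text \<open>The base point is fixed along v + t z, so the component in any chart d is a fixed linear
  image of the one in c. Hence the derivatives taken chart by chart obey the transformation law and
  form a tangent vector.\<close>

lemma vert_deriv_props:
  assumes v: "v \<in> A" "base v \<in> W" and Y: "chart_field \<Y>" and z: "z \<in> tangent_space \<A> (base v)"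
  shows "vert_deriv \<Y> v z \<in> tangent_space \<A> (base v)"
    and "coord (vert_deriv \<Y> v z) c = fD (hat \<Y>) (bundle_chart c v) (0, coord z c)"
proof -
  let ?p = "base v" and ?q = "bundle_chart c v"
  let ?l = "\<lambda>t::real. ?q + t *\<^sub>R (0, coord z c)"
  let ?D = "fD (hat \<Y>) ?q (0, coord z c)"
  have p: "?p \<in> cdom c" using v W_cdom by blast
  \<comment> \<open>Openness of \<open>chart_dom\<close> keeps the curve in A for small t, and the
    derivative at 0 depends on these t only.\<close>
  have N: "open (?l -` chart_dom)" "0 \<in> ?l -` chart_dom"
    using chart_domI[OF v] by (auto simp: zero_prod_def[symmetric] intro!: open_vimage open_chart_dom continuous_intros)
  have curve: "v + t *\<^sub>R z \<in> A" "base (v + t *\<^sub>R z) \<in> W" "bundle_chart c (v + t *\<^sub>R z) = ?l t"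
    if "t \<in> ?l -` chart_dom" for t
  proof -
    have "v + t *\<^sub>R z \<in> tangent_space \<A> ?p"
      using A_tangent[OF v(1)] z by (intro tangent_space_closed)
    from vec_bundle_chart[OF this p] have "v + t *\<^sub>R z = vec (?l t)"
      by (simp add: bundle_chart_def)
    then show "v + t *\<^sub>R z \<in> A" using that chart_dom_props(1) by simp
    show "base (v + t *\<^sub>R z) \<in> W" using v by simp
    show "bundle_chart c (v + t *\<^sub>R z) = ?l t" by (simp add: bundle_chart_def)
  qed
  have "(hat \<Y> has_derivative fD (hat \<Y>) ?q) (at ?q)"
    by (rule smooth_on_has_derivative[OF chart_field_smooth[OF Y] chart_domI[OF v]])
  then have "((\<lambda>t. hat \<Y> (?l t)) has_derivative (\<lambda>t. fD (hat \<Y>) ?q (t *\<^sub>R (0, coord z c)))) (at 0)"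
    by (intro has_derivative_compose[where g="hat \<Y>" and f="?l" and f'="\<lambda>t. t *\<^sub>R (0, coord z c)"])
      (rule derivative_eq_intros refl | simp add: zero_prod_def[symmetric])+
  then have curve_deriv: "((\<lambda>t. hat \<Y> (?l t)) has_vector_derivative ?D) (at 0)"
    unfolding has_vector_derivative_def
    by (rule has_derivative_eq_rhs)
      (simp add: fun_eq_iff linear_scale[OF smooth_on_linear_fD[OF chart_field_smooth[OF Y] chart_domI[OF v]], symmetric])
  have "vert_deriv \<Y> v z = tvec_at c ?p ?D"
    unfolding vert_deriv_def tvec_at_def
  proof (intro arg_cong[of _ _ "TVec ?p"] ext)
    fix d
    \<comment> \<open>The value 0 treats the pairs d that are not charts around \<open>?p\<close>
      together with the charts.\<close>
    define B where "B h = (if d \<in> \<A> \<and> ?p \<in> cdom d then fD (tr c d) (cmap c ?p) h else 0)" for h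
    have B: "bounded_linear B"
      using linear_fD_tr[OF c _ p, of d]
      by (cases "d \<in> \<A> \<and> ?p \<in> cdom d") (auto simp: B_def[abs_def] linear_conv_bounded_linear)
    have "coord (\<Y> (v + t *\<^sub>R z)) d = B (hat \<Y> (?l t))" if "t \<in> ?l -` chart_dom" for t
    proof -
      have "\<Y> (v + t *\<^sub>R z) \<in> tangent_space \<A> ?p"
        using chart_field_in[OF Y curve(1,2)[OF that]] by simp
      then show ?thesis
        using hat_bundle_chart[OF curve(1,2)[OF that], of \<Y>] curve(3)[OF that] tangent_coord[OF _ c _ p, of _ d] tangent_coord_0
        by (auto simp: B_def)
    qed
    then have "((\<lambda>t. coord (\<Y> (v + t *\<^sub>R z)) d) has_vector_derivative B ?D) (at 0)"
      using has_vector_derivative_transform_within_open[OF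
        bounded_linear.has_vector_derivative[OF B curve_deriv] N] by simp
    then show "vector_derivative (\<lambda>t. coord (\<Y> (v + t *\<^sub>R z)) d) (at 0) =
      (if d \<in> \<A> \<and> ?p \<in> cdom d then fD (tr c d) (cmap c ?p) ?D else 0)"
      unfolding B_def[symmetric] by (rule vector_derivative_at)
  qed
  then show "vert_deriv \<Y> v z \<in> tangent_space \<A> (base v)"
    and "coord (vert_deriv \<Y> v z) c = ?D"
    using tvec_at_in[OF c p] coord_tvec_at[OF c p] by auto
qed

definition hor :: "'b \<Rightarrow> ('b \<times> 'b \<Rightarrow> 'c::real_normed_vector) \<Rightarrow> 'b \<times> 'b \<Rightarrow> 'c" where
  "hor h f q = fD f q (h, - G q h (snd q))"

text \<open>In \<open>\<nabla>\<^sub>X(\<Y>\<^sub>V) - (\<partial>\<^sup>\<nu>\<Y>)(\<nabla>\<^sub>XV)\<close> the derivatives of V cancel, which leaves the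
  derivative of \<open>\<Y>\<close> in the horizontal direction \<open>(h, - G h y)\<close>.\<close>

lemma nabla_aniso_props:
  assumes v: "v \<in> A" "base v \<in> W" and X: "X \<in> vector_fields \<A>" and Y: "chart_field \<Y>"
  shows "nabla_aniso \<A> A nabla v X \<Y> \<in> tangent_space \<A> (base v)"
    and "coord (nabla_aniso \<A> A nabla v X \<Y>) c = hor (coord (X (base v)) c) (hat \<Y>) (bundle_chart c v) +
      G (bundle_chart c v) (coord (X (base v)) c) (hat \<Y> (bundle_chart c v))"
proof -
  let ?p = "base v" and ?q = "bundle_chart c v"
  let ?x = "cmap c ?p" and ?y = "coord v c" and ?h = "coord (X ?p) c"
  have p: "?p \<in> cdom c" using v W_cdom by blast
  have q: "?q \<in> chart_dom" "?q = (?x, ?y)" using chart_domI[OF v] by (auto simp: bundle_chart_def)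
  define V where "V = (SOME V. \<exists>\<Omega>. admissible_extension \<A> A v \<Omega> V)"
  have "\<exists>V \<Omega>. admissible_extension \<A> A v \<Omega> V"
  proof (intro exI)
    \<comment> \<open>The extension has the components of v held constant; \<open>?S\<close> selects
      the base points over which it remains in A.\<close>
    let ?S = "(\<lambda>x. (x, ?y)) -` chart_dom"
    let ?\<Omega> = "cdom c \<inter> cmap c -` ?S"
    have S: "open ?S" by (intro open_vimage open_chart_dom continuous_intros)
    show "admissible_extension \<A> A v ?\<Omega> (\<lambda>p. tvec_at c p ?y)"
      unfolding admissible_extension_def
    proof (intro conjI ballI)
      show "open ?\<Omega>" by (rule open_cvimage[OF c S])
      show "?p \<in> ?\<Omega>" using p q by simp
      show "(\<lambda>p. tvec_at c p ?y) \<in> vector_fields_on \<A> ?\<Omega>"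
        by (rule vector_fields_on_subset[OF vector_fields_on_const[OF c] open_cdom[OF c]]) auto
      show "tvec_at c ?p ?y = v" by (rule tvec_at_coord[OF A_tangent[OF v(1)] c p])
      fix p' assume p': "p' \<in> ?\<Omega>"
      then have "vec (cmap c p', ?y) = tvec_at c p' ?y" by (simp add: vec_def cinv_cmap c)
      then show "tvec_at c p' ?y \<in> A" using chart_dom_props(1)[of "(cmap c p', ?y)"] p' by simp
    qed
  qed
  then have "\<exists>\<Omega>. admissible_extension \<A> A v \<Omega> V" unfolding V_def by (rule someI_ex)
  then obtain \<Omega>' where \<Omega>': "open \<Omega>'" "?p \<in> \<Omega>'" "V \<in> vector_fields_on \<A> \<Omega>'" "\<And>p. p \<in> \<Omega>' \<Longrightarrow> V p \<in> A" "V ?p = v"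
    unfolding admissible_extension_def by blast
  \<comment> \<open>The chosen extension may live on a larger set; inside W its values lie in the
    domain of the chart formulas.\<close>
  define \<Omega> where "\<Omega> = \<Omega>' \<inter> W"
  have \<Omega>: "open \<Omega>" "?p \<in> \<Omega>" "\<Omega> \<subseteq> cdom c" using \<Omega>' v cutoff_props by (auto simp: \<Omega>_def)
  have V: "V \<in> vector_fields_on \<A> \<Omega>"
    by (rule vector_fields_on_subset[OF \<Omega>'(3,1)]) (auto simp: \<Omega>_def)
  have V_A: "V p \<in> A" "base (V p) = p" "p \<in> W" if "p \<in> \<Omega>" for p
    using that \<Omega>'(4) tangent_base[OF vector_fields_on_in[OF V that]] by (auto simp: \<Omega>_def)
  have cO: "open (cmap c ` \<Omega>)" "?x \<in> cmap c ` \<Omega>" using open_cimage[OF c] \<Omega> by auto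
  have Vs: "smooth_on (cmap c ` \<Omega>) (loc c V)"
    using vector_fields_on_smooth[OF V c] \<Omega>(3) by (simp add: inf.absorb2)
  have chart_V: "bundle_chart c (V p) = (cmap c p, loc c V (cmap c p))" if "p \<in> \<Omega>" for p
    using V_A[OF that] that \<Omega>(3) by (auto simp: bundle_chart_def cinv_cmap[OF c] subset_iff)
  have YV_loc: "hat \<Y> (x, loc c V x) = loc c (\<lambda>p. \<Y> (V p)) x" if "x \<in> cmap c ` \<Omega>" for x
  proof -
    from that obtain p where "p \<in> \<Omega>" "x = cmap c p" by blast
    then show ?thesis
      using chart_V[of p] hat_bundle_chart[of "V p" \<Y>] V_A[of p] \<Omega>(3) by (auto simp: cinv_cmap[OF c] subset_iff)
  qed
  have "smooth_on (cmap c ` \<Omega>) (\<lambda>x. hat \<Y> (x, loc c V x))"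
  proof (rule smooth_on_comp[OF cO(1) open_chart_dom _ chart_field_smooth[OF Y]])
    show "(\<lambda>x. (x, loc c V x)) ` cmap c ` \<Omega> \<subseteq> chart_dom"
      using chart_V chart_domI V_A by (auto simp flip: chart_V)
  qed (intro smooth_intros cO Vs)
  then have "smooth_on (cmap c ` \<Omega>) (loc c (\<lambda>p. \<Y> (V p)))"
    by (rule smooth_on_cong[OF cO(1)]) (rule YV_loc)
  then have YV: "(\<lambda>p. \<Y> (V p)) \<in> vector_fields_on \<A> \<Omega>"
    using chart_field_in[OF Y] V_A by (intro vector_fields_on_chartI[OF c \<Omega>(1,3)]) (metis, auto)
  let ?DY = "fD (hat \<Y>) ?q" and ?DV = "fD (loc c V) ?x"
  have hY: "(hat \<Y> has_derivative ?DY) (at ?q)"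
    by (rule smooth_on_has_derivative[OF chart_field_smooth[OF Y] q(1)])
  have hV: "(loc c V has_derivative ?DV) (at ?x)" by (rule smooth_on_has_derivative[OF Vs cO(2)])
  have Vx: "loc c V ?x = ?y" using \<Omega>' p by (simp add: cinv_cmap[OF c])
  have "((\<lambda>x. hat \<Y> (x, loc c V x)) has_derivative (\<lambda>h. ?DY (h, ?DV h))) (at ?x)"
    by (rule has_derivative_compose[OF has_derivative_Pair[OF has_derivative_ident hV]]) (use hY q Vx in simp)
  then have "(loc c (\<lambda>p. \<Y> (V p)) has_derivative (\<lambda>h. ?DY (h, ?DV h))) (at ?x)"
    by (rule has_derivative_transform_within_open[OF _ cO YV_loc])
  note D = fD_eqI[OF this]
  let ?z = "nabla_local \<A> nabla v X V"
  note 1 = nabla_local_props[OF v X \<Omega>(1,2) YV]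
  note 2 = nabla_local_props[OF v X \<Omega>(1,2) V]
  note 3 = vert_deriv_props[OF v Y 2(1)]
  have *: "nabla_aniso \<A> A nabla v X \<Y> = nabla_local \<A> nabla v X (\<lambda>p. \<Y> (V p)) - vert_deriv \<Y> v ?z"
    by (simp add: nabla_aniso_def V_def Let_def)
  show "nabla_aniso \<A> A nabla v X \<Y> \<in> tangent_space \<A> ?p"
    unfolding * by (rule tangent_space_diff[OF 1(1) 3(1)])
  have "?DY (?h, ?DV ?h) - ?DY (0, ?DV ?h + G ?q ?h ?y) = ?DY (?h, - G ?q ?h ?y)"
    using linear_diff[OF has_derivative_linear[OF hY], of "(?h, ?DV ?h)" "(0, ?DV ?h + G ?q ?h ?y)"] by simp
  then show "coord (nabla_aniso \<A> A nabla v X \<Y>) c = hor ?h (hat \<Y>) ?q + G ?q ?h (hat \<Y> ?q)"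
    unfolding * coord_tvec 1(2) 3(2) 2(2) D hor_def \<Omega>'(5) hat_bundle_chart[OF v]
    using q(2) by (simp add: algebra_simps)
qed

end

section \<open>Smooth families of multilinear maps\<close>

text \<open>Smoothness is required for constant arguments only; in finite dimension linearity
  extends it to moving ones.\<close>

definition smooth_bilinear :: "'p::euclidean_space set \<Rightarrow>
    ('p \<Rightarrow> 'b::euclidean_space \<Rightarrow> 'c::euclidean_space \<Rightarrow> 'd::real_normed_vector) \<Rightarrow> bool" where
  "smooth_bilinear S F \<longleftrightarrow> open S \<and> (\<forall>q\<in>S. \<forall>k. linear (\<lambda>h. F q h k)) \<and> (\<forall>q\<in>S. \<forall>h. linear (F q h)) \<and>
    (\<forall>h k. smooth_on S (\<lambda>q. F q h k))"

text \<open>Fixing the last argument reduces to the bilinear case, so its product rule is reused and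
  only one more slot is treated.\<close>

definition smooth_trilinear :: "'p::euclidean_space set \<Rightarrow>
    ('p \<Rightarrow> 'b::euclidean_space \<Rightarrow> 'c::euclidean_space \<Rightarrow> 'd::euclidean_space \<Rightarrow> 'f::real_normed_vector) \<Rightarrow> bool" where
  "smooth_trilinear S F \<longleftrightarrow> (\<forall>l. smooth_bilinear S (\<lambda>q h k. F q h k l)) \<and> (\<forall>q\<in>S. \<forall>h k. linear (F q h k))"

lemma smooth_bilinearD:
  assumes "smooth_bilinear S F"
  shows "open S" "q \<in> S \<Longrightarrow> linear (\<lambda>h. F q h k)" "q \<in> S \<Longrightarrow> linear (F q h)" "smooth_on S (\<lambda>q. F q h k)"
  using assms unfolding smooth_bilinear_def by blast+

lemma smooth_trilinearD:
  assumes "smooth_trilinear S F"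
  shows "smooth_bilinear S (\<lambda>q h k. F q h k l)" "q \<in> S \<Longrightarrow> linear (F q h k)"
  using assms unfolding smooth_trilinear_def by blast+

lemma smooth_bilinear_smooth_on:
  assumes "smooth_bilinear S F" "smooth_on S f" "smooth_on S g"
  shows "smooth_on S (\<lambda>q. F q (f q) (g q))"
  by (rule smooth_on_family[OF smooth_bilinearD(1)[OF assms(1)] smooth_on_family[OF smooth_bilinearD(1)[OF assms(1)]
          smooth_bilinearD(4)[OF assms(1)] smooth_bilinearD(2)[OF assms(1)] assms(2)]
        smooth_bilinearD(3)[OF assms(1)] assms(3)])

lemma smooth_trilinear_smooth_on:
  assumes "smooth_trilinear S F" "smooth_on S f" "smooth_on S g" "smooth_on S h"
  shows "smooth_on S (\<lambda>q. F q (f q) (g q) (h q))"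
  by (rule smooth_on_family[OF smooth_bilinearD(1)[OF smooth_trilinearD(1)[OF assms(1)]]
        smooth_bilinear_smooth_on[OF smooth_trilinearD(1)[OF assms(1)] assms(2,3)] smooth_trilinearD(2)[OF assms(1)] assms(4)])

lemma smooth_bilinear_has_derivative:
  assumes "smooth_bilinear S F" "q \<in> S" "(f has_derivative f') (at q)" "(g has_derivative g') (at q)"
  shows "((\<lambda>q. F q (f q) (g q)) has_derivative
    (\<lambda>\<xi>. fD (\<lambda>p. F p (f q) (g q)) q \<xi> + F q (f' \<xi>) (g q) + F q (f q) (g' \<xi>))) (at q)"
  by (rule has_derivative_bilinear_family[OF smooth_bilinearD(1)[OF assms(1)] assms(2)
        smooth_bilinearD(2,3)[OF assms(1)] smooth_on_has_derivative[OF smooth_bilinearD(4)[OF assms(1)] assms(2)] assms(3,4)])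

lemma smooth_trilinear_has_derivative:
  assumes "smooth_trilinear S F" "q \<in> S" "(f has_derivative f') (at q)" "(g has_derivative g') (at q)"
    and "(h has_derivative h') (at q)"
  shows "((\<lambda>q. F q (f q) (g q) (h q)) has_derivative
    (\<lambda>\<xi>. fD (\<lambda>p. F p (f q) (g q) (h q)) q \<xi> + F q (f' \<xi>) (g q) (h q) + F q (f q) (g' \<xi>) (h q) + F q (f q) (g q) (h' \<xi>))) (at q)"
  by (rule has_derivative_family[OF smooth_bilinearD(1)[OF smooth_trilinearD(1)[OF assms(1)]] assms(2)
        smooth_trilinearD(2)[OF assms(1)] smooth_bilinear_has_derivative[OF smooth_trilinearD(1)[OF assms(1)] assms(2-4)] assms(5)])

lemma fD_add: "smooth_on S f \<Longrightarrow> smooth_on S g \<Longrightarrow> q \<in> S \<Longrightarrow> fD (\<lambda>p. f p + g p) q \<xi> = fD f q \<xi> + fD g q \<xi>"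
  by (rule fD_eqI[OF has_derivative_add[OF smooth_on_has_derivative smooth_on_has_derivative], THEN fun_cong])

lemma fD_diff: "smooth_on S f \<Longrightarrow> smooth_on S g \<Longrightarrow> q \<in> S \<Longrightarrow> fD (\<lambda>p. f p - g p) q \<xi> = fD f q \<xi> - fD g q \<xi>"
  by (rule fD_eqI[OF has_derivative_diff[OF smooth_on_has_derivative smooth_on_has_derivative], THEN fun_cong])

lemma fD_scaleR: "smooth_on S f \<Longrightarrow> q \<in> S \<Longrightarrow> fD (\<lambda>p. a *\<^sub>R f p) q \<xi> = a *\<^sub>R fD f q \<xi>"
  by (rule fD_eqI[OF has_derivative_scaleR_right[OF smooth_on_has_derivative], THEN fun_cong])

text \<open>Differentiation in the parameter commutes with sums and multiples in the argument h.
  This makes the derivative terms of the curvature linear in the arguments of G.\<close>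

lemma linear_fD_family:
  assumes "open S" "q \<in> S" "\<And>h. smooth_on S (\<lambda>p. F p h)" "\<And>p. p \<in> S \<Longrightarrow> linear (F p)"
  shows "linear (\<lambda>h. fD (\<lambda>p. F p h) q \<xi>)"
proof (rule linearI)
  fix h k a
  have "fD (\<lambda>p. F p (h + k)) q = fD (\<lambda>p. F p h + F p k) q"
    by (rule fD_cong_open[OF assms(1,2)]) (rule linear_add[OF assms(4)])
  then show "fD (\<lambda>p. F p (h + k)) q \<xi> = fD (\<lambda>p. F p h) q \<xi> + fD (\<lambda>p. F p k) q \<xi>"
    by (simp add: fD_add[OF assms(3,3,2)])
  have "fD (\<lambda>p. F p (a *\<^sub>R h)) q = fD (\<lambda>p. a *\<^sub>R F p h) q"
    by (rule fD_cong_open[OF assms(1,2)]) (rule linear_scale[OF assms(4)])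
  then show "fD (\<lambda>p. F p (a *\<^sub>R h)) q \<xi> = a *\<^sub>R fD (\<lambda>p. F p h) q \<xi>"
    by (simp add: fD_scaleR[OF assms(3,2)])
qed

section \<open>Torsion, curvature and their derivatives in a chart\<close>

context connection_chart
begin

lemma smooth_bilinear_G: "smooth_bilinear chart_dom G"
  unfolding smooth_bilinear_def by (auto simp: open_chart_dom linear_G_left linear_G_right smooth_on_G)

lemma loc_bundle_chart:
  "base v \<in> W \<Longrightarrow> loc c X (fst (bundle_chart c v)) = coord (X (base v)) c"
  by (simp add: bundle_chart_def cinv_cmap c W_cdom)

lemma fst_chart_dom_cdom: "q \<in> chart_dom \<Longrightarrow> fst q \<in> cmap c ` cdom c"
  using fst_chart_dom W_cdom by fastforce

lemma smooth_on_comp_fst: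
  "smooth_on (cmap c ` cdom c) f \<Longrightarrow> smooth_on chart_dom (\<lambda>q. f (fst q))"
  by (rule smooth_on_comp[OF open_chart_dom open_cimage_cdom[OF c]])
    (auto intro!: smooth_intros open_chart_dom fst_chart_dom_cdom)

lemma comp_fst_has_derivative:
  assumes "smooth_on (cmap c ` cdom c) f" "q \<in> chart_dom"
  shows "((\<lambda>q. f (fst q)) has_derivative (\<lambda>\<xi>. fD f (fst q) (fst \<xi>))) (at q)"
  by (rule has_derivative_compose[OF has_derivative_fst[OF has_derivative_ident]
        smooth_on_has_derivative[OF assms(1) fst_chart_dom_cdom[OF assms(2)]]])

lemma hat_nabla:
  assumes "q \<in> chart_dom" "X \<in> vector_fields \<A>" "Y \<in> vector_fields \<A>"
  shows "hat (\<lambda>v. nabla v X Y) q =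
    fD (loc c Y) (fst q) (loc c X (fst q)) + G q (loc c X (fst q)) (loc c Y (fst q))"
  using coord_nabla[OF chart_dom_props(1,2)[OF assms(1)] assms(2,3)]
  by (simp add: hat_def chart_dom_props[OF assms(1)])

text \<open>The derivatives of the components of X and Y occur only together with
  \<open>fst \<xi>\<close>. For vertical \<xi> only the derivative of G survives, which gives P; for
  horizontal \<xi> this is the derivative needed for the curvature.\<close>

lemma hat_nabla_has_derivative:
  assumes q: "q \<in> chart_dom" and X: "X \<in> vector_fields \<A>" and Y: "Y \<in> vector_fields \<A>"
  defines "h \<equiv> loc c X (fst q)" and "k \<equiv> loc c Y (fst q)"
  defines "dX \<equiv> fD (loc c X) (fst q)" and "dY \<equiv> fD (loc c Y) (fst q)"
  shows "(hat (\<lambda>v. nabla v X Y) has_derivative (\<lambda>\<xi>.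
    fD (\<lambda>x. fD (loc c Y) x h) (fst q) (fst \<xi>) + dY (dX (fst \<xi>)) +
    (fD (\<lambda>p. G p h k) q \<xi> + G q (dX (fst \<xi>)) k + G q h (dY (fst \<xi>))))) (at q)"
proof -
  let ?U = "cmap c ` cdom c"
  note U = open_cimage_cdom[OF c] fst_chart_dom_cdom[OF q]
  note Xs = vector_fields_smooth[OF X c] and Ys = vector_fields_smooth[OF Y c]
  have "((\<lambda>x. fD (loc c Y) x (loc c X x)) has_derivative
      (\<lambda>\<xi>. fD (\<lambda>x. fD (loc c Y) x h) (fst q) \<xi> + dY (dX \<xi>))) (at (fst q))"
    unfolding h_def dX_def dY_def
    by (rule has_derivative_family[OF U smooth_on_linear_fD[OF Ys] smooth_on_has_derivative[OF smooth_on_fD_const[OF Ys] U(2)]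
        smooth_on_has_derivative[OF Xs U(2)]])
  note 1 = has_derivative_compose[OF has_derivative_fst[OF has_derivative_ident] this]
  note 2 = smooth_bilinear_has_derivative[OF smooth_bilinear_G q comp_fst_has_derivative[OF Xs q] comp_fst_has_derivative[OF Ys q]]
  show ?thesis
    unfolding h_def k_def dX_def dY_def
    by (rule has_derivative_transform_within_open[OF has_derivative_add[OF
          1[unfolded h_def dX_def dY_def] 2] open_chart_dom q])
      (simp add: hat_nabla[OF _ X Y])
qed

lemma chart_field_nabla:
  assumes "X \<in> vector_fields \<A>" "Y \<in> vector_fields \<A>"
  shows "chart_field (\<lambda>v. nabla v X Y)"
  unfolding chart_field_def
proof (intro conjI ballI impI)
  note s = assms[THEN vector_fields_smooth, OF c]
  have "smooth_on chart_dom (\<lambda>q. fD (loc c Y) (fst q) (loc c X (fst q)) + G q (loc c X (fst q)) (loc c Y (fst q)))"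
    by (intro smooth_on_add open_chart_dom smooth_bilinear_smooth_on[OF smooth_bilinear_G] smooth_on_comp_fst s
        smooth_on_comp_fst[OF smooth_on_fD[OF open_cimage_cdom[OF c] s(2,1)]])
  then show "smooth_on chart_dom (hat (\<lambda>v. nabla v X Y))"
    by (rule smooth_on_cong[OF open_chart_dom]) (simp add: hat_nabla assms)
qed (rule nabla_in[OF _ assms])

section \<open>Horizontal derivatives and the curvature in coordinates\<close>

lemma smooth_on_hor_direction: "smooth_on chart_dom (\<lambda>q. (h, - G q h (snd q)))"
  by (intro smooth_intros open_chart_dom smooth_on_family[OF open_chart_dom smooth_on_G linear_G_right])

lemma smooth_on_hor: "smooth_on chart_dom f \<Longrightarrow> smooth_on chart_dom (hor h f)"
  unfolding hor_def[abs_def] by (rule smooth_on_fD[OF open_chart_dom _ smooth_on_hor_direction])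

lemma linear_hor_direction:
  assumes "q \<in> chart_dom" "smooth_on chart_dom f"
  shows "linear (\<lambda>h. hor h f q)"
  unfolding hor_def
  by (rule linear_compose[where g="fD f q", unfolded comp_def, OF _ smooth_on_linear_fD[OF assms(2,1)]])
    (auto intro!: linearI simp: linear_add[OF linear_G_left[OF assms(1)]] linear_scale[OF linear_G_left[OF assms(1)]])

lemma hor_add: "q \<in> chart_dom \<Longrightarrow> smooth_on chart_dom f \<Longrightarrow> smooth_on chart_dom g \<Longrightarrow>
    hor h (\<lambda>p. f p + g p) q = hor h f q + hor h g q"
  by (simp add: hor_def fD_add)

lemma hor_diff: "q \<in> chart_dom \<Longrightarrow> smooth_on chart_dom f \<Longrightarrow> smooth_on chart_dom g \<Longrightarrow>
    hor h (\<lambda>p. f p - g p) q = hor h f q - hor h g q"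
  by (simp add: hor_def fD_diff)

lemma hor_G:
  assumes "q \<in> chart_dom" "smooth_on chart_dom g"
  shows "hor i (\<lambda>p. G p h (g p)) q = hor i (\<lambda>p. G p h (g q)) q + G q h (hor i g q)"
  unfolding hor_def
  by (rule fD_eqI[OF has_derivative_family[OF open_chart_dom assms(1) linear_G_right
          smooth_on_has_derivative[OF smooth_on_G assms(1)] smooth_on_has_derivative[OF assms(2,1)]], THEN fun_cong])

definition Rm :: "'b \<times> 'b \<Rightarrow> 'b \<Rightarrow> 'b \<Rightarrow> 'b \<Rightarrow> 'b" where
  "Rm q h k l = hor h (\<lambda>p. G p k l) q - hor k (\<lambda>p. G p h l) q + G q h (G q k l) - G q k (G q h l)"

text \<open>The commutator of two horizontal fields is vertical, with component \<open>- R(i, h)y\<close>.\<close>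

lemma hor_commutator:
  fixes f :: "'b \<times> 'b \<Rightarrow> 'b"
  assumes q: "q \<in> chart_dom" and f: "smooth_on chart_dom f"
  shows "hor i (hor h f) q - hor h (hor i f) q = - fD f q (0, Rm q i h (snd q))"
proof -
  have hor_hor: "hor i (hor h f) q =
      fD (\<lambda>p. fD f p (h, - G q h (snd q))) q (i, - G q i (snd q)) +
      fD f q (0, - (hor i (\<lambda>p. G p h (snd q)) q - G q h (G q i (snd q))))" for i h
  proof -
    \<comment> \<open>The base component h of the horizontal direction is constant, so the
      derivative of this direction is vertical.\<close>
    have 1: "((\<lambda>p. (h, - G p h (snd p))) has_derivative
      (\<lambda>\<xi>. (0, - (fD (\<lambda>p. G p h (snd q)) q \<xi> + G q h (snd \<xi>))))) (at q)"
      by (intro has_derivative_Pair has_derivative_const has_derivative_minus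
          has_derivative_family[OF open_chart_dom q linear_G_right smooth_on_has_derivative[OF smooth_on_G q]]
          has_derivative_snd has_derivative_ident)
    have "fD (\<lambda>p. fD f p (h, - G p h (snd p))) q = (\<lambda>\<xi>. fD (\<lambda>p. fD f p (h, - G q h (snd q))) q \<xi> +
        fD f q (0, - (fD (\<lambda>p. G p h (snd q)) q \<xi> + G q h (snd \<xi>))))"
      by (rule fD_eqI[OF has_derivative_family[OF open_chart_dom q smooth_on_linear_fD[OF f]
          smooth_on_has_derivative[OF smooth_on_fD_const[OF f] q] 1]])
    then show ?thesis
      by (simp add: hor_def[abs_def] linear_neg[OF linear_G_right[OF q]])
  qed
  have neg: "fD f q (0, - x) = - fD f q (0, x)" and diff: "fD f q (0, x - y) = fD f q (0, x) - fD f q (0, y)"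
    and add: "fD f q (0, x + y) = fD f q (0, x) + fD f q (0, y)" for x y
    using linear_neg[OF smooth_on_linear_fD[OF f q], of "(0, x)"]
      linear_diff[OF smooth_on_linear_fD[OF f q], of "(0, x)" "(0, y)"]
      linear_add[OF smooth_on_linear_fD[OF f q], of "(0, x)" "(0, y)"] by simp_all
  show ?thesis
    unfolding hor_hor smooth_on_fD_symmetric[OF open_chart_dom f q, of "(h, - G q h (snd q))" "(i, - G q i (snd q))"] Rm_def
    by (simp add: neg diff add)
qed

lemma smooth_trilinear_Rm: "smooth_trilinear chart_dom Rm"
  unfolding smooth_trilinear_def smooth_bilinear_def
proof (intro conjI ballI allI open_chart_dom)
  note lin = linear_G_left linear_G_right linear_hor_direction[OF _ smooth_on_G]
    linear_compose[OF linear_G_right linear_G_right, unfolded comp_def]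
    linear_compose[OF linear_G_left linear_G_right, unfolded comp_def]
  have hor_left: "linear (\<lambda>k. hor h (\<lambda>p. G p k l) q)" and hor_right: "linear (\<lambda>l. hor h (\<lambda>p. G p k l) q)"
    if "q \<in> chart_dom" for q h k l
    unfolding hor_def
    using linear_fD_family[OF open_chart_dom that smooth_on_G linear_G_left]
      linear_fD_family[OF open_chart_dom that smooth_on_G linear_G_right] by blast+
  fix h k l
  show "linear (\<lambda>h. Rm q h k l)" "linear (\<lambda>k. Rm q h k l)" "linear (Rm q h k)" if "q \<in> chart_dom" for q
    unfolding Rm_def[abs_def] using that
    by (intro linear_compose_add linear_compose_sub lin hor_left hor_right; simp)+
  show "smooth_on chart_dom (\<lambda>q. Rm q h k l)"
    unfolding Rm_def[abs_def]
    by (intro smooth_on_add smooth_on_diff open_chart_dom smooth_on_hor smooth_on_G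
        smooth_on_family[OF open_chart_dom smooth_on_G linear_G_right])
qed

text \<open>Alternating in X and Y removes the second derivatives of Z and the sum G(X, DZ(Y)) +
  G(Y, DZ(X)), which are symmetric. The terms with DY(X) - DX(Y), inserted into DZ and into the
  first slot of G, are those of the covariant derivative along the bracket.\<close>

lemma curvature_field_props:
  assumes v: "v \<in> A" "base v \<in> W" and X: "X \<in> vector_fields \<A>" and Y: "Y \<in> vector_fields \<A>" and Z: "Z \<in> vector_fields \<A>"
  shows "curvature_field \<A> A nabla v X Y Z \<in> tangent_space \<A> (base v)"
    and "coord (curvature_field \<A> A nabla v X Y Z) c =
      Rm (bundle_chart c v) (coord (X (base v)) c) (coord (Y (base v)) c) (coord (Z (base v)) c)"
proof -
  let ?q = "bundle_chart c v"
  have p: "base v \<in> cdom c" using v W_cdom by blast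
  note q = chart_domI[OF v]
  note XY = lie_bracket_in_vector_fields[OF X Y]
  note n1 = nabla_aniso_props[OF v X chart_field_nabla[OF Y Z]]
  note n2 = nabla_aniso_props[OF v Y chart_field_nabla[OF X Z]]
  show "curvature_field \<A> A nabla v X Y Z \<in> tangent_space \<A> (base v)"
    unfolding curvature_field_def
    by (intro tangent_space_diff n1(1) n2(1) nabla_in[OF v(1) XY Z])
  have x: "cmap c (base v) = fst ?q" "coord v c = snd ?q" by (simp_all add: bundle_chart_def)
  have U: "open (cmap c ` cdom c)" "fst ?q \<in> cmap c ` cdom c"
    using open_cimage_cdom[OF c] fst_chart_dom_cdom[OF q] by auto
  note Zs = vector_fields_smooth[OF Z c]
  have hh: "hor h (hat (\<lambda>v. nabla v Y Z)) ?q =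
      fD (\<lambda>x. fD (loc c Z) x (coord (Y (base v)) c)) (fst ?q) h + fD (loc c Z) (fst ?q) (fD (loc c Y) (fst ?q) h) +
      (hor h (\<lambda>p. G p (coord (Y (base v)) c) (coord (Z (base v)) c)) ?q
       + G ?q (fD (loc c Y) (fst ?q) h) (coord (Z (base v)) c) + G ?q (coord (Y (base v)) c) (fD (loc c Z) (fst ?q) h))"
    if "Y \<in> vector_fields \<A>" for h Y
    unfolding hor_def fD_eqI[OF hat_nabla_has_derivative[OF q that Z]]
    by (simp add: loc_bundle_chart v)
  show "coord (curvature_field \<A> A nabla v X Y Z) c =
      Rm ?q (coord (X (base v)) c) (coord (Y (base v)) c) (coord (Z (base v)) c)"
    unfolding curvature_field_def coord_tvec n1(2) n2(2) coord_nabla[OF v XY Z] hh[OF X] hh[OF Y]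
      hat_nabla[OF q X Z] hat_nabla[OF q Y Z] lie_bracket_props(2)[OF X Y c p] loc_bundle_chart[OF v(2)] x Rm_def
      smooth_on_fD_symmetric[OF U(1) Zs U(2), of "coord (X (base v)) c" "coord (Y (base v)) c"]
    by (simp add: linear_add[OF linear_G_right[OF q]] linear_diff[OF linear_G_left[OF q]]
        linear_diff[OF smooth_on_linear_fD[OF Zs U(2)]])
qed

text \<open>The formula for fields contains only their values at \<open>base v\<close>, so the
  extensions chosen by \<open>ext\<close> leave no trace.\<close>

lemma curvature_props:
  assumes v: "v \<in> A" "base v \<in> W"
    and u: "x \<in> tangent_space \<A> (base v)" "y \<in> tangent_space \<A> (base v)" "z \<in> tangent_space \<A> (base v)"
  shows "curvature \<A> A nabla v x y z \<in> tangent_space \<A> (base v)"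
    and "coord (curvature \<A> A nabla v x y z) c = Rm (bundle_chart c v) (coord x c) (coord y c) (coord z c)"
  using curvature_field_props[OF v ext_props(1)[OF u(1)] ext_props(1)[OF u(2)] ext_props(1)[OF u(3)]]
  by (simp_all add: curvature_def ext_props(2)[OF u(1)] ext_props(2)[OF u(2)] ext_props(2)[OF u(3)])

text \<open>The derivative parts DY(X) - DX(Y) of the two covariant derivatives are exactly the
  components of the Lie bracket.\<close>

lemma torsion_props:
  assumes v: "v \<in> A" "base v \<in> W" and u: "x \<in> tangent_space \<A> (base v)" "y \<in> tangent_space \<A> (base v)"
  shows "torsion \<A> nabla v x y \<in> tangent_space \<A> (base v)"
    and "coord (torsion \<A> nabla v x y) c =
      G (bundle_chart c v) (coord x c) (coord y c) - G (bundle_chart c v) (coord y c) (coord x c)"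
proof -
  have p: "base v \<in> cdom c" using v W_cdom by blast
  note X = ext_props(1)[OF u(1)] and Y = ext_props(1)[OF u(2)]
  show "torsion \<A> nabla v x y \<in> tangent_space \<A> (base v)"
    unfolding torsion_def torsion_field_def
    by (intro tangent_space_diff nabla_in v X Y lie_bracket_props)
  show "coord (torsion \<A> nabla v x y) c =
      G (bundle_chart c v) (coord x c) (coord y c) - G (bundle_chart c v) (coord y c) (coord x c)"
    unfolding torsion_def torsion_field_def coord_tvec coord_nabla[OF v X Y] coord_nabla[OF v Y X]
      lie_bracket_props(2)[OF X Y c p] ext_props(2)[OF u(1)] ext_props(2)[OF u(2)]
    by simp
qed

text \<open>In a vertical direction the base component vanishes, and with it every term that
  differentiates the extensions of x and y.\<close>

lemma vert_conn_props:
  assumes v: "v \<in> A" "base v \<in> W"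
    and u: "x \<in> tangent_space \<A> (base v)" "y \<in> tangent_space \<A> (base v)" "z \<in> tangent_space \<A> (base v)"
  shows "vert_conn \<A> nabla v x y z \<in> tangent_space \<A> (base v)"
    and "coord (vert_conn \<A> nabla v x y z) c = fD (\<lambda>q. G q (coord x c) (coord y c)) (bundle_chart c v) (0, coord z c)"
proof -
  note X = ext_props[OF u(1)] and Y = ext_props[OF u(2)]
  note q = chart_domI[OF v]
  note vd = vert_deriv_props[OF v chart_field_nabla[OF X(1) Y(1)] u(3)]
  have *: "vert_conn \<A> nabla v x y z = vert_deriv (\<lambda>v'. nabla v' (ext \<A> x) (ext \<A> y)) v z"
    by (simp add: vert_conn_def vert_conn_field_def ext_props(2)[OF u(3)])
  show "vert_conn \<A> nabla v x y z \<in> tangent_space \<A> (base v)"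
    unfolding * by (rule vd(1))
  have U: "fst (bundle_chart c v) \<in> cmap c ` cdom c" by (rule fst_chart_dom_cdom[OF q])
  note l0 = linear_0[OF smooth_on_linear_fD[OF vector_fields_smooth[OF X(1) c] U]]
    linear_0[OF smooth_on_linear_fD[OF vector_fields_smooth[OF Y(1) c] U]]
    linear_0[OF smooth_on_linear_fD[OF smooth_on_fD_const[OF vector_fields_smooth[OF Y(1) c]] U]]
  show "coord (vert_conn \<A> nabla v x y z) c = fD (\<lambda>q. G q (coord x c) (coord y c)) (bundle_chart c v) (0, coord z c)"
    unfolding * vd(2) fD_eqI[OF hat_nabla_has_derivative[OF q X(1) Y(1)]] loc_bundle_chart[OF v(2)] X(2) Y(2)
    by (simp add: l0 linear_0[OF linear_G_left[OF q]] linear_0[OF linear_G_right[OF q]])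
qed

text \<open>The formula is demanded at every v over W, since a covariant derivative of T
  differentiates T in v.\<close>

definition represents2 where
  "represents2 T S \<longleftrightarrow> smooth_bilinear chart_dom S \<and>
    (\<forall>v\<in>A. base v \<in> W \<longrightarrow> (\<forall>x\<in>tangent_space \<A> (base v). \<forall>y\<in>tangent_space \<A> (base v).
      T v x y \<in> tangent_space \<A> (base v) \<and> coord (T v x y) c = S (bundle_chart c v) (coord x c) (coord y c)))"

definition represents3 where
  "represents3 T S \<longleftrightarrow> smooth_trilinear chart_dom S \<and>
    (\<forall>v\<in>A. base v \<in> W \<longrightarrow> (\<forall>x\<in>tangent_space \<A> (base v). \<forall>y\<in>tangent_space \<A> (base v). \<forall>z\<in>tangent_space \<A> (base v).
      T v x y z \<in> tangent_space \<A> (base v) \<and>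
      coord (T v x y z) c = S (bundle_chart c v) (coord x c) (coord y c) (coord z c)))"

text \<open>The derivatives of the components of the extensions of x and y arise once from
  differentiating the field \<open>?Y\<close> and once from the covariant derivatives inside T, with
  opposite signs. After cancellation only values at \<open>base v\<close> remain.\<close>

lemma nabla_tensor2_props:
  assumes T: "represents2 T S" and v: "v \<in> A" "base v \<in> W"
    and u: "u \<in> tangent_space \<A> (base v)" "x \<in> tangent_space \<A> (base v)" "y \<in> tangent_space \<A> (base v)"
  defines "q \<equiv> bundle_chart c v"
  shows "nabla_tensor2 \<A> A nabla T v u x y \<in> tangent_space \<A> (base v)"
    and "coord (nabla_tensor2 \<A> A nabla T v u x y) c = 
      hor (coord u c) (\<lambda>p. S p (coord x c) (coord y c)) q + G q (coord u c) (S q (coord x c) (coord y c))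
      - S q (G q (coord u c) (coord x c)) (coord y c) - S q (coord x c) (G q (coord u c) (coord y c))"
proof -
  note U = ext_props[OF u(1)] and X = ext_props[OF u(2)] and Y = ext_props[OF u(3)]
  note q = chart_domI[OF v, folded q_def]
  have S: "smooth_bilinear chart_dom S" using T by (simp add: represents2_def)
  have T': "T v x y \<in> tangent_space \<A> (base v)" "coord (T v x y) c = S (bundle_chart c v) (coord x c) (coord y c)"
    if "v \<in> A" "base v \<in> W" "x \<in> tangent_space \<A> (base v)" "y \<in> tangent_space \<A> (base v)" for v x y
    using T that by (auto simp: represents2_def)
  let ?Y = "\<lambda>v'. T v' (ext \<A> x (base v')) (ext \<A> y (base v'))"
  have hat: "hat ?Y p = S p (loc c (ext \<A> x) (fst p)) (loc c (ext \<A> y) (fst p))" if "p \<in> chart_dom" for p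
    using T'(2)[OF chart_dom_props(1,2)[OF that] vector_fields_in[OF X(1)] vector_fields_in[OF Y(1)]]
    by (simp add: hat_def chart_dom_props[OF that])
  note Xs = vector_fields_smooth[OF X(1) c] and Ys = vector_fields_smooth[OF Y(1) c]
  have "chart_field ?Y"
    unfolding chart_field_def
  proof (intro conjI ballI impI)
    show "smooth_on chart_dom (hat ?Y)"
      by (rule smooth_on_cong[OF open_chart_dom smooth_bilinear_smooth_on[OF S smooth_on_comp_fst[OF Xs] smooth_on_comp_fst[OF Ys]]])
        (simp add: hat)
  qed (intro T' vector_fields_in X Y)
  note n = nabla_aniso_props[OF v U(1) this, folded q_def]
  have "(hat ?Y has_derivative (\<lambda>\<xi>. fD (\<lambda>p. S p (coord x c) (coord y c)) q \<xi> +
      S q (fD (loc c (ext \<A> x)) (fst q) (fst \<xi>)) (coord y c) + S q (coord x c) (fD (loc c (ext \<A> y)) (fst q) (fst \<xi>)))) (at q)"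
    using has_derivative_transform_within_open[OF smooth_bilinear_has_derivative[OF S q
        comp_fst_has_derivative[OF Xs q] comp_fst_has_derivative[OF Ys q]] open_chart_dom q hat[symmetric]]
    by (simp add: q_def loc_bundle_chart[OF v(2)] X(2) Y(2))
  note D = fD_eqI[OF this]
  have x: "cmap c (base v) = fst q" by (simp add: q_def bundle_chart_def)
  have *: "nabla_tensor2 \<A> A nabla T v u x y = nabla_aniso \<A> A nabla v (ext \<A> u) ?Y -
     T v (nabla v (ext \<A> u) (ext \<A> x)) y - T v x (nabla v (ext \<A> u) (ext \<A> y))"
    by (simp add: nabla_tensor2_def nabla_tensor2_field_def X(2) Y(2))
  note t1 = T'[OF v nabla_in[OF v(1) U(1) X(1)] u(3), folded q_def]
    and t2 = T'[OF v u(2) nabla_in[OF v(1) U(1) Y(1)], folded q_def]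
  show "nabla_tensor2 \<A> A nabla T v u x y \<in> tangent_space \<A> (base v)"
    unfolding * by (intro tangent_space_diff n(1) t1(1) t2(1))
  show "coord (nabla_tensor2 \<A> A nabla T v u x y) c = 
      hor (coord u c) (\<lambda>p. S p (coord x c) (coord y c)) q + G q (coord u c) (S q (coord x c) (coord y c))
      - S q (G q (coord u c) (coord x c)) (coord y c) - S q (coord x c) (G q (coord u c) (coord y c))"
    unfolding * coord_tvec n(2) t1(2) t2(2) coord_nabla[OF v U(1) X(1), folded q_def] coord_nabla[OF v U(1) Y(1), folded q_def]
      hor_def D hat[OF q]
    by (simp add: U(2) X(2) Y(2) x loc_bundle_chart[OF v(2), folded q_def]
        linear_add[OF smooth_bilinearD(2)[OF S q]] linear_add[OF smooth_bilinearD(3)[OF S q]])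
qed

text \<open>The same cancellation, now in three slots.\<close>

lemma nabla_tensor3_props:
  assumes T: "represents3 T S" and v: "v \<in> A" "base v \<in> W"
    and u: "u \<in> tangent_space \<A> (base v)" "x \<in> tangent_space \<A> (base v)" "y \<in> tangent_space \<A> (base v)" "z \<in> tangent_space \<A> (base v)"
  defines "q \<equiv> bundle_chart c v"
  shows "nabla_tensor3 \<A> A nabla T v u x y z \<in> tangent_space \<A> (base v)"
    and "coord (nabla_tensor3 \<A> A nabla T v u x y z) c = 
      hor (coord u c) (\<lambda>p. S p (coord x c) (coord y c) (coord z c)) q
      + G q (coord u c) (S q (coord x c) (coord y c) (coord z c))
      - S q (G q (coord u c) (coord x c)) (coord y c) (coord z c)
      - S q (coord x c) (G q (coord u c) (coord y c)) (coord z c)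
      - S q (coord x c) (coord y c) (G q (coord u c) (coord z c))"
proof -
  note U = ext_props[OF u(1)] and X = ext_props[OF u(2)] and Y = ext_props[OF u(3)] and Z = ext_props[OF u(4)]
  note q = chart_domI[OF v, folded q_def]
  have S: "smooth_trilinear chart_dom S" using T by (simp add: represents3_def)
  have T': "T v x y z \<in> tangent_space \<A> (base v)"
    "coord (T v x y z) c = S (bundle_chart c v) (coord x c) (coord y c) (coord z c)"
    if "v \<in> A" "base v \<in> W" "x \<in> tangent_space \<A> (base v)" "y \<in> tangent_space \<A> (base v)" "z \<in> tangent_space \<A> (base v)" for v x y z
    using T that by (auto simp: represents3_def)
  let ?Y = "\<lambda>v'. T v' (ext \<A> x (base v')) (ext \<A> y (base v')) (ext \<A> z (base v'))"
  have hat: "hat ?Y p = S p (loc c (ext \<A> x) (fst p)) (loc c (ext \<A> y) (fst p)) (loc c (ext \<A> z) (fst p))" if "p \<in> chart_dom" for p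
    using T'(2)[OF chart_dom_props(1,2)[OF that] vector_fields_in[OF X(1)] vector_fields_in[OF Y(1)] vector_fields_in[OF Z(1)]]
    by (simp add: hat_def chart_dom_props[OF that])
  note Xs = vector_fields_smooth[OF X(1) c] and Ys = vector_fields_smooth[OF Y(1) c] and Zs = vector_fields_smooth[OF Z(1) c]
  have "chart_field ?Y"
    unfolding chart_field_def
  proof (intro conjI ballI impI)
    show "smooth_on chart_dom (hat ?Y)"
      by (rule smooth_on_cong[OF open_chart_dom smooth_trilinear_smooth_on[OF S
            smooth_on_comp_fst[OF Xs] smooth_on_comp_fst[OF Ys] smooth_on_comp_fst[OF Zs]]])
        (simp add: hat)
  qed (intro T' vector_fields_in X Y Z)
  note n = nabla_aniso_props[OF v U(1) this, folded q_def]
  have "(hat ?Y has_derivative (\<lambda>\<xi>. fD (\<lambda>p. S p (coord x c) (coord y c) (coord z c)) q \<xi> +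
      S q (fD (loc c (ext \<A> x)) (fst q) (fst \<xi>)) (coord y c) (coord z c) +
      S q (coord x c) (fD (loc c (ext \<A> y)) (fst q) (fst \<xi>)) (coord z c) +
      S q (coord x c) (coord y c) (fD (loc c (ext \<A> z)) (fst q) (fst \<xi>)))) (at q)"
    using has_derivative_transform_within_open[OF smooth_trilinear_has_derivative[OF S q
        comp_fst_has_derivative[OF Xs q] comp_fst_has_derivative[OF Ys q] comp_fst_has_derivative[OF Zs q]]
        open_chart_dom q hat[symmetric]]
    by (simp add: q_def loc_bundle_chart[OF v(2)] X(2) Y(2) Z(2))
  note D = fD_eqI[OF this]
  have x: "cmap c (base v) = fst q" by (simp add: q_def bundle_chart_def)
  have *: "nabla_tensor3 \<A> A nabla T v u x y z = nabla_aniso \<A> A nabla v (ext \<A> u) ?Y -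
     T v (nabla v (ext \<A> u) (ext \<A> x)) y z - T v x (nabla v (ext \<A> u) (ext \<A> y)) z
     - T v x y (nabla v (ext \<A> u) (ext \<A> z))"
    by (simp add: nabla_tensor3_def nabla_tensor3_field_def X(2) Y(2) Z(2))
  note t1 = T'[OF v nabla_in[OF v(1) U(1) X(1)] u(3,4), folded q_def]
    and t2 = T'[OF v u(2) nabla_in[OF v(1) U(1) Y(1)] u(4), folded q_def]
    and t3 = T'[OF v u(2,3) nabla_in[OF v(1) U(1) Z(1)], folded q_def]
  show "nabla_tensor3 \<A> A nabla T v u x y z \<in> tangent_space \<A> (base v)"
    unfolding * by (intro tangent_space_diff n(1) t1(1) t2(1) t3(1))
  note bil = smooth_trilinearD(1)[OF S]
  show "coord (nabla_tensor3 \<A> A nabla T v u x y z) c = 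
      hor (coord u c) (\<lambda>p. S p (coord x c) (coord y c) (coord z c)) q
      + G q (coord u c) (S q (coord x c) (coord y c) (coord z c))
      - S q (G q (coord u c) (coord x c)) (coord y c) (coord z c)
      - S q (coord x c) (G q (coord u c) (coord y c)) (coord z c)
      - S q (coord x c) (coord y c) (G q (coord u c) (coord z c))"
    unfolding * coord_tvec n(2) t1(2) t2(2) t3(2) coord_nabla[OF v U(1) X(1), folded q_def]
      coord_nabla[OF v U(1) Y(1), folded q_def] coord_nabla[OF v U(1) Z(1), folded q_def]
      hor_def D hat[OF q]
    by (simp add: U(2) X(2) Y(2) Z(2) x loc_bundle_chart[OF v(2), folded q_def]
        linear_add[OF smooth_bilinearD(2)[OF bil q]] linear_add[OF smooth_bilinearD(3)[OF bil q]]
        linear_add[OF smooth_trilinearD(2)[OF S q]])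
qed

lemma represents2_torsion: "represents2 (torsion \<A> nabla) (\<lambda>q h k. G q h k - G q k h)"
  unfolding represents2_def smooth_bilinear_def
  using torsion_props
  by (auto intro!: linear_compose_sub linear_G_left linear_G_right smooth_on_diff open_chart_dom smooth_on_G)

lemma represents3_curvature: "represents3 (curvature \<A> A nabla) Rm"
  unfolding represents3_def using curvature_props smooth_trilinear_Rm by blast

section \<open>The Bianchi identities in a chart\<close>

text \<open>The terms T(T(u, w), z) - T(G(u, w), z) - T(w, G(u, z)) equal T(G(u, z), w) - T(G(w, u),
  z) and vanish in the cyclic sum. The rest, \<delta>\<delta>-free, is the horizontal derivative of
  T(w, z) along u plus G(u, T(w, z)); splitting T and relabelling cyclically turns it into the
  curvature terms.\<close>

lemma first_Bianchi_chart:
  assumes q: "q \<in> chart_dom"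
  defines "T \<equiv> \<lambda>p h k. G p h k - G p k h"
  shows "cyclic_sum (Rm q) u w z = cyclic_sum (\<lambda>u w z. T q (T q u w) z +
    (hor u (\<lambda>p. T p w z) q + G q u (T q w z) - T q (G q u w) z - T q w (G q u z))) u w z"
  unfolding cyclic_sum_def T_def Rm_def
  by (simp add: hor_diff[OF q smooth_on_G smooth_on_G] linear_diff[OF linear_G_left[OF q]] linear_diff[OF linear_G_right[OF q]])

text \<open>The terms with G in the first two slots of R cancel against the torsion term. In the
  rest, the second horizontal derivatives combine to commutators, whose vertical derivatives of G
  are cancelled by the P term; the products of G with its horizontal derivative and the triple
  products of G cancel as in the Jacobi identity.\<close>

lemma second_Bianchi_chart:
  assumes q: "q \<in> chart_dom"
  shows "cyclic_sum (\<lambda>u w z. 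
      (hor u (\<lambda>p. Rm p w z b) q + G q u (Rm q w z b) - Rm q (G q u w) z b - Rm q w (G q u z) b - Rm q w z (G q u b))
      - fD (\<lambda>p. G p w b) q (0, Rm q u z (snd q)) + Rm q (G q u w - G q w u) z b) u w z = 0"
proof -
  have swap: "Rm q h k l = - Rm q k h l" for h k l by (simp add: Rm_def)
  have GG: "smooth_on chart_dom (\<lambda>p. G p h (G p k l))" for h k l
    by (rule smooth_on_family[OF open_chart_dom smooth_on_G linear_G_right smooth_on_G])
  have hor_Rm: "hor i (\<lambda>p. Rm p h k l) q =
      hor i (hor h (\<lambda>p. G p k l)) q - hor i (hor k (\<lambda>p. G p h l)) q +
      (hor i (\<lambda>p. G p h (G q k l)) q + G q h (hor i (\<lambda>p. G p k l) q)) -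
      (hor i (\<lambda>p. G p k (G q h l)) q + G q k (hor i (\<lambda>p. G p h l) q))" for i h k l
    unfolding Rm_def[abs_def]
    by (simp add: hor_add hor_diff q smooth_on_hor smooth_on_G GG smooth_on_diff smooth_on_add open_chart_dom hor_G)
  have comm: "hor i (hor h (\<lambda>p. G p k l)) q = hor h (hor i (\<lambda>p. G p k l)) q - fD (\<lambda>p. G p k l) q (0, Rm q i h (snd q))" for i h k l
    using hor_commutator[OF q smooth_on_G, of i h k l] by (simp add: algebra_simps)
  have neg: "fD (\<lambda>p. G p k l) q (0, - x) = - fD (\<lambda>p. G p k l) q (0, x)" for k l x
    using linear_neg[OF smooth_on_linear_fD[OF smooth_on_G q], of k l "(0, x)"] by simp
  have G_Rm: "G q i (Rm q h k l) = G q i (hor h (\<lambda>p. G p k l) q) - G q i (hor k (\<lambda>p. G p h l) q)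
      + G q i (G q h (G q k l)) - G q i (G q k (G q h l))" for i h k l
    unfolding Rm_def by (simp add: linear_diff[OF linear_G_right[OF q]] linear_add[OF linear_G_right[OF q]])
  have Rm_G: "Rm q h k (G q i l) = hor h (\<lambda>p. G p k (G q i l)) q - hor k (\<lambda>p. G p h (G q i l)) q
      + G q h (G q k (G q i l)) - G q k (G q h (G q i l))" for i h k l
    by (simp add: Rm_def)
  have "Rm q (G q u w - G q w u) z b = Rm q (G q u w) z b - Rm q (G q w u) z b" for u w z
    by (rule linear_diff[OF smooth_bilinearD(2)[OF smooth_trilinearD(1)[OF smooth_trilinear_Rm] q]])
  note diff = this
  \<comment> \<open>\<open>comm\<close> and \<open>swap\<close> exchange two arguments and would
    loop as general rewrite rules; the instances bring each pair into one fixed order, so that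
    opposite terms become syntactically equal up to sign.\<close>
  show ?thesis
    unfolding cyclic_sum_def hor_Rm G_Rm Rm_G diff
      comm[of u w] comm[of w z] comm[of z u] swap[of w "G q u z"] swap[of z "G q w u"] swap[of u "G q z w"]
      swap[of u z] swap[of w u] swap[of z w] neg
    by simp
qed

end

theorem proposition2p14:
  fixes \<A> :: "('a::{t2_space, second_countable_topology}, 'e::euclidean_space) chart set"
    and A :: "('a, 'e) tvec set"
    and nabla :: "('a, 'e) conn"
  assumes "smooth_atlas \<A>"
    and "open_in_tangent_bundle \<A> A"
    and "base ` A = UNIV"
    and "anisotropic_connection \<A> A nabla"
    and "v \<in> A"
    and "u \<in> tangent_space \<A> (base v)"
    and "w \<in> tangent_space \<A> (base v)"
    and "z \<in> tangent_space \<A> (base v)"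
    and "b \<in> tangent_space \<A> (base v)"
  shows "let R = curvature \<A> A nabla; P = vert_conn \<A> nabla; \<T> = torsion \<A> nabla in
     (\<forall>x\<in>tangent_space \<A> (base v). R v u w x = - R v w u x) \<and>
     cyclic_sum (\<lambda>u w z. R v u w z) u w z =
       cyclic_sum (\<lambda>u w z. \<T> v (\<T> v u w) z + nabla_tensor2 \<A> A nabla \<T> v u w z) u w z \<and>
     cyclic_sum (\<lambda>u w z. nabla_tensor3 \<A> A nabla R v u w z b
         - P v w b (R v u z v) + R v (\<T> v u w) z b) u w z = zero_vec (base v)"
proof -
  interpret connection \<A> A nabla
    using assms(1,2,4) by unfold_locales
  let ?p = "base v"
  \<comment> \<open>All vectors in the claim belong to the tangent space at \<open>base v\<close>,
    so one chart and one cutoff function around this point serve for the whole proof.\<close>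
  obtain c where cp: "c \<in> \<A>" "?p \<in> cdom c" using chart_exists .
  obtain \<phi> W K where \<phi>: "cutoff \<phi> W K" "?p \<in> W" "K \<subseteq> cdom c" using cutoff_exists[OF open_cdom[OF cp(1)] cp(2)] .
  interpret connection_chart \<A> A nabla c \<phi> W K
    using cp(1) \<phi>(1,3) by unfold_locales
  note v = assms(5) \<phi>(2)
  note q = chart_domI[OF v]
  have vt: "v \<in> tangent_space \<A> ?p" by (rule A_tangent[OF v(1)])
  note R = curvature_props[OF v] and T = torsion_props[OF v] and P = vert_conn_props[OF v]
    and DT = nabla_tensor2_props[OF represents2_torsion v] and DR = nabla_tensor3_props[OF represents3_curvature v]
  note ts = assms(6-9) vt
  \<comment> \<open>In R(u, z)v the vector v is both the reference direction and an argument; as an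
    argument it contributes the fibre coordinate of the point of \<open>chart_dom\<close>.\<close>
  have y: "coord v c = snd (bundle_chart c v)" by (simp add: bundle_chart_def)
  have skew: "curvature \<A> A nabla v u w x = - curvature \<A> A nabla v w u x" if x: "x \<in> tangent_space \<A> ?p" for x
    by (rule tangent_eqI[OF _ _ cp]) (use ts x cp in \<open>auto intro!: R tangent_space_minus simp: R(2) Rm_def\<close>)
  have first: "cyclic_sum (\<lambda>u w z. curvature \<A> A nabla v u w z) u w z =
      cyclic_sum (\<lambda>u w z. torsion \<A> nabla v (torsion \<A> nabla v u w) z
        + nabla_tensor2 \<A> A nabla (torsion \<A> nabla) v u w z) u w z"
  proof (rule tangent_eqI[OF _ _ cp])
    show "coord (cyclic_sum (\<lambda>u w z. curvature \<A> A nabla v u w z) u w z) c =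
      coord (cyclic_sum (\<lambda>u w z. torsion \<A> nabla v (torsion \<A> nabla v u w) z
        + nabla_tensor2 \<A> A nabla (torsion \<A> nabla) v u w z) u w z) c"
      using first_Bianchi_chart[OF q, of "coord u c" "coord w c" "coord z c"]
      unfolding cyclic_sum_def coord_tvec by (simp only: R(2) T DT(2) ts)
  qed (unfold cyclic_sum_def, (intro tangent_space_add R(1) T(1) DT(1) ts)+)
  have second: "cyclic_sum (\<lambda>u w z. nabla_tensor3 \<A> A nabla (curvature \<A> A nabla) v u w z b
      - vert_conn \<A> nabla v w b (curvature \<A> A nabla v u z v)
      + curvature \<A> A nabla v (torsion \<A> nabla v u w) z b) u w z = zero_vec ?p" (is "?L = _")
  proof (rule tangent_eqI[OF _ zero_vec_in cp])
    show "coord ?L c = coord (zero_vec ?p) c"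
      using second_Bianchi_chart[OF q, of "coord b c" "coord u c" "coord w c" "coord z c"]
      unfolding cyclic_sum_def coord_tvec by (simp only: R T P(2) DR(2) ts y)
  qed (unfold cyclic_sum_def, (intro tangent_space_add tangent_space_diff R(1) T(1) DR(1) P(1) ts)+)
  show ?thesis
    unfolding Let_def using skew first second by blast
qed

end
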